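(* Let $[S,T]\subseteq\mathbb{R}$ be an interval and let $n\in\mathbb{N}$. Let $p\in[1,3)$, let $\omega$ be a control function on $[S,T]$, and let $X$ be an $n$-dimensional branched rough path on $[S,T]$ with regularity $p$ and control $\omega$. Let $M$ be a manifold, let $f:M\to R_n^2M$ be an admissible rough velocity field, and let $Y_0\in M$. Then there exist $\varepsilon\in(0,\infty)$ and an integral curve $Y:[S,\min\{S+\varepsilon,T\}]\to M$ of $f$ driven by $X$ that satisfies $Y(S)=Y_0$.
   Context: Smooth means $C^\infty$; manifolds are smooth and finite-dimensional; superscripts $i$ denote coordinates. For $I\subseteq\mathbb{R}$, $\Delta I:=\{(s,t)\in I^2: s\le t\}$. A control function on $[S,T]$ is a continuous function $\omega:\Delta[S,T]\to[0,\infty)$ with $\omega(s,s)=0$ for all $s$ and $\omega(s,t)\ge\omega(s,u)+\omega(u,t)$ for all $S\le s\le u\le t\le T$. $\mathcal{F}_n^2$ is the set of non-empty forests of rooted trees with at most two vertices, with vertices labeled by $\{1,\dots,n\}$. Its elements are: the one-vertex trees, written $\alpha$; the forests made of two one-vertex trees, written $\alpha\cdot\beta=\beta\cdot\alpha$ (unordered, $\alpha=\beta$ allowed); and the two-vertex trees, written $\alpha|\beta$ (top vertex $\alpha$, bottom vertex $\beta$). The symmetry factor is $\sigma(\alpha)=1$, $\sigma(\alpha|\beta)=1$, $\sigma(\alpha\cdot\beta)=1$ if $\alpha\ne\beta$, and $\sigma(\alpha\cdot\alpha)=2$. For $p\in[1,3)$, an $n$-dimensional branched rough path on $[S,T]$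 with regularity $p$ and control $\omega$ is a tuple $X=(X^\tau)_{\tau\in\mathcal{F}_n^2}$ of functions $X^\tau:\Delta[S,T]\to\mathbb{R}$ such that for all $\alpha,\beta$ and all $S\le s\le u\le t\le T$: $X^\alpha(s,t)=X^\alpha(s,u)+X^\alpha(u,t)$; $X^{\alpha\cdot\beta}(s,t)=X^\alpha(s,t)X^\beta(s,t)$; $X^{\alpha|\beta}(s,t)=X^{\alpha|\beta}(s,u)+X^{\alpha|\beta}(u,t)+X^\alpha(s,u)X^\beta(u,t)$; and such that for some $C\in(0,\infty)$, $|X^\alpha(s,t)|\le C\omega(s,t)^{1/p}$, $|X^{\alpha\cdot\beta}(s,t)|\le C\omega(s,t)^{2/p}$, $|X^{\alpha|\beta}(s,t)|\le C\omega(s,t)^{2/p}$ for all $\alpha,\beta$ and $(s,t)\in\Delta[S,T]$. Rough velocity bundle. $F_{mn}^2$ is the real vector space of tuples $(f^i_\tau)$, $i\in\{1,\dots,m\}$, $\tau\in\mathcal{F}_n^2$. $G_m^2$ is the Lie group of invertible $2$-jets of smooth maps $\mathbb{R}^m\to\mathbb{R}^m$ with source and target $0$; a jet $a$ is written $(a^i_j,a^i_{jk})$ with $a^i_{jk}=a^i_{kj}$ (first and second partial derivatives at $0$). It acts on $F_{mn}^2$ from the left by $af=g$, $g^i_\alpha=\sum_j a^i_jf^j_\alpha$, $g^i_{\alpha\cdot\beta}=\sum_j a^i_jf^j_{\alpha\cdot\beta}+\sum_{j,k}a^i_{jk}f^j_\alpha f^k_\beta$, $g^i_{\alpha|\beta}=\sum_j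 a^i_jf^j_{\alpha|\beta}$. For an $m$-dimensional manifold $M$, let $P^2M$ be the second-order frame bundle ($2$-jets $j^2_0\psi$ at $0$ of local diffeomorphisms $\psi:\mathbb{R}^m\to M$), a principal $G_m^2$-bundle; $R_n^2M$ is the associated bundle with fiber $F_{mn}^2$, i.e. the set of classes $[(j_0^2\psi,f)]$ under $(j^2_0\psi,f)\sim(j^2_0(\psi\circ a),a^{-1}f)$, with projection $\pi[(j_0^2\psi,f)]=\psi(0)$. A chart $(U,x)$ on $M$ induces coordinates $(x^i,f^i_\tau)$ on $\pi^{-1}(U)$: the class $[(j_0^2\psi,f)]$ has base coordinates $x(\psi(0))$ and fiber coordinates $af$, where $a\in G_m^2$ consists of the first and second derivatives of $x\circ\psi$ at $0$. Under a change of charts from $(U,x)$ to $(V,y)$ the fiber coordinates at $p$ change by the action of the jet with $a^i_j=\frac{\partial y^i}{\partial x^j}(p)$, $a^i_{jk}=\frac{\partial^2y^i}{\partial x^j\partial x^k}(p)$. A rough velocity field on $M$ is a smooth section $f:M\to R_n^2M$; in a chart $(U,x)$ it is represented by smooth functions $f^i_\tau:U\to\mathbb{R}$. It is admissible if for every $p\in M$ there is a chart $(U,x)$ around $p$ in which $\sum_j\frac{\partial f^i_\beta}{\partial x^j}(p)f^j_\alpha(p)=f^i_{\alpha\cdot\beta}(p)+f^i_{\alpha|\beta}(p)$ for all $i,\alpha,\beta$ (this condition does not depend on the chart). For a compact interval $J\subseteq[S,T]$, a function $Y:J\to M$ is an integral curve of $f$ driven by $X$ (restricted to $\Delta J$)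 if it is continuous and if for every compact interval $I\subseteq J$ and every chart $(U,x)$ with $Y(I)\subseteq U$ there exists $C\in(0,\infty)$ such that $\left|Y^i(t)-Y^i(s)-\sum_{\tau\in\mathcal{F}_n^2}\frac{1}{\sigma(\tau)}f^i_\tau(Y(s))X^\tau(s,t)\right|\le C\omega(s,t)^{3/p}$ for every $i$ and $(s,t)\in\Delta I$, where $Y^i=x^i\circ Y$ and $(f^i_\tau)$ represents $f$ in the chart induced by $(U,x)$. *)

theory Defs
  imports "HOL-Analysis.Analysis" "HOL-Library.Uprod"
begin

section \<open>Smooth maps between open subsets of Euclidean space\<close>

text \<open>
  The dimension \<open>m\<close> is a natural number, \<open>m = 0\<close> included, so \<open>\<real>\<^sup>m\<close> is the library's
  \<open>Euclidean_space m\<close>: functions \<open>nat \<Rightarrow> real\<close> vanishing at all indices \<open>\<ge> m\<close>.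
  Coordinates are therefore numbered from \<open>0\<close> to \<open>m - 1\<close>.
\<close>

definition partial_deriv :: "nat \<Rightarrow> ((nat \<Rightarrow> real) \<Rightarrow> real) \<Rightarrow> (nat \<Rightarrow> real) \<Rightarrow> real" where
  "partial_deriv j F u = deriv (\<lambda>h. F (u(j := h))) (u j)"

primrec Ck_on :: "nat \<Rightarrow> nat \<Rightarrow> (nat \<Rightarrow> real) set \<Rightarrow> ((nat \<Rightarrow> real) \<Rightarrow> real) \<Rightarrow> bool" where
  "Ck_on m 0 W F \<longleftrightarrow> continuous_map (subtopology (Euclidean_space m) W) euclideanreal F"
| "Ck_on m (Suc k) W F \<longleftrightarrow>
     continuous_map (subtopology (Euclidean_space m) W) euclideanreal F \<and>
     (\<forall>j<m. (\<forall>u\<in>W. (\<lambda>h. F (u(j := h))) differentiable at (u j)) \<and>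
            Ck_on m k W (partial_deriv j F))"

definition smooth_on :: "nat \<Rightarrow> (nat \<Rightarrow> real) set \<Rightarrow> ((nat \<Rightarrow> real) \<Rightarrow> real) \<Rightarrow> bool" where
  "smooth_on m W F \<longleftrightarrow> (\<forall>k. Ck_on m k W F)"

definition smooth_map_on ::
    "nat \<Rightarrow> (nat \<Rightarrow> real) set \<Rightarrow> ((nat \<Rightarrow> real) \<Rightarrow> (nat \<Rightarrow> real)) \<Rightarrow> bool" where
  "smooth_map_on m W \<phi> \<longleftrightarrow> (\<forall>i<m. smooth_on m W (\<lambda>u. \<phi> u i))"

section \<open>Smooth manifolds\<close>

text \<open>
  A chart \<open>(U, x)\<close> carries a total function \<open>x\<close>, of which only the values on \<open>U\<close> matter.
  A smooth structure is given by its maximal atlas \<open>A\<close>, so that ``a chart on the manifold''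
  means an element of \<open>A\<close>.
\<close>

type_synonym 'a chart = "'a set \<times> ('a \<Rightarrow> nat \<Rightarrow> real)"

definition top_chart :: "nat \<Rightarrow> 'a topology \<Rightarrow> 'a chart \<Rightarrow> bool" where
  "top_chart m M = (\<lambda>(U, x). openin M U \<and> openin (Euclidean_space m) (x ` U) \<and>
     homeomorphic_map (subtopology M U) (subtopology (Euclidean_space m) (x ` U)) x)"

definition smoothly_compatible :: "nat \<Rightarrow> 'a chart \<Rightarrow> 'a chart \<Rightarrow> bool" where
  "smoothly_compatible m = (\<lambda>(U, x) (V, y).
     smooth_map_on m (x ` (U \<inter> V)) (\<lambda>u. y (inv_into U x u)) \<and>
     smooth_map_on m (y ` (U \<inter> V)) (\<lambda>v. x (inv_into V y v)))"

definition smooth_manifold :: "nat \<Rightarrow> 'a topology \<Rightarrow> 'a chart set \<Rightarrow> bool" where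
  "smooth_manifold m M A \<longleftrightarrow>
     Hausdorff_space M \<and> second_countable M \<and>
     (\<forall>c\<in>A. top_chart m M c) \<and>
     (\<Union>c\<in>A. fst c) = topspace M \<and>
     (\<forall>c\<in>A. \<forall>d\<in>A. smoothly_compatible m c d) \<and>
     (\<forall>c. top_chart m M c \<and> (\<forall>d\<in>A. smoothly_compatible m c d) \<longrightarrow> c \<in> A)"

section \<open>Forests with at most two vertices\<close>

text \<open>\<open>Dot (Upair \<alpha> \<beta>)\<close> is \<open>\<alpha> \<cdot> \<beta>\<close>; \<open>Stack \<alpha> \<beta>\<close> is the tree with top vertex \<open>\<alpha>\<close> and
  bottom vertex \<open>\<beta>\<close>.\<close>

datatype forest = Vertex nat | Dot "nat uprod" | Stack nat nat

definition forests :: "nat \<Rightarrow> forest set" where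
  "forests n = {Vertex \<alpha> | \<alpha>. \<alpha> \<in> {1..n}}
     \<union> {Dot (Upair \<alpha> \<beta>) | \<alpha> \<beta>. \<alpha> \<in> {1..n} \<and> \<beta> \<in> {1..n}}
     \<union> {Stack \<alpha> \<beta> | \<alpha> \<beta>. \<alpha> \<in> {1..n} \<and> \<beta> \<in> {1..n}}"

fun symmetry_factor :: "forest \<Rightarrow> real" where
  "symmetry_factor (Vertex \<alpha>) = 1"
| "symmetry_factor (Dot P) = (if proper_uprod P then 1 else 2)"
| "symmetry_factor (Stack \<alpha> \<beta>) = 1"

section \<open>Controls and branched rough paths\<close>

definition control :: "real \<Rightarrow> real \<Rightarrow> (real \<Rightarrow> real \<Rightarrow> real) \<Rightarrow> bool" where
  "control S T \<omega> \<longleftrightarrow>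
     continuous_on {(s, t). S \<le> s \<and> s \<le> t \<and> t \<le> T} (\<lambda>(s, t). \<omega> s t) \<and>
     (\<forall>s t. S \<le> s \<and> s \<le> t \<and> t \<le> T \<longrightarrow> 0 \<le> \<omega> s t) \<and>
     (\<forall>s\<in>{S..T}. \<omega> s s = 0) \<and>
     (\<forall>s u t. S \<le> s \<and> s \<le> u \<and> u \<le> t \<and> t \<le> T \<longrightarrow> \<omega> s u + \<omega> u t \<le> \<omega> s t)"

definition branched_rough_path ::
    "nat \<Rightarrow> real \<Rightarrow> real \<Rightarrow> real \<Rightarrow> (real \<Rightarrow> real \<Rightarrow> real) \<Rightarrow>
     (forest \<Rightarrow> real \<Rightarrow> real \<Rightarrow> real) \<Rightarrow> bool" where
  "branched_rough_path n S T p \<omega> X \<longleftrightarrow>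
     (\<forall>\<alpha>\<in>{1..n}. \<forall>\<beta>\<in>{1..n}. \<forall>s u t. S \<le> s \<and> s \<le> u \<and> u \<le> t \<and> t \<le> T \<longrightarrow>
        X (Vertex \<alpha>) s t = X (Vertex \<alpha>) s u + X (Vertex \<alpha>) u t \<and>
        X (Dot (Upair \<alpha> \<beta>)) s t = X (Vertex \<alpha>) s t * X (Vertex \<beta>) s t \<and>
        X (Stack \<alpha> \<beta>) s t = X (Stack \<alpha> \<beta>) s u + X (Stack \<alpha> \<beta>) u t
                            + X (Vertex \<alpha>) s u * X (Vertex \<beta>) u t) \<and>
     (\<exists>C>0. \<forall>\<alpha>\<in>{1..n}. \<forall>\<beta>\<in>{1..n}. \<forall>s t. S \<le> s \<and> s \<le> t \<and> t \<le> T \<longrightarrow>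
        \<bar>X (Vertex \<alpha>) s t\<bar> \<le> C * \<omega> s t powr (1 / p) \<and>
        \<bar>X (Dot (Upair \<alpha> \<beta>)) s t\<bar> \<le> C * \<omega> s t powr (2 / p) \<and>
        \<bar>X (Stack \<alpha> \<beta>) s t\<bar> \<le> C * \<omega> s t powr (2 / p))"

section \<open>Jets and their action on the fiber\<close>

text \<open>
  A 2-jet with source \<open>0\<close> is recorded by its first and second partial derivatives
  \<open>(a\<^sup>i\<^sub>j, a\<^sup>i\<^sub>j\<^sub>k)\<close>; the target point is not part of the data. Out-of-range entries of jets
  and of fiber elements are \<open>0\<close>, so that equality of functions is equality of tuples.
\<close>

type_synonym jet = "(nat \<Rightarrow> nat \<Rightarrow> real) \<times> (nat \<Rightarrow> nat \<Rightarrow> nat \<Rightarrow> real)"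

type_synonym fiber = "nat \<Rightarrow> forest \<Rightarrow> real"

abbreviation origin :: "nat \<Rightarrow> real" where
  "origin \<equiv> (\<lambda>_. 0)"

definition jet2 :: "nat \<Rightarrow> ((nat \<Rightarrow> real) \<Rightarrow> (nat \<Rightarrow> real)) \<Rightarrow> jet" where
  "jet2 m \<phi> =
     ((\<lambda>i j. if i < m \<and> j < m then partial_deriv j (\<lambda>u. \<phi> u i) origin else 0),
      (\<lambda>i j k. if i < m \<and> j < m \<and> k < m
               then partial_deriv j (partial_deriv k (\<lambda>u. \<phi> u i)) origin else 0))"

definition pointed_smooth_map :: "nat \<Rightarrow> ((nat \<Rightarrow> real) \<Rightarrow> (nat \<Rightarrow> real)) \<Rightarrow> bool" where
  "pointed_smooth_map m \<phi> \<longleftrightarrow>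
     \<phi> \<in> topspace (Euclidean_space m) \<rightarrow> topspace (Euclidean_space m) \<and>
     smooth_map_on m (topspace (Euclidean_space m)) \<phi> \<and> \<phi> origin = origin"

text \<open>The 2-jets at \<open>0\<close> of \<open>\<phi>\<close> and \<open>\<theta>\<close> are mutually inverse elements of the jet group.\<close>

definition inverse_jets ::
    "nat \<Rightarrow> ((nat \<Rightarrow> real) \<Rightarrow> (nat \<Rightarrow> real)) \<Rightarrow> ((nat \<Rightarrow> real) \<Rightarrow> (nat \<Rightarrow> real)) \<Rightarrow> bool" where
  "inverse_jets m \<phi> \<theta> \<longleftrightarrow> pointed_smooth_map m \<phi> \<and> pointed_smooth_map m \<theta> \<and>
     jet2 m (\<phi> \<circ> \<theta>) = jet2 m id \<and> jet2 m (\<theta> \<circ> \<phi>) = jet2 m id"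

definition fiber_space :: "nat \<Rightarrow> nat \<Rightarrow> fiber set" where
  "fiber_space m n = {f. \<forall>i \<tau>. \<not> (i < m \<and> \<tau> \<in> forests n) \<longrightarrow> f i \<tau> = 0}"

text \<open>
  The two labels of an unordered pair are \<open>Min\<close> and \<open>Max\<close> of its set of elements. Since
  \<open>a\<^sup>i\<^sub>j\<^sub>k\<close> is symmetric in \<open>j, k\<close>, this choice of order is immaterial, see
  \<open>jet_act_Dot\<close> below.
\<close>

fun jet_act_component :: "nat \<Rightarrow> jet \<Rightarrow> fiber \<Rightarrow> nat \<Rightarrow> forest \<Rightarrow> real" where
  "jet_act_component m (a1, a2) f i (Vertex \<alpha>) = (\<Sum>j<m. a1 i j * f j (Vertex \<alpha>))"
| "jet_act_component m (a1, a2) f i (Dot P) =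
     (\<Sum>j<m. a1 i j * f j (Dot P)) +
     (\<Sum>j<m. \<Sum>k<m. a2 i j k * f j (Vertex (Min (set_uprod P))) * f k (Vertex (Max (set_uprod P))))"
| "jet_act_component m (a1, a2) f i (Stack \<alpha> \<beta>) = (\<Sum>j<m. a1 i j * f j (Stack \<alpha> \<beta>))"

definition jet_act :: "nat \<Rightarrow> nat \<Rightarrow> jet \<Rightarrow> fiber \<Rightarrow> fiber" where
  "jet_act m n a f =
     (\<lambda>i \<tau>. if i < m \<and> \<tau> \<in> forests n then jet_act_component m a f i \<tau> else 0)"

lemma jet_act_Dot:
  assumes sym: "\<And>j k. a2 i j k = a2 i k j"
    and "i < m" "\<alpha> \<in> {1..n}" "\<beta> \<in> {1..n}"
  shows "jet_act m n (a1, a2) f i (Dot (Upair \<alpha> \<beta>)) =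
           (\<Sum>j<m. a1 i j * f j (Dot (Upair \<alpha> \<beta>))) +
           (\<Sum>j<m. \<Sum>k<m. a2 i j k * f j (Vertex \<alpha>) * f k (Vertex \<beta>))"
proof -
  have "Dot (Upair \<alpha> \<beta>) \<in> forests n"
    using assms by (auto simp: forests_def)
  moreover have "(\<Sum>j<m. \<Sum>k<m. a2 i j k * f j (Vertex \<beta>) * f k (Vertex \<alpha>)) =
      (\<Sum>j<m. \<Sum>k<m. a2 i j k * f j (Vertex \<alpha>) * f k (Vertex \<beta>))"
    by (subst sum.swap) (simp add: sym mult_ac)
  ultimately show ?thesis
    using \<open>i < m\<close> by (simp add: jet_act_def min_def max_def)
qed

section \<open>The second-order frame bundle and the rough velocity bundle\<close>

text \<open>
  Diffeomorphisms from an open neighborhood of \<open>0\<close> onto an open subset of the manifold, as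
  total functions whose values away from \<open>0\<close> are irrelevant.
\<close>

definition local_diffeo :: "nat \<Rightarrow> 'a topology \<Rightarrow> 'a chart set \<Rightarrow> ((nat \<Rightarrow> real) \<Rightarrow> 'a) \<Rightarrow> bool" where
  "local_diffeo m M A \<psi> \<longleftrightarrow>
     (\<exists>N. openin (Euclidean_space m) N \<and> origin \<in> N \<and> openin M (\<psi> ` N) \<and>
          homeomorphic_map (subtopology (Euclidean_space m) N) (subtopology M (\<psi> ` N)) \<psi> \<and>
          (\<forall>(U, x)\<in>A. smooth_map_on m (N \<inter> \<psi> -` U) (x \<circ> \<psi>) \<and>
                      smooth_map_on m (x ` (U \<inter> \<psi> ` N)) (\<lambda>v. inv_into N \<psi> (inv_into U x v))))"

definition frame_of ::
    "nat \<Rightarrow> 'a topology \<Rightarrow> 'a chart set \<Rightarrow> ((nat \<Rightarrow> real) \<Rightarrow> 'a) \<Rightarrow> ((nat \<Rightarrow> real) \<Rightarrow> 'a) set" where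
  "frame_of m M A \<psi> = {\<psi>'. local_diffeo m M A \<psi>' \<and> \<psi>' origin = \<psi> origin \<and>
     (\<forall>(U, x)\<in>A. \<psi> origin \<in> U \<longrightarrow> jet2 m (x \<circ> \<psi>') = jet2 m (x \<circ> \<psi>))}"

definition frame_bundle ::
    "nat \<Rightarrow> 'a topology \<Rightarrow> 'a chart set \<Rightarrow> ((nat \<Rightarrow> real) \<Rightarrow> 'a) set set" where
  "frame_bundle m M A = frame_of m M A ` {\<psi>. local_diffeo m M A \<psi>}"

text \<open>The relation \<open>(j\<^sup>2\<^sub>0\<psi>, f) \<sim> (j\<^sup>2\<^sub>0(\<psi> \<circ> a), a\<inverse>f)\<close>, where the group element \<open>a\<close> is
  the jet of \<open>\<phi>\<close> and its inverse is the jet of \<open>\<theta>\<close>.\<close>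

definition assoc_rel ::
    "nat \<Rightarrow> nat \<Rightarrow> 'a topology \<Rightarrow> 'a chart set \<Rightarrow> (((nat \<Rightarrow> real) \<Rightarrow> 'a) set \<times> fiber) rel" where
  "assoc_rel m n M A =
     {((P, f), (P', f')). P \<in> frame_bundle m M A \<and> P' \<in> frame_bundle m M A \<and>
        f \<in> fiber_space m n \<and> f' \<in> fiber_space m n \<and>
        (\<exists>\<psi>\<in>P. \<exists>\<phi> \<theta>. inverse_jets m \<phi> \<theta> \<and>
           P' = frame_of m M A (\<psi> \<circ> \<phi>) \<and> f' = jet_act m n (jet2 m \<theta>) f)}"

type_synonym 'a velocity = "(((nat \<Rightarrow> real) \<Rightarrow> 'a) set \<times> fiber) set"

definition rough_velocity_bundle ::
    "nat \<Rightarrow> nat \<Rightarrow> 'a topology \<Rightarrow> 'a chart set \<Rightarrow> 'a velocity set" where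
  "rough_velocity_bundle m n M A = (frame_bundle m M A \<times> fiber_space m n) // assoc_rel m n M A"

definition bundle_proj :: "'a velocity \<Rightarrow> 'a" where
  "bundle_proj \<xi> = (THE q. \<exists>(P, f)\<in>\<xi>. \<exists>\<psi>\<in>P. q = \<psi> origin)"

text \<open>The fiber coordinates of \<open>\<xi>\<close> induced by a chart with coordinate map \<open>x\<close>.\<close>

definition fiber_coords :: "nat \<Rightarrow> nat \<Rightarrow> ('a \<Rightarrow> nat \<Rightarrow> real) \<Rightarrow> 'a velocity \<Rightarrow> fiber" where
  "fiber_coords m n x \<xi> =
     (THE g. \<exists>(P, f)\<in>\<xi>. \<exists>\<psi>\<in>P. g = jet_act m n (jet2 m (x \<circ> \<psi>)) f)"

section \<open>Rough velocity fields and integral curves\<close>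

text \<open>The field \<open>f\<close> is represented in a chart \<open>(U, x)\<close> by \<open>q \<mapsto> fiber_coords m n x (f q) i \<tau>\<close>
  on \<open>U\<close>; \<open>local_rep\<close> is this function precomposed with the inverse of the coordinate map.\<close>

definition local_rep ::
    "nat \<Rightarrow> nat \<Rightarrow> 'a chart \<Rightarrow> ('a \<Rightarrow> 'a velocity) \<Rightarrow> nat \<Rightarrow> forest \<Rightarrow> (nat \<Rightarrow> real) \<Rightarrow> real" where
  "local_rep m n = (\<lambda>(U, x) f i \<tau> u. fiber_coords m n x (f (inv_into U x u)) i \<tau>)"

definition rough_velocity_field ::
    "nat \<Rightarrow> nat \<Rightarrow> 'a topology \<Rightarrow> 'a chart set \<Rightarrow> ('a \<Rightarrow> 'a velocity) \<Rightarrow> bool" where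
  "rough_velocity_field m n M A f \<longleftrightarrow>
     (\<forall>q\<in>topspace M. f q \<in> rough_velocity_bundle m n M A \<and> bundle_proj (f q) = q) \<and>
     (\<forall>(U, x)\<in>A. \<forall>i<m. \<forall>\<tau>\<in>forests n. smooth_on m (x ` U) (local_rep m n (U, x) f i \<tau>))"

definition admissible ::
    "nat \<Rightarrow> nat \<Rightarrow> 'a topology \<Rightarrow> 'a chart set \<Rightarrow> ('a \<Rightarrow> 'a velocity) \<Rightarrow> bool" where
  "admissible m n M A f \<longleftrightarrow>
     (\<forall>q\<in>topspace M. \<exists>(U, x)\<in>A. q \<in> U \<and>
        (\<forall>i<m. \<forall>\<alpha>\<in>{1..n}. \<forall>\<beta>\<in>{1..n}.
           (\<Sum>j<m. partial_deriv j (local_rep m n (U, x) f i (Vertex \<beta>)) (x q)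
                    * fiber_coords m n x (f q) j (Vertex \<alpha>))
           = fiber_coords m n x (f q) i (Dot (Upair \<alpha> \<beta>))
             + fiber_coords m n x (f q) i (Stack \<alpha> \<beta>)))"

text \<open>\<open>Y\<close> is an integral curve on \<open>{a..b}\<close>; values of \<open>Y\<close> elsewhere are irrelevant.\<close>

definition integral_curve ::
    "nat \<Rightarrow> nat \<Rightarrow> 'a topology \<Rightarrow> 'a chart set \<Rightarrow> ('a \<Rightarrow> 'a velocity) \<Rightarrow> real \<Rightarrow>
     (real \<Rightarrow> real \<Rightarrow> real) \<Rightarrow> (forest \<Rightarrow> real \<Rightarrow> real \<Rightarrow> real) \<Rightarrow>
     real \<Rightarrow> real \<Rightarrow> (real \<Rightarrow> 'a) \<Rightarrow> bool" where
  "integral_curve m n M A f p \<omega> X a b Y \<longleftrightarrow>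
     continuous_map (top_of_set {a..b}) M Y \<and>
     (\<forall>c d. a \<le> c \<and> c \<le> d \<and> d \<le> b \<longrightarrow>
       (\<forall>(U, x)\<in>A. Y ` {c..d} \<subseteq> U \<longrightarrow>
         (\<exists>C>0. \<forall>i<m. \<forall>s t. c \<le> s \<and> s \<le> t \<and> t \<le> d \<longrightarrow>
           \<bar>x (Y t) i - x (Y s) i
             - (\<Sum>\<tau>\<in>forests n. 1 / symmetry_factor \<tau> * fiber_coords m n x (f (Y s)) i \<tau> * X \<tau> s t)\<bar>
           \<le> C * \<omega> s t powr (3 / p))))"

end

theory Submission
  imports Defs "HOL-Library.Landau_Symbols"
begin

text \<open>
  Work in one chart around \<open>Y0\<close>. The Euler scheme along a finite partition replaces the equation
  by \<open>Y\<^sub>t = Y\<^sub>s + \<Xi>\<^sub>s\<^sub>t(Y\<^sub>s)\<close>, where \<open>\<Xi>\<close> is the sum over forests. Chen's relation and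
  admissibility make the defect of additivity of \<open>\<Xi>\<close> of order \<open>\<omega> powr (3 / p)\<close>, and since
  \<open>3 / p > 1\<close>, Davie's argument bounds \<open>Y\<^sub>t - Y\<^sub>s - \<Xi>\<^sub>s\<^sub>t(Y\<^sub>s)\<close> by \<open>\<omega> powr (3 / p)\<close> uniformly in the
  partition. For each pair \<open>(s, t)\<close> this bound is a closed condition on \<open>Y\<close> in a compact product
  space, and finitely many of them are satisfied by an Euler scheme; compactness yields a \<open>Y\<close>
  satisfying all of them, and the bound makes it continuous. The transformation law of the
  fiber coordinates carries the expansion to every other chart and makes admissibility
  independent of the chart.
\<close>

section \<open>Calculus on open subsets of Euclidean space\<close>

text \<open>The estimates hold only while the scheme stays in a compact cube \<open>K\<close>, and
  staying there needs the estimates; \<open>discrete_sewing\<close> therefore proves confinement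
  (\<open>good\<close>) and the error bound in one induction. A second circularity: the error
  constant \<kappa> is computed from the defect constant \<open>c\<close>, but the defect bound
  presupposes control of the error. It is broken by asking there only for closeness
  \<open>gauge s t ^ 2\<close> with constant 1. On a short interval
  \<open>\<kappa> * gauge s t \<le> 1\<close>, which turns a third-order error with constant
  \<kappa> into such a second-order one; so \<open>c\<close> can be fixed before \<kappa>. Uniform
  constants come from compactness and are carried as big-O along \<open>principal Q\<close>, where
  \<open>Q\<close> is the set of all points and times concerned. Smoothness is given by iterated
  partial derivatives on a function type, so Taylor's formula, the chain rules and the symmetry of
  mixed derivatives are derived from continuity of these derivatives. The symmetry is essential
  because \<open>\<alpha> \<cdot> \<beta>\<close> is an unordered pair.\<close>

definition espace :: "nat \<Rightarrow> (nat \<Rightarrow> real) set" where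
  "espace m = {v. \<forall>i\<ge>m. v i = 0}"

lemma espace_iff: "v \<in> espace m \<longleftrightarrow> (\<forall>i\<ge>m. v i = 0)"
  by (simp add: espace_def)

lemma topspace_eq_espace: "topspace (Euclidean_space m) = espace m"
  by (simp add: topspace_Euclidean_space espace_def)

lemma espace_upd: "v \<in> espace m \<Longrightarrow> j < m \<Longrightarrow> v(j := h) \<in> espace m"
  by (auto simp: espace_iff)

text \<open>Translates abstract topologies into \<open>continuous_on\<close> and
  \<open>openin (top_of_set ..)\<close> on the function type.\<close>

lemma Euclidean_space_eq: "Euclidean_space m = top_of_set (espace m)"
  by (simp add: Euclidean_space_def euclidean_product_topology espace_def)

lemma subtopology_Euclidean_space:
  "W \<subseteq> espace m \<Longrightarrow> subtopology (Euclidean_space m) W = top_of_set W"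
  unfolding Euclidean_space_eq by (simp add: subtopology_subtopology inf_absorb2)

text \<open>Sup-norm balls in the first \<open>m\<close> coordinates serve as neighborhoods: they
  are convex, and replacing coordinates of the center by those of a point of the cube does not leave
  it.\<close>

definition cube :: "nat \<Rightarrow> (nat \<Rightarrow> real) \<Rightarrow> real \<Rightarrow> (nat \<Rightarrow> real) set" where
  "cube m u d = {v \<in> espace m. \<forall>i<m. \<bar>v i - u i\<bar> < d}"

lemma cube_subset_espace: "cube m u d \<subseteq> espace m"
  by (auto simp: cube_def)

lemma cube_mono: "d \<le> e \<Longrightarrow> cube m u d \<subseteq> cube m u e"
  by (auto simp: cube_def)

lemma open_contains_cube:
  assumes W: "openin (Euclidean_space m) W" and u: "u \<in> W"
  shows "\<exists>d>0. cube m u d \<subseteq> W"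
proof -
  obtain G where G: "open G" "W = espace m \<inter> G"
    using W unfolding Euclidean_space_eq openin_open by auto
  have "openin (product_topology (\<lambda>_. euclidean) UNIV) G"
    using G(1) by (simp add: euclidean_product_topology)
  moreover have "u \<in> G" using u G by auto
  ultimately obtain X where X: "u \<in> Pi\<^sub>E UNIV X" "\<And>i. open (X i)" "Pi\<^sub>E UNIV X \<subseteq> G"
    using product_topology_open_contains_basis[of "\<lambda>_. euclidean" UNIV G u] by auto
  have "\<exists>e>0. ball (u i) e \<subseteq> X i" for i
    using X(1,2) by (metis PiE_iff UNIV_I open_contains_ball_eq)
  then obtain e where e: "\<And>i. e i > 0" "\<And>i. ball (u i) (e i) \<subseteq> X i" by metis
  \<comment> \<open>The element 1 keeps the set nonempty when \<open>m = 0\<close>. Finitely many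
    radii suffice, since from coordinate \<open>m\<close> on both points vanish.\<close>
  define d where "d = Min (insert 1 (e ` {..<m}))"
  have "d > 0" unfolding d_def using e by auto
  moreover have "cube m u d \<subseteq> W"
  proof
    fix v assume v: "v \<in> cube m u d"
    have "v i \<in> X i" for i
    proof (cases "i < m")
      case True
      then have "d \<le> e i" unfolding d_def by auto
      with v True have "v i \<in> ball (u i) (e i)"
        by (auto simp: cube_def dist_real_def abs_minus_commute)
      then show ?thesis using e(2) by blast
    next
      case False
      then have "v i = u i" using v u G by (auto simp: cube_def espace_iff)
      then show ?thesis using X(1) by auto
    qed
    then have "v \<in> G" using X(3) by auto
    then show "v \<in> W" using v G by (auto simp: cube_def)
  qed
  ultimately show ?thesis by blast
qed

lemma continuous_cubeE:
  assumes W: "openin (Euclidean_space m) W" and "u \<in> W" "continuous_on W F" "e > 0"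
  obtains d where "d > 0" "cube m u d \<subseteq> W" "\<And>v. v \<in> cube m u d \<Longrightarrow> \<bar>F v - F u\<bar> < (e::real)"
proof -
  have sub: "W \<subseteq> espace m" using W openin_subset topspace_eq_espace by blast
  have "openin (top_of_set W) (W \<inter> F -` ball (F u) e)"
    using assms by (intro continuous_openin_preimage_gen) auto
  then have "openin (Euclidean_space m) (W \<inter> F -` ball (F u) e)"
    using openin_trans W unfolding Euclidean_space_eq by blast
  moreover have "u \<in> W \<inter> F -` ball (F u) e" using assms by auto
  ultimately obtain d where "d > 0" "cube m u d \<subseteq> W \<inter> F -` ball (F u) e"
    using open_contains_cube by blast
  then show ?thesis by (intro that[of d]) (auto simp: dist_real_def abs_minus_commute)
qed

lemma Ck_on_continuous: "Ck_on m k W F \<Longrightarrow> W \<subseteq> espace m \<Longrightarrow> continuous_on W F"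
  by (cases k) (simp_all add: subtopology_Euclidean_space)

lemma Ck_on_SucD: "Ck_on m (Suc k) W F \<Longrightarrow> Ck_on m k W F"
  by (induction k arbitrary: F) auto

lemma Ck_on_le: "k \<le> l \<Longrightarrow> Ck_on m l W F \<Longrightarrow> Ck_on m k W F"
  by (induction l rule: nat_induct) (auto simp: le_Suc_eq simp del: Ck_on.simps(2) dest: Ck_on_SucD)

lemma Ck_on_partial: "Ck_on m (Suc k) W F \<Longrightarrow> j < m \<Longrightarrow> Ck_on m k W (partial_deriv j F)"
  by auto

lemma has_partial_deriv:
  assumes "Ck_on m (Suc k) W F" "u \<in> W" "j < m"
  shows "((\<lambda>h. F (u(j := h))) has_field_derivative partial_deriv j F u) (at (u j))"
  using assms by (auto simp: partial_deriv_def DERIV_deriv_iff_real_differentiable)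

lemma has_partial_deriv':
  assumes "Ck_on m (Suc k) W F" "u(j := h) \<in> W" "j < m"
  shows "((\<lambda>h. F (u(j := h))) has_field_derivative partial_deriv j F (u(j := h))) (at h)"
  using has_partial_deriv[OF assms] by simp

section \<open>Mean values and differentiability from continuous partial derivatives\<close>

lemma MVT_segment:
  fixes a b :: real
  assumes "\<And>x. x \<in> closed_segment a b \<Longrightarrow> (g has_field_derivative g' x) (at x)"
  shows "\<exists>x\<in>closed_segment a b. g b - g a = g' x * (b - a)"
proof -
  consider "a < b" | "a = b" | "b < a" by linarith
  then show ?thesis
  proof cases
    case 1
    then show ?thesis using MVT2[of a b g g'] assms by (force simp: closed_segment_eq_real_ivl)
  next
    case 3
    then have "\<exists>z>b. z < a \<and> g a - g b = (a - b) * g' z"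
      using assms by (intro MVT2) (auto simp: closed_segment_eq_real_ivl)
    then obtain z where "b < z" "z < a" "g b - g a = g' z * (b - a)"
      by (auto simp: algebra_simps)
    then show ?thesis using 3 by (intro bexI[of _ z]) (auto simp: closed_segment_eq_real_ivl)
  qed auto
qed

text \<open>Moving from \<open>u\<close> to \<open>v\<close> one coordinate at a time gives
  \<open>m\<close> one-dimensional mean value problems. Each has its own intermediate point, whence
  a family \<xi>.\<close>

lemma coordinatewise_MVT:
  assumes F: "Ck_on m 1 W F" and sub: "cube m u d \<subseteq> W" and u: "u \<in> espace m"
    and v: "v \<in> cube m u d"
  shows "\<exists>\<xi>. (\<forall>k<m. \<xi> k \<in> cube m u d) \<and>
    F v - F u = (\<Sum>k<m. partial_deriv k F (\<xi> k) * (v k - u k))"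
proof -
  \<comment> \<open>The first \<open>k\<close> coordinates have already moved. That
    \<open>P m = v\<close> uses that both points vanish from coordinate \<open>m\<close> on.\<close>
  define P where "P k = (\<lambda>i. if i < k then v i else u i)" for k
  have P0: "P 0 = u" by (simp add: P_def)
  have Pm: "P m = v" using u v by (auto simp: P_def cube_def espace_iff fun_eq_iff)
  have *: "\<exists>\<xi>\<in>cube m u d. F (P (Suc k)) - F (P k) = partial_deriv k F \<xi> * (v k - u k)"
    if k: "k < m" for k
  proof -
    have inc: "(P k)(k := h) \<in> cube m u d" if "h \<in> closed_segment (u k) (v k)" for h
    proof -
      have "\<bar>h - u k\<bar> \<le> \<bar>v k - u k\<bar>"
        using that by (auto simp: closed_segment_eq_real_ivl split: if_splits)
      moreover have "0 < d" using v k by (auto simp: cube_def)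
      ultimately show ?thesis using u v k by (auto simp: cube_def P_def espace_iff)
    qed
    have "\<exists>h\<in>closed_segment (u k) (v k).
       F ((P k)(k := v k)) - F ((P k)(k := u k)) = partial_deriv k F ((P k)(k := h)) * (v k - u k)"
      using F k inc sub by (intro MVT_segment has_partial_deriv'[where k = 0 and W = W]) auto
    moreover have "(P k)(k := v k) = P (Suc k)" "(P k)(k := u k) = P k"
      by (auto simp: P_def fun_eq_iff)
    ultimately show ?thesis using inc by auto
  qed
  then obtain \<xi> where \<xi>: "\<And>k. k < m \<Longrightarrow> \<xi> k \<in> cube m u d"
      "\<And>k. k < m \<Longrightarrow> F (P (Suc k)) - F (P k) = partial_deriv k F (\<xi> k) * (v k - u k)"
    by metis
  have "F v - F u = (\<Sum>k<m. F (P (Suc k)) - F (P k))"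
    using sum_lessThan_telescope[of "\<lambda>k. F (P k)" m] P0 Pm by simp
  also have "\<dots> = (\<Sum>k<m. partial_deriv k F (\<xi> k) * (v k - u k))"
    using \<xi>(2) by simp
  finally show ?thesis using \<xi>(1) by blast
qed

abbreviation l1 :: "nat \<Rightarrow> (nat \<Rightarrow> real) \<Rightarrow> real" where
  "l1 m v \<equiv> \<Sum>j<m. \<bar>v j\<bar>"

text \<open>By continuity, the partial derivatives at the intermediate points of the mean value
  formula differ from those at \<open>u\<close> by at most \<open>e\<close>.\<close>

lemma frechet_cubeE:
  assumes W: "openin (Euclidean_space m) W" and F: "Ck_on m 1 W F" and u: "u \<in> W" and e: "e > 0"
  obtains d where "d > 0" "cube m u d \<subseteq> W"
    "\<And>v. v \<in> cube m u d \<Longrightarrow>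
      \<bar>F v - F u - (\<Sum>k<m. partial_deriv k F u * (v k - u k))\<bar> \<le> e * l1 m (\<lambda>k. v k - u k)"
proof -
  have sub: "W \<subseteq> espace m" using W openin_subset topspace_eq_espace by blast
  have "\<exists>d>0. cube m u d \<subseteq> W \<and> (\<forall>v\<in>cube m u d. \<bar>partial_deriv k F v - partial_deriv k F u\<bar> < e)"
    if "k < m" for k
  proof -
    have "continuous_on W (partial_deriv k F)"
      using F that Ck_on_continuous[of m 0, OF _ sub] by auto
    from continuous_cubeE[OF W u this e] show ?thesis by metis
  qed
  then obtain d where d: "\<And>k. k < m \<Longrightarrow> d k > 0"
    "\<And>k v. k < m \<Longrightarrow> v \<in> cube m u (d k) \<Longrightarrow> \<bar>partial_deriv k F v - partial_deriv k F u\<bar> < e"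
    by metis
  obtain d0 where d0: "d0 > 0" "cube m u d0 \<subseteq> W" using open_contains_cube[OF W u] by blast
  define D where "D = Min (insert d0 (d ` {..<m}))"
  have D: "D > 0" "D \<le> d0" "\<And>k. k < m \<Longrightarrow> D \<le> d k" unfolding D_def using d d0 by auto
  show ?thesis
  proof (rule that[OF D(1)])
    show subD: "cube m u D \<subseteq> W" using d0 cube_mono[OF D(2)] by blast
    fix v assume v: "v \<in> cube m u D"
    obtain \<xi> where \<xi>: "\<And>k. k < m \<Longrightarrow> \<xi> k \<in> cube m u D"
      "F v - F u = (\<Sum>k<m. partial_deriv k F (\<xi> k) * (v k - u k))"
      using coordinatewise_MVT[OF F subD _ v] u sub by blast
    have "F v - F u - (\<Sum>k<m. partial_deriv k F u * (v k - u k))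
      = (\<Sum>k<m. (partial_deriv k F (\<xi> k) - partial_deriv k F u) * (v k - u k))"
      by (simp add: \<xi>(2) sum_subtractf left_diff_distrib)
    also have "\<bar>\<dots>\<bar> \<le> (\<Sum>k<m. e * \<bar>v k - u k\<bar>)"
    proof (rule order_trans[OF sum_abs], rule sum_mono)
      fix k assume k: "k \<in> {..<m}"
      then have "\<bar>partial_deriv k F (\<xi> k) - partial_deriv k F u\<bar> \<le> e"
        using \<xi>(1)[of k] D(3)[of k] d(2)[of k "\<xi> k"] cube_mono[of D "d k" m u] by fastforce
      then show "\<bar>(partial_deriv k F (\<xi> k) - partial_deriv k F u) * (v k - u k)\<bar> \<le> e * \<bar>v k - u k\<bar>"
        by (simp add: abs_mult mult_right_mono)
    qed
    finally show "\<bar>F v - F u - (\<Sum>k<m. partial_deriv k F u * (v k - u k))\<bar>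
      \<le> e * l1 m (\<lambda>k. v k - u k)" by (simp add: sum_distrib_left)
  qed
qed

section \<open>Chain rules of first and second order\<close>

lemma chain_rule_curve:
  assumes W: "openin (Euclidean_space m) W" and F: "Ck_on m 1 W F" and u: "\<gamma> t0 \<in> W"
    and \<gamma>: "\<forall>\<^sub>F t in at t0. \<gamma> t \<in> espace m"
    and D: "\<And>k. k < m \<Longrightarrow> ((\<lambda>t. \<gamma> t k) has_field_derivative D k) (at (t0::real))"
  shows "((\<lambda>t. F (\<gamma> t)) has_field_derivative (\<Sum>k<m. partial_deriv k F (\<gamma> t0) * D k)) (at t0)"
proof -
  \<comment> \<open>The error of the linear approximation along the curve; the claim reduces to its
    derivative at \<open>t0\<close> being 0.\<close>
  define r where "r t = F (\<gamma> t) - F (\<gamma> t0) - (\<Sum>k<m. partial_deriv k F (\<gamma> t0) * (\<gamma> t k - \<gamma> t0 k))" for t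
  have "(r has_field_derivative 0) (at t0)"
    unfolding has_field_derivative_iff
  proof (rule tendstoI)
    fix e :: real assume e: "e > 0"
    \<comment> \<open>\<open>L\<close> eventually bounds the difference quotients of \<gamma> in the
      l1 norm. The summand 1 makes the limit strictly smaller than \<open>L\<close> and keeps
      \<open>L\<close> positive.\<close>
    define L where "L = l1 m D + 1"
    have L: "L > 0" unfolding L_def by (simp add: add_nonneg_pos sum_nonneg)
    obtain d where d: "d > 0" "cube m (\<gamma> t0) d \<subseteq> W" "\<And>v. v \<in> cube m (\<gamma> t0) d \<Longrightarrow>
      \<bar>F v - F (\<gamma> t0) - (\<Sum>k<m. partial_deriv k F (\<gamma> t0) * (v k - \<gamma> t0 k))\<bar>
        \<le> (e / (2 * L)) * l1 m (\<lambda>k. v k - \<gamma> t0 k)"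
      using frechet_cubeE[OF W F u, of "e / (2 * L)"] e L by auto
    have "((\<lambda>t. l1 m (\<lambda>k. (\<gamma> t k - \<gamma> t0 k) / (t - t0))) \<longlongrightarrow> l1 m D) (at t0)"
      using D unfolding has_field_derivative_iff by (intro tendsto_intros) auto
    then have ev1: "\<forall>\<^sub>F t in at t0. l1 m (\<lambda>k. (\<gamma> t k - \<gamma> t0 k) / (t - t0)) < L"
      unfolding L_def by (rule order_tendstoD) simp
    have "\<forall>\<^sub>F t in at t0. \<forall>k<m. \<bar>\<gamma> t k - \<gamma> t0 k\<bar> < d"
    proof -
      have "\<forall>\<^sub>F t in at t0. \<forall>k\<in>{..<m}. \<bar>\<gamma> t k - \<gamma> t0 k\<bar> < d"
      proof (rule eventually_ball_finite, simp, rule ballI)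
        fix k assume "k \<in> {..<m}"
        then have "((\<lambda>t. \<gamma> t k) \<longlongrightarrow> \<gamma> t0 k) (at t0)"
          using D DERIV_isCont isCont_def by blast
        from tendstoD[OF this d(1)] show "\<forall>\<^sub>F t in at t0. \<bar>\<gamma> t k - \<gamma> t0 k\<bar> < d"
          by (simp add: dist_real_def)
      qed
      then show ?thesis by (rule eventually_mono) auto
    qed
    moreover have "\<forall>\<^sub>F t in at t0. t \<noteq> t0" by (simp add: eventually_at_filter)
    ultimately have "\<forall>\<^sub>F t in at t0. l1 m (\<lambda>k. (\<gamma> t k - \<gamma> t0 k) / (t - t0)) < L \<and>
       \<gamma> t \<in> cube m (\<gamma> t0) d \<and> t \<noteq> t0"
      using ev1 \<gamma> by eventually_elim (simp add: cube_def)
    then show "\<forall>\<^sub>F t in at t0. dist ((r t - r t0) / (t - t0)) 0 < e"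
    proof eventually_elim
      fix t assume t: "l1 m (\<lambda>k. (\<gamma> t k - \<gamma> t0 k) / (t - t0)) < L \<and>
       \<gamma> t \<in> cube m (\<gamma> t0) d \<and> t \<noteq> t0"
      have "\<bar>r t\<bar> \<le> (e / (2 * L)) * l1 m (\<lambda>k. \<gamma> t k - \<gamma> t0 k)"
        unfolding r_def using d(3) t by blast
      also have "l1 m (\<lambda>k. \<gamma> t k - \<gamma> t0 k) = l1 m (\<lambda>k. (\<gamma> t k - \<gamma> t0 k) / (t - t0)) * \<bar>t - t0\<bar>"
        using t by (simp add: sum_distrib_right)
      also have "(e / (2 * L)) * \<dots> \<le> (e / (2 * L)) * (L * \<bar>t - t0\<bar>)"
        using t e L by (intro mult_left_mono mult_right_mono) auto
      also have "\<dots> = e / 2 * \<bar>t - t0\<bar>" using L by simp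
      finally have "\<bar>r t\<bar> / \<bar>t - t0\<bar> \<le> e / 2" using t by (simp add: divide_simps)
      moreover have "dist ((r t - r t0) / (t - t0)) 0 = \<bar>r t\<bar> / \<bar>t - t0\<bar>"
        by (simp add: dist_real_def r_def)
      ultimately show "dist ((r t - r t0) / (t - t0)) 0 < e"
        using e by linarith
    qed
  qed
  then have "((\<lambda>t. F (\<gamma> t0) + (\<Sum>k<m. partial_deriv k F (\<gamma> t0) * (\<gamma> t k - \<gamma> t0 k)) + r t)
     has_field_derivative (0 + (\<Sum>k<m. partial_deriv k F (\<gamma> t0) * (D k - 0)) + 0)) (at t0)"
    using D by (intro DERIV_add DERIV_const DERIV_sum DERIV_cmult DERIV_diff) auto
  then show ?thesis by (simp add: r_def)
qed

lemma eventually_upd_in: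
  assumes "openin (Euclidean_space m) N" "u \<in> N" "j < m"
  shows "\<forall>\<^sub>F h in nhds (u j). u(j := h) \<in> N"
proof -
  obtain d where d: "d > 0" "cube m u d \<subseteq> N" using open_contains_cube assms by blast
  have "u \<in> espace m" using assms openin_subset topspace_eq_espace by blast
  then have "u(j := h) \<in> N" if "dist h (u j) < d" for h
    using that d assms(3) by (intro subsetD[OF d(2)]) (auto simp: cube_def espace_upd dist_real_def)
  then show ?thesis using d unfolding eventually_nhds_metric by blast
qed

lemma partial_deriv_cong:
  assumes "openin (Euclidean_space m) N" "u \<in> N" "j < m" and eq: "\<And>v. v \<in> N \<Longrightarrow> F v = G v"
  shows "partial_deriv j F u = partial_deriv j G u"
  unfolding partial_deriv_def
proof (rule deriv_cong_ev)
  show "\<forall>\<^sub>F h in nhds (u j). F (u(j := h)) = G (u(j := h))"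
    using eventually_upd_in[OF assms(1-3)] by eventually_elim (rule eq)
qed simp

lemma partial_derivI:
  "((\<lambda>h. F (u(j := h))) has_field_derivative D) (at (u j)) \<Longrightarrow> partial_deriv j F u = D"
  unfolding partial_deriv_def by (rule DERIV_imp_deriv)

lemma has_chain_rule_partial:
  assumes W: "openin (Euclidean_space m) W" and F: "Ck_on m 1 W F"
    and N: "openin (Euclidean_space m) N" and u: "u \<in> N" and j: "j < m"
    and \<phi>: "\<And>v. v \<in> N \<Longrightarrow> \<phi> v \<in> W" and \<phi>1: "\<And>k. k < m \<Longrightarrow> Ck_on m 1 N (\<lambda>v. \<phi> v k)"
  shows "((\<lambda>h. F (\<phi> (u(j := h)))) has_field_derivative
    (\<Sum>k<m. partial_deriv k F (\<phi> u) * partial_deriv j (\<lambda>v. \<phi> v k) u)) (at (u j))"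
proof -
  have "W \<subseteq> espace m" using W openin_subset topspace_eq_espace by blast
  moreover have "\<forall>\<^sub>F h in at (u j). \<phi> (u(j := h)) \<in> W"
    using eventually_upd_in[OF N u j] \<phi> by (auto simp: eventually_at_filter elim: eventually_mono)
  ultimately have "\<forall>\<^sub>F h in at (u j). \<phi> (u(j := h)) \<in> espace m"
    by (auto elim: eventually_mono)
  moreover have "((\<lambda>h. \<phi> (u(j := h)) k) has_field_derivative partial_deriv j (\<lambda>v. \<phi> v k) u) (at (u j))"
    if "k < m" for k
    using has_partial_deriv[of m 0 N "\<lambda>v. \<phi> v k" u j] \<phi>1[OF that] u j by simp
  ultimately show ?thesis
    using chain_rule_curve[OF W F, of "\<lambda>h. \<phi> (u(j := h))" "u j"] \<phi>[OF u] by simp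
qed

lemma chain_rule_partial:
  assumes W: "openin (Euclidean_space m) W" and F: "Ck_on m 1 W F"
    and N: "openin (Euclidean_space m) N" and u: "u \<in> N" and j: "j < m"
    and \<phi>: "\<And>v. v \<in> N \<Longrightarrow> \<phi> v \<in> W" and \<phi>1: "\<And>k. k < m \<Longrightarrow> Ck_on m 1 N (\<lambda>v. \<phi> v k)"
  shows "partial_deriv j (\<lambda>v. F (\<phi> v)) u =
    (\<Sum>k<m. partial_deriv k F (\<phi> u) * partial_deriv j (\<lambda>v. \<phi> v k) u)"
  by (rule partial_derivI) (rule has_chain_rule_partial[OF assms])

text \<open>The first-order rule holds on all of \<open>N\<close>, not only at \<open>u\<close>, so
  it may be differentiated once more with the product rule.\<close>

lemma chain_rule_partial2:
  assumes W: "openin (Euclidean_space m) W" and F: "Ck_on m 2 W F"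
    and N: "openin (Euclidean_space m) N" and u: "u \<in> N" and i: "i < m" and j: "j < m"
    and \<phi>: "\<And>v. v \<in> N \<Longrightarrow> \<phi> v \<in> W" and \<phi>2: "\<And>k. k < m \<Longrightarrow> Ck_on m 2 N (\<lambda>v. \<phi> v k)"
  shows "partial_deriv i (partial_deriv j (\<lambda>v. F (\<phi> v))) u =
    (\<Sum>q<m. \<Sum>p<m. partial_deriv q (partial_deriv p F) (\<phi> u) *
        partial_deriv i (\<lambda>v. \<phi> v q) u * partial_deriv j (\<lambda>v. \<phi> v p) u) +
    (\<Sum>p<m. partial_deriv p F (\<phi> u) * partial_deriv i (partial_deriv j (\<lambda>v. \<phi> v p)) u)"
proof -
  have F1: "Ck_on m 1 W F" and \<phi>1: "\<And>k. k < m \<Longrightarrow> Ck_on m 1 N (\<lambda>v. \<phi> v k)"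
    using Ck_on_le[of 1 2, OF _ F] Ck_on_le[of 1 2, OF _ \<phi>2] by (simp_all del: Ck_on.simps One_nat_def)
  have pF: "Ck_on m 1 W (partial_deriv p F)" and p\<phi>: "Ck_on m 1 N (partial_deriv j (\<lambda>v. \<phi> v p))"
    if "p < m" for p
    using F \<phi>2[OF that] that j by (simp_all add: numeral_2_eq_2)
  have "partial_deriv i (partial_deriv j (\<lambda>v. F (\<phi> v))) u =
    partial_deriv i (\<lambda>v. \<Sum>p<m. partial_deriv p F (\<phi> v) * partial_deriv j (\<lambda>v. \<phi> v p) v) u"
    using chain_rule_partial[OF W F1 N _ j \<phi> \<phi>1] by (intro partial_deriv_cong[OF N u i]) auto
  also have "\<dots> = (\<Sum>p<m. (\<Sum>q<m. partial_deriv q (partial_deriv p F) (\<phi> u) *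
        partial_deriv i (\<lambda>v. \<phi> v q) u) * partial_deriv j (\<lambda>v. \<phi> v p) u +
      partial_deriv i (partial_deriv j (\<lambda>v. \<phi> v p)) u * partial_deriv p F (\<phi> u))"
  proof (intro partial_derivI DERIV_sum)
    fix p assume p: "p \<in> {..<m}"
    have "((\<lambda>h. partial_deriv j (\<lambda>v. \<phi> v p) (u(i := h))) has_field_derivative
       partial_deriv i (partial_deriv j (\<lambda>v. \<phi> v p)) u) (at (u i))"
      using has_partial_deriv[of m 0 N, OF _ u i] p\<phi> p by simp
    from DERIV_mult[OF has_chain_rule_partial[OF W pF N u i \<phi> \<phi>1] this]
    show "((\<lambda>h. partial_deriv p F (\<phi> (u(i := h))) * partial_deriv j (\<lambda>v. \<phi> v p) (u(i := h)))
      has_field_derivative (\<Sum>q<m. partial_deriv q (partial_deriv p F) (\<phi> u) *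
        partial_deriv i (\<lambda>v. \<phi> v q) u) * partial_deriv j (\<lambda>v. \<phi> v p) u +
      partial_deriv i (partial_deriv j (\<lambda>v. \<phi> v p)) u * partial_deriv p F (\<phi> u)) (at (u i))"
      using p by simp
  qed
  also have "\<dots> = (\<Sum>p<m. \<Sum>q<m. partial_deriv q (partial_deriv p F) (\<phi> u) *
        partial_deriv i (\<lambda>v. \<phi> v q) u * partial_deriv j (\<lambda>v. \<phi> v p) u) +
    (\<Sum>p<m. partial_deriv p F (\<phi> u) * partial_deriv i (partial_deriv j (\<lambda>v. \<phi> v p)) u)"
    by (simp add: sum.distrib sum_distrib_right mult.commute[of "partial_deriv p F (\<phi> u)" for p])
  finally show ?thesis by (subst sum.swap)
qed

section \<open>Symmetry of second partial derivatives\<close>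

lemma mixed_difference_approx:
  assumes W: "openin (Euclidean_space m) W" and F: "Ck_on m 2 W F" and u: "u \<in> W"
    and j: "j < m" and k: "k < m" and jk: "j \<noteq> k" and e: "e > 0"
  shows "\<exists>d>0. \<forall>h. 0 < h \<and> h < d \<longrightarrow>
    \<bar>F (u(j := u j + h, k := u k + h)) - F (u(j := u j + h)) - F (u(k := u k + h)) + F u
      - h\<^sup>2 * partial_deriv k (partial_deriv j F) u\<bar> \<le> e * h\<^sup>2"
proof -
  have sub: "W \<subseteq> espace m" using W openin_subset topspace_eq_espace by blast
  have F1: "Ck_on m (Suc 0) W F" "Ck_on m (Suc 0) W (partial_deriv j F)"
    "Ck_on m 0 W (partial_deriv k (partial_deriv j F))"
    using F j k Ck_on_le[of 1 2] by (simp_all add: numeral_2_eq_2)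
  obtain d where d: "d > 0" "cube m u d \<subseteq> W" "\<And>v. v \<in> cube m u d \<Longrightarrow>
      \<bar>partial_deriv k (partial_deriv j F) v - partial_deriv k (partial_deriv j F) u\<bar> < e"
    using continuous_cubeE[OF W u Ck_on_continuous[OF F1(3) sub] e] by blast
  have "\<bar>F (u(j := u j + h, k := u k + h)) - F (u(j := u j + h)) - F (u(k := u k + h)) + F u
      - h\<^sup>2 * partial_deriv k (partial_deriv j F) u\<bar> \<le> e * h\<^sup>2" if h: "0 < h" "h < d" for h
  proof -
    have inc: "u(k := y, j := x) \<in> cube m u d"
      if "x \<in> closed_segment (u j) (u j + h)" "y \<in> closed_segment (u k) (u k + h)" for x y
      using that h j k u sub jk by (auto simp: cube_def closed_segment_eq_real_ivl espace_iff)
    \<comment> \<open>The second difference is the increment in direction \<open>j\<close> of a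
      difference in direction \<open>k\<close>. The mean value theorem in \<open>j\<close> and then
      in \<open>k\<close> leaves \<open>h\<^sup>2\<close> times one mixed derivative at a point of
      the square.\<close>
    have "\<exists>x\<in>closed_segment (u j) (u j + h).
      (F (u(k := u k + h, j := u j + h)) - F (u(k := u k, j := u j + h)))
       - (F (u(k := u k + h, j := u j)) - F (u(k := u k, j := u j)))
      = (partial_deriv j F (u(k := u k + h, j := x)) - partial_deriv j F (u(k := u k, j := x)))
        * ((u j + h) - u j)"
    proof (rule MVT_segment, rule DERIV_diff)
      fix x assume x: "x \<in> closed_segment (u j) (u j + h)"
      have "u(k := u k + h, j := x) \<in> W" "u(k := u k, j := x) \<in> W"
        using inc[OF x, of "u k + h"] inc[OF x, of "u k"] d(2) by auto
      then show "((\<lambda>x. F (u(k := u k + h, j := x))) has_field_derivative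
          partial_deriv j F (u(k := u k + h, j := x))) (at x)"
        "((\<lambda>x. F (u(k := u k, j := x))) has_field_derivative
          partial_deriv j F (u(k := u k, j := x))) (at x)"
        using has_partial_deriv'[where h = x and u = "u(k := u k + h)", OF F1(1) _ j]
          has_partial_deriv'[where h = x and u = "u(k := u k)", OF F1(1) _ j] by blast+
    qed
    then obtain x where x: "x \<in> closed_segment (u j) (u j + h)"
      "F (u(k := u k + h, j := u j + h)) - F (u(j := u j + h)) - F (u(k := u k + h)) + F u
      = (partial_deriv j F (u(k := u k + h, j := x)) - partial_deriv j F (u(k := u k, j := x))) * h"
      using jk by (auto simp: fun_upd_twist algebra_simps)
    have "\<exists>y\<in>closed_segment (u k) (u k + h).
      partial_deriv j F (u(j := x, k := u k + h)) - partial_deriv j F (u(j := x, k := u k))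
      = partial_deriv k (partial_deriv j F) (u(j := x, k := y)) * ((u k + h) - u k)"
    proof (rule MVT_segment)
      fix y assume "y \<in> closed_segment (u k) (u k + h)"
      then have "u(j := x, k := y) \<in> W" using inc[OF x(1)] d(2) jk by (auto simp: fun_upd_twist)
      then show "((\<lambda>y. partial_deriv j F (u(j := x, k := y))) has_field_derivative
          partial_deriv k (partial_deriv j F) (u(j := x, k := y))) (at y)"
        using has_partial_deriv'[where h = y and u = "u(j := x)", OF F1(2) _ k] by blast
    qed
    then obtain y where y: "y \<in> closed_segment (u k) (u k + h)"
      "partial_deriv j F (u(k := u k + h, j := x)) - partial_deriv j F (u(k := u k, j := x))
      = partial_deriv k (partial_deriv j F) (u(k := y, j := x)) * h"
      unfolding fun_upd_twist[OF jk] by auto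
    have "F (u(j := u j + h, k := u k + h)) - F (u(j := u j + h)) - F (u(k := u k + h)) + F u
      - h\<^sup>2 * partial_deriv k (partial_deriv j F) u =
      (partial_deriv k (partial_deriv j F) (u(k := y, j := x)) - partial_deriv k (partial_deriv j F) u) * h\<^sup>2"
      using x(2) y(2) jk by (simp add: fun_upd_twist power2_eq_square algebra_simps)
    also have "\<bar>\<dots>\<bar> \<le> e * h\<^sup>2"
      using d(3)[OF inc[OF x(1) y(1)]] by (simp add: abs_mult mult_right_mono)
    finally show ?thesis .
  qed
  then show ?thesis using d(1) by blast
qed

text \<open>The second difference over a square of side \<open>h\<close> is symmetric in the two
  directions and, divided by \<open>h\<^sup>2\<close>, approximates either mixed derivative.\<close>

lemma partial_deriv_commute:
  assumes W: "openin (Euclidean_space m) W" and F: "Ck_on m 2 W F" and u: "u \<in> W"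
    and j: "j < m" and k: "k < m"
  shows "partial_deriv j (partial_deriv k F) u = partial_deriv k (partial_deriv j F) u"
proof (cases "j = k")
  case False
  let ?a = "partial_deriv j (partial_deriv k F) u" and ?b = "partial_deriv k (partial_deriv j F) u"
  have "\<bar>?a - ?b\<bar> \<le> 0 + e" if e: "e > 0" for e
  proof -
    obtain d d' where d: "d > 0" "d' > 0"
      "\<And>h. 0 < h \<Longrightarrow> h < d \<Longrightarrow> \<bar>F (u(j := u j + h, k := u k + h)) - F (u(j := u j + h)) - F (u(k := u k + h)) + F u
      - h\<^sup>2 * ?b\<bar> \<le> e / 2 * h\<^sup>2"
      "\<And>h. 0 < h \<Longrightarrow> h < d' \<Longrightarrow> \<bar>F (u(k := u k + h, j := u j + h)) - F (u(k := u k + h)) - F (u(j := u j + h)) + F u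
      - h\<^sup>2 * ?a\<bar> \<le> e / 2 * h\<^sup>2"
      using mixed_difference_approx[OF W F u j k False, of "e / 2"]
        mixed_difference_approx[OF W F u k j _, of "e / 2"] False e by auto
    define h where "h = min d d' / 2"
    have h: "0 < h" "h < d" "h < d'" using d(1,2) by (auto simp: h_def)
    have "\<bar>h\<^sup>2 * ?a - h\<^sup>2 * ?b\<bar> \<le> e * h\<^sup>2"
      using d(3)[OF h(1,2)] d(4)[OF h(1,3)] unfolding fun_upd_twist[OF False] by linarith
    then have "h\<^sup>2 * \<bar>?a - ?b\<bar> \<le> h\<^sup>2 * e"
      by (metis (no_types) abs_mult abs_of_nonneg mult.commute right_diff_distrib zero_le_power2)
    then show ?thesis using h(1) by simp
  qed
  then have "\<bar>?a - ?b\<bar> \<le> 0" by (rule field_le_epsilon)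
  then show ?thesis by simp
qed simp

section \<open>Taylor expansions\<close>

text \<open>The \<open>k\<close>-fold directional derivative along the fixed vector
  \<open>w\<close>, homogeneous of degree \<open>k\<close> in \<open>w\<close>; divided by
  \<open>fact k\<close> it is the Taylor term of order \<open>k\<close>.\<close>

primrec iter_dir ::
    "nat \<Rightarrow> (nat \<Rightarrow> real) \<Rightarrow> nat \<Rightarrow> ((nat \<Rightarrow> real) \<Rightarrow> real) \<Rightarrow> (nat \<Rightarrow> real) \<Rightarrow> real" where
  "iter_dir m w 0 F v = F v"
| "iter_dir m w (Suc k) F v = (\<Sum>j<m. w j * iter_dir m w k (partial_deriv j F) v)"

text \<open>Differentiating along the segment raises the order by one, which reduces the Taylor
  formula in several variables to Maclaurin's formula in the parameter \<open>t\<close>.\<close>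

lemma has_derivative_iter_dir_segment:
  fixes y z :: "nat \<Rightarrow> real"
  defines "\<gamma> \<equiv> \<lambda>t i. y i + t * (z i - y i)"
  assumes W: "openin (Euclidean_space m) W" and "Ck_on m (Suc k) W F"
    and y: "y \<in> espace m" and z: "z \<in> espace m" and t: "\<gamma> t \<in> W"
  shows "((\<lambda>t. iter_dir m (\<lambda>i. z i - y i) k F (\<gamma> t)) has_field_derivative
    iter_dir m (\<lambda>i. z i - y i) (Suc k) F (\<gamma> t)) (at t)"
  using assms(3)
proof (induction k arbitrary: F)
  case 0
  have "((\<lambda>t. F (\<gamma> t)) has_field_derivative
      (\<Sum>j<m. partial_deriv j F (\<gamma> t) * (z j - y j))) (at t)"
  proof (rule chain_rule_curve[where \<gamma> = \<gamma> and ?t0.0 = t, OF W _ t])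
    show "Ck_on m 1 W F" using 0 by simp
    show "\<forall>\<^sub>F t in at t. \<gamma> t \<in> espace m"
      using y z by (simp add: \<gamma>_def espace_iff)
    show "((\<lambda>t. \<gamma> t j) has_field_derivative z j - y j) (at t)" for j
      unfolding \<gamma>_def by (auto intro!: derivative_eq_intros)
  qed
  then show ?case by (simp add: mult.commute)
next
  case (Suc k)
  have "((\<lambda>t. \<Sum>j<m. (z j - y j) * iter_dir m (\<lambda>i. z i - y i) k (partial_deriv j F) (\<gamma> t))
    has_field_derivative
    (\<Sum>j<m. (z j - y j) * iter_dir m (\<lambda>i. z i - y i) (Suc k) (partial_deriv j F) (\<gamma> t))) (at t)"
    using Suc.prems by (intro DERIV_sum DERIV_cmult Suc.IH Ck_on_partial) auto
  then show ?case by simp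
qed

text \<open>Each level of the recursion contributes one factor \<open>l1 m w\<close>; the remaining
  factors are iterated partial derivatives, locally bounded by continuity.\<close>

lemma iter_dir_locally_bounded:
  assumes W: "openin (Euclidean_space m) W" and "Ck_on m k W F" and u: "u \<in> W"
  shows "\<exists>d>0. \<exists>C\<ge>0. cube m u d \<subseteq> W \<and>
    (\<forall>v\<in>cube m u d. \<forall>w. \<bar>iter_dir m w k F v\<bar> \<le> C * l1 m w ^ k)"
  using assms(2)
proof (induction k arbitrary: F)
  case 0
  have sub: "W \<subseteq> espace m" using W openin_subset topspace_eq_espace by blast
  obtain d where d: "d > 0" "cube m u d \<subseteq> W" "\<And>v. v \<in> cube m u d \<Longrightarrow> \<bar>F v - F u\<bar> < 1"
    using continuous_cubeE[OF W u Ck_on_continuous[OF 0 sub], of 1] by auto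
  have "\<bar>F v\<bar> \<le> \<bar>F u\<bar> + 1" if "v \<in> cube m u d" for v
    using d(3)[OF that] by linarith
  then have "\<forall>v\<in>cube m u d. \<forall>w. \<bar>iter_dir m w 0 F v\<bar> \<le> (\<bar>F u\<bar> + 1) * l1 m w ^ 0" by simp
  then show ?case using d(1,2) by (intro exI[of _ d] conjI exI[of _ "\<bar>F u\<bar> + 1"]) auto
next
  case (Suc k)
  have "\<forall>j\<in>{..<m}. \<exists>d>0. \<exists>C\<ge>0. cube m u d \<subseteq> W \<and>
    (\<forall>v\<in>cube m u d. \<forall>w. \<bar>iter_dir m w k (partial_deriv j F) v\<bar> \<le> C * l1 m w ^ k)"
    using Suc by (auto intro!: Suc.IH)
  then obtain d C where dC: "\<And>j. j < m \<Longrightarrow> d j > 0" "\<And>j. j < m \<Longrightarrow> C j \<ge> 0"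
    "\<And>j v w. j < m \<Longrightarrow> v \<in> cube m u (d j) \<Longrightarrow>
        \<bar>iter_dir m w k (partial_deriv j F) v\<bar> \<le> C j * l1 m w ^ k"
    unfolding bchoice_iff lessThan_iff Ball_def by metis
  obtain d0 where d0: "d0 > 0" "cube m u d0 \<subseteq> W" using open_contains_cube[OF W u] by blast
  define D where "D = Min (insert d0 (d ` {..<m}))"
  have D: "D > 0" "D \<le> d0" "\<And>k. k < m \<Longrightarrow> D \<le> d k" unfolding D_def using dC d0 by auto
  have "\<bar>iter_dir m w (Suc k) F v\<bar> \<le> (\<Sum>j<m. C j) * l1 m w ^ Suc k" if v: "v \<in> cube m u D" for v w
  proof -
    have "\<bar>iter_dir m w (Suc k) F v\<bar> \<le> (\<Sum>j<m. \<bar>w j\<bar> * \<bar>iter_dir m w k (partial_deriv j F) v\<bar>)"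
      by (simp add: abs_mult[symmetric] sum_abs)
    also have "\<dots> \<le> (\<Sum>j<m. l1 m w * (C j * l1 m w ^ k))"
    proof (rule sum_mono, rule mult_mono)
      fix j assume j: "j \<in> {..<m}"
      then show "\<bar>w j\<bar> \<le> l1 m w" by (intro member_le_sum) auto
      show "\<bar>iter_dir m w k (partial_deriv j F) v\<bar> \<le> C j * l1 m w ^ k"
        using j v D(3)[of j] cube_mono[of D "d j" m u] by (intro dC(3)) auto
    qed (auto simp: sum_nonneg)
    also have "\<dots> = l1 m w * ((\<Sum>j<m. C j) * l1 m w ^ k)"
      by (simp only: sum_distrib_left[symmetric] sum_distrib_right[symmetric])
    finally show ?thesis by (simp add: mult_ac)
  qed
  moreover have "0 \<le> (\<Sum>j<m. C j)" using dC(2) by (auto intro: sum_nonneg)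
  moreover have "cube m u D \<subseteq> W" using cube_mono[OF D(2)] d0 by blast
  ultimately show ?case using D(1) by blast
qed

definition taylor_remainder ::
    "nat \<Rightarrow> nat \<Rightarrow> ((nat \<Rightarrow> real) \<Rightarrow> real) \<Rightarrow> (nat \<Rightarrow> real) \<Rightarrow> (nat \<Rightarrow> real) \<Rightarrow> real" where
  "taylor_remainder m k F y z = F z - (\<Sum>i<k. iter_dir m (\<lambda>j. z j - y j) i F y / fact i)"

text \<open>The cube is convex, so the segment from \<open>y\<close> to \<open>z\<close> stays in
  \<open>W\<close> and the Lagrange remainder is a single directional derivative of order
  \<open>k\<close>.\<close>

lemma taylor_remainder_locally_bounded:
  assumes W: "openin (Euclidean_space m) W" and F: "Ck_on m k W F" and u: "u \<in> W" and k: "0 < k"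
  shows "\<exists>d>0. \<exists>C\<ge>0. \<forall>y\<in>cube m u d. \<forall>z\<in>cube m u d.
    \<bar>taylor_remainder m k F y z\<bar> \<le> C * l1 m (\<lambda>j. z j - y j) ^ k"
proof -
  obtain d C where d: "d > 0" "C \<ge> 0" "cube m u d \<subseteq> W"
    "\<And>v w. v \<in> cube m u d \<Longrightarrow> \<bar>iter_dir m w k F v\<bar> \<le> C * l1 m w ^ k"
    using iter_dir_locally_bounded[OF W F u] by blast
  have "\<bar>taylor_remainder m k F y z\<bar> \<le> C * l1 m (\<lambda>j. z j - y j) ^ k"
    if y: "y \<in> cube m u d" and z: "z \<in> cube m u d" for y z
  proof -
    define \<gamma> where "\<gamma> t i = y i + t * (z i - y i)" for t i
    have \<gamma>: "\<gamma> t \<in> cube m u d" if t: "0 \<le> t" "t \<le> 1" for t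
    proof -
      have "\<bar>\<gamma> t i - u i\<bar> < d" if "i < m" for i
      proof -
        have "y i \<in> ball (u i) d" "z i \<in> ball (u i) d"
          using y z that by (auto simp: cube_def dist_real_def)
        then have "(1 - t) * y i + t * z i \<in> ball (u i) d"
          using convexD[OF convex_ball, of "y i" "u i" d "z i" "1 - t" t] t by simp
        then show ?thesis by (simp add: \<gamma>_def dist_real_def algebra_simps abs_minus_commute)
      qed
      then show ?thesis using y z by (auto simp: cube_def \<gamma>_def espace_iff)
    qed
    define \<Phi> where "\<Phi> i t = iter_dir m (\<lambda>j. z j - y j) i F (\<gamma> t)" for i t
    have "DERIV (\<Phi> i) t :> \<Phi> (Suc i) t" if "i < k" "0 \<le> t" "t \<le> 1" for i t
      unfolding \<Phi>_def \<gamma>_def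
    proof (rule has_derivative_iter_dir_segment[OF W])
      show "Ck_on m (Suc i) W F" using Ck_on_le[OF _ F, of "Suc i"] that by simp
      show "(\<lambda>i. y i + t * (z i - y i)) \<in> W" using \<gamma>[OF that(2,3)] d(3) unfolding \<gamma>_def by blast
    qed (use y z cube_subset_espace in auto)
    then obtain t where t: "0 < t" "t < 1"
      "\<Phi> 0 1 = (\<Sum>i<k. \<Phi> i 0 / fact i * 1 ^ i) + \<Phi> k t / fact k * 1 ^ k"
      using Maclaurin[of 1 k \<Phi> "\<Phi> 0"] k by auto
    have "\<gamma> 0 = y" "\<gamma> 1 = z" by (auto simp: \<gamma>_def)
    then have "taylor_remainder m k F y z = \<Phi> k t / fact k"
      using t(3) by (simp add: taylor_remainder_def \<Phi>_def)
    also have "\<bar>\<dots>\<bar> \<le> \<bar>\<Phi> k t\<bar>"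
      by (simp add: divide_le_eq mult_le_cancel_left1 fact_ge_1)
    also have "\<dots> \<le> C * l1 m (\<lambda>j. z j - y j) ^ k"
      unfolding \<Phi>_def using \<gamma> t by (intro d(4)) auto
    finally show ?thesis .
  qed
  then show ?thesis using d by blast
qed

section \<open>From local to uniform bounds on compact sets\<close>

lemma compact_local_bound:
  assumes K: "compact K" "K \<subseteq> espace m"
    and loc: "\<And>u u'. u \<in> K \<Longrightarrow> u' \<in> K \<Longrightarrow>
      \<exists>d>0. \<exists>C\<ge>0. \<forall>y\<in>cube m u d. \<forall>z\<in>cube m u' d. g y z \<le> C * h y z"
    and h: "\<And>y z. h y z \<ge> (0::real)"
  shows "\<exists>C\<ge>0. \<forall>y\<in>K. \<forall>z\<in>K. g y z \<le> C * h y z"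
proof -
  \<comment> \<open>Cubes are only relatively open in \<open>espace m\<close>. These boxes are open
    in the whole function space and have the same trace on \<open>espace m\<close>, so they can
    cover \<open>K \<times> K\<close>.\<close>
  define B where "B u d = (\<Inter>i\<in>{..<m}. (\<lambda>v. v i) -` ball (u i) d)" for u :: "nat \<Rightarrow> real" and d
  have oB: "open (B u d)" for u d unfolding B_def by (intro open_INT ballI open_vimage) auto
  have cB: "v \<in> cube m u d" if "v \<in> B u d" "v \<in> K" for u v d
    using that K by (auto simp: B_def cube_def dist_real_def abs_minus_commute)
  have "\<forall>p\<in>K \<times> K. \<exists>d>0. \<exists>C\<ge>0. \<forall>y\<in>cube m (fst p) d. \<forall>z\<in>cube m (snd p) d. g y z \<le> C * h y z"
    using loc by auto
  then obtain d C where d: "\<And>p. p \<in> K \<times> K \<Longrightarrow> d p > 0" "\<And>p. p \<in> K \<times> K \<Longrightarrow> C p \<ge> 0"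
    "\<And>p y z. p \<in> K \<times> K \<Longrightarrow> y \<in> cube m (fst p) (d p) \<Longrightarrow> z \<in> cube m (snd p) (d p) \<Longrightarrow> g y z \<le> C p * h y z"
    by metis
  define U where "U p = B (fst p) (d p) \<times> B (snd p) (d p)" for p
  have "K \<times> K \<subseteq> (\<Union>p\<in>K \<times> K. U p)"
  proof
    fix p assume p: "p \<in> K \<times> K"
    then have "p \<in> U p" using d(1)[OF p] by (cases p) (auto simp: U_def B_def)
    then show "p \<in> (\<Union>p\<in>K \<times> K. U p)" using p by blast
  qed
  then obtain P where P: "P \<subseteq> K \<times> K" "finite P" "K \<times> K \<subseteq> (\<Union>p\<in>P. U p)"
    using compactE_image[OF compact_Times[OF K(1) K(1)], of "K \<times> K" U] oB
    by (auto simp: U_def open_Times)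
  have "g y z \<le> (\<Sum>p\<in>P. C p) * h y z" if yz: "y \<in> K" "z \<in> K" for y z
  proof -
    obtain p where p: "p \<in> P" "(y, z) \<in> U p" using P(3) yz by blast
    then have "g y z \<le> C p * h y z"
      using P(1) yz cB by (intro d(3)) (auto simp: U_def)
    \<comment> \<open>The sum of the finitely many nonnegative constants serves every member of the
      subcover, because \<open>h\<close> is nonnegative.\<close>
    also have "C p \<le> (\<Sum>p\<in>P. C p)" using P p d(2) by (intro member_le_sum) auto
    then have "C p * h y z \<le> (\<Sum>p\<in>P. C p) * h y z" using h by (rule mult_right_mono)
    finally show ?thesis .
  qed
  moreover have "(\<Sum>p\<in>P. C p) \<ge> 0" using P d(2) by (auto intro!: sum_nonneg)
  ultimately show ?thesis by blast
qed

text \<open>Off the diagonal of \<open>K \<times> K\<close> the Taylor bound is trivial, so \<open>K\<close> need not be convex.\<close>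

lemma taylor_remainder_far:
  assumes W: "openin (Euclidean_space m) W" and F: "Ck_on m k W F" and u: "u \<in> W" and u': "u' \<in> W"
    and ne: "u \<noteq> u'"
  shows "\<exists>d>0. \<exists>C\<ge>0. \<forall>y\<in>cube m u d. \<forall>z\<in>cube m u' d.
    \<bar>taylor_remainder m k F y z\<bar> \<le> C * l1 m (\<lambda>j. z j - y j) ^ k"
proof -
  have sub: "W \<subseteq> espace m" using W openin_subset topspace_eq_espace by blast
  have "\<exists>j<m. u j \<noteq> u' j"
  proof (rule ccontr)
    assume "\<not> ?thesis"
    moreover have "u \<in> espace m" "u' \<in> espace m" using u u' sub by auto
    ultimately have "u i = u' i" for i by (cases "i < m") (auto simp: espace_iff)
    then have "u = u'" by (rule ext)
    with ne show False by blast
  qed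
  then obtain j where j: "j < m" "u j \<noteq> u' j" by blast
  \<comment> \<open>Half the gap between the centers in one coordinate. As both cubes have radius at
    most \<open>\<delta> / 2\<close>, their points stay at least \<delta> apart in that coordinate,
    so any bound \<open>B\<close> on the remainder is at most \<open>B / \<delta> ^ k\<close> times
    the power on the right.\<close>
  define \<delta> where "\<delta> = \<bar>u' j - u j\<bar> / 2"
  have \<delta>: "\<delta> > 0" using j by (simp add: \<delta>_def)
  have "\<forall>i\<in>{..<k}. \<exists>d>0. \<exists>C\<ge>0. cube m u d \<subseteq> W \<and>
    (\<forall>v\<in>cube m u d. \<forall>w. \<bar>iter_dir m w i F v\<bar> \<le> C * l1 m w ^ i)"
    using iter_dir_locally_bounded[OF W Ck_on_le[OF _ F] u] by simp
  then obtain d C where d: "\<And>i. i < k \<Longrightarrow> d i > 0" "\<And>i. i < k \<Longrightarrow> C i \<ge> 0"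
    "\<And>i v w. i < k \<Longrightarrow> v \<in> cube m u (d i) \<Longrightarrow> \<bar>iter_dir m w i F v\<bar> \<le> C i * l1 m w ^ i"
    unfolding bchoice_iff lessThan_iff Ball_def by metis
  obtain d' C' where d': "d' > 0" "C' \<ge> 0" "\<And>v. v \<in> cube m u' d' \<Longrightarrow> \<bar>F v\<bar> \<le> C'"
    using iter_dir_locally_bounded[OF W Ck_on_le[OF _ F] u', of 0] by auto
  define D where "D = Min ({d', \<delta> / 2, 1} \<union> d ` {..<k})"
  have D: "D > 0" "D \<le> d'" "D \<le> \<delta> / 2" "D \<le> 1" "\<And>i. i < k \<Longrightarrow> D \<le> d i"
  proof -
    show "D > 0" unfolding D_def using d d' \<delta> by auto
    have "D \<le> x" if "x \<in> {d', \<delta> / 2, 1} \<union> d ` {..<k}" for x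
      unfolding D_def using that by (intro Min_le) auto
    from this[of d'] this[of "\<delta> / 2"] this[of 1] this[of "d i" for i]
    show "D \<le> d'" "D \<le> \<delta> / 2" "D \<le> 1" "\<And>i. i < k \<Longrightarrow> D \<le> d i" by auto
  qed
  \<comment> \<open>Bounds the l1 distance of any two points of the two cubes: with radius at most
    1, each coordinate gap grows by at most 2.\<close>
  define L where "L = l1 m (\<lambda>j. u' j - u j) + 2 * real m"
  define B where "B = C' + (\<Sum>i<k. C i * L ^ i)"
  have L: "L \<ge> 0" by (simp add: L_def sum_nonneg add_nonneg_nonneg)
  have B: "B \<ge> 0" unfolding B_def using d d' L by (auto intro!: add_nonneg_nonneg sum_nonneg)
  have "\<bar>taylor_remainder m k F y z\<bar> \<le> (B / \<delta> ^ k) * l1 m (\<lambda>j. z j - y j) ^ k"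
    if y: "y \<in> cube m u D" and z: "z \<in> cube m u' D" for y z
  proof -
    have yz: "\<bar>y i - u i\<bar> < D" "\<bar>z i - u' i\<bar> < D" if "i < m" for i
      using y z that by (auto simp: cube_def)
    have lL: "l1 m (\<lambda>j. z j - y j) \<le> L"
    proof -
      have "l1 m (\<lambda>j. z j - y j) \<le> (\<Sum>j<m. \<bar>u' j - u j\<bar> + 2)"
      proof (rule sum_mono)
        fix i assume "i \<in> {..<m}"
        then show "\<bar>z i - y i\<bar> \<le> \<bar>u' i - u i\<bar> + 2" using yz[of i] D(4) by auto
      qed
      then show ?thesis by (simp add: L_def sum.distrib)
    qed
    have "\<bar>u' j - u j\<bar> \<le> \<bar>z j - y j\<bar> + \<bar>y j - u j\<bar> + \<bar>z j - u' j\<bar>" by linarith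
    also have "\<dots> \<le> \<bar>z j - y j\<bar> + \<delta> / 2 + \<delta> / 2"
      using yz[OF j(1)] D(3) by (intro add_mono) auto
    finally have "\<delta> \<le> \<bar>z j - y j\<bar>" unfolding \<delta>_def by simp
    also have "\<dots> \<le> l1 m (\<lambda>j. z j - y j)" using j by (intro member_le_sum) auto
    finally have \<delta>l: "\<delta> ^ k \<le> l1 m (\<lambda>j. z j - y j) ^ k" using \<delta> by (intro power_mono) auto
    have "\<bar>taylor_remainder m k F y z\<bar>
      \<le> \<bar>F z\<bar> + (\<Sum>i<k. \<bar>iter_dir m (\<lambda>j. z j - y j) i F y / fact i\<bar>)"
      unfolding taylor_remainder_def
      by (rule order_trans[OF abs_triangle_ineq4], rule add_left_mono, rule sum_abs)
    also have "\<dots> \<le> C' + (\<Sum>i<k. C i * L ^ i)"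
    proof (intro add_mono sum_mono)
      show "\<bar>F z\<bar> \<le> C'" using z D(2) cube_mono by (intro d'(3)) blast
      fix i assume i: "i \<in> {..<k}"
      have "\<bar>iter_dir m (\<lambda>j. z j - y j) i F y / fact i\<bar> \<le> \<bar>iter_dir m (\<lambda>j. z j - y j) i F y\<bar>"
        by (simp add: divide_le_eq mult_le_cancel_left1 fact_ge_1)
      also have "\<dots> \<le> C i * l1 m (\<lambda>j. z j - y j) ^ i"
        using i y D(5)[of i] cube_mono[of D "d i" m u] by (intro d(3)) auto
      also have "\<dots> \<le> C i * L ^ i"
        using i d(2) lL by (intro mult_left_mono power_mono) (auto simp: sum_nonneg)
      finally show "\<bar>iter_dir m (\<lambda>j. z j - y j) i F y / fact i\<bar> \<le> C i * L ^ i" .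
    qed
    also have "\<dots> = (B / \<delta> ^ k) * \<delta> ^ k" using \<delta> by (simp add: B_def)
    also have "\<dots> \<le> (B / \<delta> ^ k) * l1 m (\<lambda>j. z j - y j) ^ k"
      using \<delta>l B \<delta> by (intro mult_left_mono) auto
    finally show ?thesis .
  qed
  then show ?thesis using D(1) B \<delta> by (intro exI[of _ D] conjI exI[of _ "B / \<delta> ^ k"]) auto
qed

lemma taylor_compact:
  assumes W: "openin (Euclidean_space m) W" and F: "Ck_on m k W F" and k: "0 < k"
    and K: "compact K" "K \<subseteq> W"
  shows "\<exists>C\<ge>0. \<forall>y\<in>K. \<forall>z\<in>K. \<bar>taylor_remainder m k F y z\<bar> \<le> C * l1 m (\<lambda>j. z j - y j) ^ k"
proof (rule compact_local_bound[OF K(1)])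
  show "K \<subseteq> espace m" using W K openin_subset topspace_eq_espace by blast
  fix u u' assume u: "u \<in> K" "u' \<in> K"
  then have "u \<in> W" "u' \<in> W" using K by auto
  then show "\<exists>d>0. \<exists>C\<ge>0. \<forall>y\<in>cube m u d. \<forall>z\<in>cube m u' d.
      \<bar>taylor_remainder m k F y z\<bar> \<le> C * l1 m (\<lambda>j. z j - y j) ^ k"
    using taylor_remainder_locally_bounded[OF W F _ k] taylor_remainder_far[OF W F]
    by (cases "u = u'") blast+
qed (simp add: sum_nonneg)

section \<open>Sums over forests\<close>

text \<open>An unordered pair \<open>P\<close> comes from \<open>2 / symmetry_factor (Dot P)\<close>
  ordered ones, so the weight \<open>1 / symmetry_factor\<close> amounts to a factor 1/2 on the
  ordered sum.\<close>

lemma sum_unordered_pairs: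
  fixes g :: "nat uprod \<Rightarrow> real"
  assumes A: "finite (A::nat set)"
  shows "(\<Sum>P\<in>(\<lambda>(\<alpha>, \<beta>). Upair \<alpha> \<beta>) ` (A \<times> A). 1 / symmetry_factor (Dot P) * g P)
    = 1 / 2 * (\<Sum>\<alpha>\<in>A. \<Sum>\<beta>\<in>A. g (Upair \<alpha> \<beta>))"
proof -
  let ?u = "\<lambda>(\<alpha>, \<beta>). Upair \<alpha> (\<beta>::nat)"
  have fib: "real (card {q \<in> A \<times> A. ?u q = P}) = 2 / symmetry_factor (Dot P)" if P: "P \<in> ?u ` (A \<times> A)" for P
  proof -
    obtain \<alpha> \<beta> where ab: "\<alpha> \<in> A" "\<beta> \<in> A" "P = Upair \<alpha> \<beta>" using P by auto
    have "{q \<in> A \<times> A. ?u q = P} = {(\<alpha>, \<beta>), (\<beta>, \<alpha>)}" using ab by auto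
    then show ?thesis using ab by (cases "\<alpha> = \<beta>") auto
  qed
  have "(\<Sum>\<alpha>\<in>A. \<Sum>\<beta>\<in>A. g (Upair \<alpha> \<beta>)) = (\<Sum>q\<in>A \<times> A. g (?u q))"
    by (simp add: sum.cartesian_product case_prod_beta)
  also have "\<dots> = (\<Sum>P\<in>?u ` (A \<times> A). \<Sum>q\<in>{q \<in> A \<times> A. ?u q = P}. g (?u q))"
    using A by (intro sum.image_gen) auto
  also have "\<dots> = (\<Sum>P\<in>?u ` (A \<times> A). 2 / symmetry_factor (Dot P) * g P)"
    by (intro sum.cong refl) (simp add: fib)
  also have "\<dots> = 2 * (\<Sum>P\<in>?u ` (A \<times> A). 1 / symmetry_factor (Dot P) * g P)"
    by (simp add: sum_distrib_left mult_ac)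
  finally show ?thesis by simp
qed

lemma forests_memI:
  assumes "\<alpha> \<in> {1..n}" "\<beta> \<in> {1..n}"
  shows "Vertex \<alpha> \<in> forests n" "Dot (Upair \<alpha> \<beta>) \<in> forests n" "Stack \<alpha> \<beta> \<in> forests n"
  using assms unfolding forests_def by blast+

text \<open>Trades symmetry factors for a uniform 1/2 over ordered labels, the shape in which the
  quadratic Taylor term appears.\<close>

lemma sum_forests:
  fixes g :: "forest \<Rightarrow> real"
  shows "(\<Sum>\<tau>\<in>forests n. 1 / symmetry_factor \<tau> * g \<tau>) = (\<Sum>\<alpha>=1..n. g (Vertex \<alpha>))
    + 1 / 2 * (\<Sum>\<alpha>=1..n. \<Sum>\<beta>=1..n. g (Dot (Upair \<alpha> \<beta>))) + (\<Sum>\<alpha>=1..n. \<Sum>\<beta>=1..n. g (Stack \<alpha> \<beta>))"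
proof -
  let ?A = "{1..n}" and ?u = "\<lambda>(\<alpha>, \<beta>). Upair \<alpha> (\<beta>::nat)"
  have eq: "forests n = Vertex ` ?A \<union> (Dot ` ?u ` (?A \<times> ?A) \<union> (\<lambda>(\<alpha>, \<beta>). Stack \<alpha> \<beta>) ` (?A \<times> ?A))"
  proof -
    have im: "(\<lambda>(\<alpha>, \<beta>). h \<alpha> \<beta>) ` (B \<times> B) = {h \<alpha> \<beta> | \<alpha> \<beta>. \<alpha> \<in> B \<and> \<beta> \<in> B}"
      for h :: "nat \<Rightarrow> nat \<Rightarrow> forest" and B by force
    have "Dot ` ?u ` (?A \<times> ?A) = (\<lambda>(\<alpha>, \<beta>). Dot (Upair \<alpha> \<beta>)) ` (?A \<times> ?A)"
      by (simp add: image_image case_prod_beta)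
    then show ?thesis unfolding forests_def im by blast
  qed
  have "(\<Sum>\<tau>\<in>forests n. 1 / symmetry_factor \<tau> * g \<tau>) =
     (\<Sum>\<tau>\<in>Vertex ` ?A. 1 / symmetry_factor \<tau> * g \<tau>)
     + ((\<Sum>\<tau>\<in>Dot ` ?u ` (?A \<times> ?A). 1 / symmetry_factor \<tau> * g \<tau>)
     + (\<Sum>\<tau>\<in>(\<lambda>(\<alpha>, \<beta>). Stack \<alpha> \<beta>) ` (?A \<times> ?A). 1 / symmetry_factor \<tau> * g \<tau>))"
    unfolding eq by (subst sum.union_disjoint; (subst sum.union_disjoint)?) auto
  also have "(\<Sum>\<tau>\<in>Vertex ` ?A. 1 / symmetry_factor \<tau> * g \<tau>) = (\<Sum>\<alpha>=1..n. g (Vertex \<alpha>))"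
    by (subst sum.reindex) (auto simp: inj_on_def)
  also have "(\<Sum>\<tau>\<in>Dot ` ?u ` (?A \<times> ?A). 1 / symmetry_factor \<tau> * g \<tau>) =
      (\<Sum>P\<in>?u ` (?A \<times> ?A). 1 / symmetry_factor (Dot P) * g (Dot P))"
    by (subst sum.reindex) (auto simp: inj_on_def)
  also have "\<dots> = 1 / 2 * (\<Sum>\<alpha>=1..n. \<Sum>\<beta>=1..n. g (Dot (Upair \<alpha> \<beta>)))"
    by (rule sum_unordered_pairs) simp
  also have "(\<Sum>\<tau>\<in>(\<lambda>(\<alpha>, \<beta>). Stack \<alpha> \<beta>) ` (?A \<times> ?A). 1 / symmetry_factor \<tau> * g \<tau>) =
     (\<Sum>\<alpha>=1..n. \<Sum>\<beta>=1..n. g (Stack \<alpha> \<beta>))"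
    by (subst sum.reindex) (auto simp: inj_on_def sum.cartesian_product case_prod_beta)
  finally show ?thesis by simp
qed

section \<open>Composition of jets\<close>

lemma sum_swap4:
  fixes t :: "'a \<Rightarrow> 'b \<Rightarrow> 'c \<Rightarrow> 'd \<Rightarrow> real"
  shows "(\<Sum>a\<in>A. \<Sum>b\<in>B. \<Sum>j\<in>J. \<Sum>k\<in>K. t a b j k) = (\<Sum>j\<in>J. \<Sum>k\<in>K. \<Sum>a\<in>A. \<Sum>b\<in>B. t a b j k)"
proof -
  have "(\<Sum>a\<in>A. \<Sum>b\<in>B. \<Sum>j\<in>J. \<Sum>k\<in>K. t a b j k) = (\<Sum>a\<in>A. \<Sum>j\<in>J. \<Sum>b\<in>B. \<Sum>k\<in>K. t a b j k)"
    by (rule sum.cong[OF refl]) (rule sum.swap)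
  also have "\<dots> = (\<Sum>j\<in>J. \<Sum>a\<in>A. \<Sum>b\<in>B. \<Sum>k\<in>K. t a b j k)" by (rule sum.swap)
  also have "\<dots> = (\<Sum>j\<in>J. \<Sum>a\<in>A. \<Sum>k\<in>K. \<Sum>b\<in>B. t a b j k)"
    by (rule sum.cong[OF refl], rule sum.cong[OF refl], rule sum.swap)
  also have "\<dots> = (\<Sum>j\<in>J. \<Sum>k\<in>K. \<Sum>a\<in>A. \<Sum>b\<in>B. t a b j k)"
    by (rule sum.cong[OF refl]) (rule sum.swap)
  finally show ?thesis .
qed

text \<open>The analogue of \<open>jet2\<close> at an arbitrary base point: transition maps have to
  be differentiated at \<open>x q\<close>, not at 0.\<close>

definition jet_at :: "nat \<Rightarrow> ((nat \<Rightarrow> real) \<Rightarrow> (nat \<Rightarrow> real)) \<Rightarrow> (nat \<Rightarrow> real) \<Rightarrow> jet" where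
  "jet_at m \<phi> v =
     ((\<lambda>i j. if i < m \<and> j < m then partial_deriv j (\<lambda>u. \<phi> u i) v else 0),
      (\<lambda>i j k. if i < m \<and> j < m \<and> k < m
               then partial_deriv j (partial_deriv k (\<lambda>u. \<phi> u i)) v else 0))"

lemma jet2_eq_jet_at: "jet2 m \<phi> = jet_at m \<phi> origin"
  by (simp add: jet2_def jet_at_def)

text \<open>The multiplication of the jet group, that is, the chain rule up to second order.\<close>

definition jet_comp :: "nat \<Rightarrow> jet \<Rightarrow> jet \<Rightarrow> jet" where
  "jet_comp m a b =
     ((\<lambda>i j. \<Sum>p<m. fst a i p * fst b p j),
      (\<lambda>i j k. (\<Sum>q<m. \<Sum>p<m. snd a i q p * fst b q j * fst b p k) + (\<Sum>p<m. fst a i p * snd b p j k)))"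

lemma jet_at_comp:
  assumes W: "openin (Euclidean_space m) W" and F: "\<And>i. i < m \<Longrightarrow> Ck_on m 2 W (\<lambda>v. F v i)"
    and N: "openin (Euclidean_space m) N" and u: "u \<in> N"
    and \<phi>: "\<And>v. v \<in> N \<Longrightarrow> \<phi> v \<in> W" and \<phi>2: "\<And>k. k < m \<Longrightarrow> Ck_on m 2 N (\<lambda>v. \<phi> v k)"
  shows "jet_at m (\<lambda>v. F (\<phi> v)) u = jet_comp m (jet_at m F (\<phi> u)) (jet_at m \<phi> u)"
proof (rule prod_eqI)
  have F1: "Ck_on m 1 W (\<lambda>v. F v i)" and \<phi>1: "Ck_on m 1 N (\<lambda>v. \<phi> v i)" if "i < m" for i
    using Ck_on_le[of 1 2, OF _ F[OF that]] Ck_on_le[of 1 2, OF _ \<phi>2[OF that]]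
    by (simp_all del: Ck_on.simps One_nat_def)
  show "fst (jet_at m (\<lambda>v. F (\<phi> v)) u) = fst (jet_comp m (jet_at m F (\<phi> u)) (jet_at m \<phi> u))"
    using chain_rule_partial[OF W F1 N u _ \<phi> \<phi>1]
    by (auto simp: jet_at_def jet_comp_def fun_eq_iff intro!: sum.cong)
  show "snd (jet_at m (\<lambda>v. F (\<phi> v)) u) = snd (jet_comp m (jet_at m F (\<phi> u)) (jet_at m \<phi> u))"
    using chain_rule_partial2[OF W F N u _ _ \<phi> \<phi>2]
    by (auto simp: jet_at_def jet_comp_def fun_eq_iff intro!: sum.cong arg_cong2[where f = "(+)"])
qed

text \<open>Second derivatives agree because the first derivatives agree on all of the open set
  \<open>N\<close>, not only at \<open>u\<close>.\<close>

lemma jet_at_cong: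
  assumes N: "openin (Euclidean_space m) N" and u: "u \<in> N" and eq: "\<And>v. v \<in> N \<Longrightarrow> F v = G v"
  shows "jet_at m F u = jet_at m G u"
proof -
  have 1: "partial_deriv j (\<lambda>v. F v i) w = partial_deriv j (\<lambda>v. G v i) w" if "w \<in> N" "j < m" for i j w
    using eq by (intro partial_deriv_cong[OF N that]) simp
  have "partial_deriv k (partial_deriv j (\<lambda>v. F v i)) u = partial_deriv k (partial_deriv j (\<lambda>v. G v i)) u"
    if "j < m" "k < m" for i j k
    using 1 that by (intro partial_deriv_cong[OF N u]) auto
  with 1[OF u] show ?thesis by (auto simp: jet_at_def fun_eq_iff)
qed

text \<open>The action on a \<open>Dot\<close> component reads the vertex components of both labels.
  When actions are iterated, these must be in range, for otherwise the inner action has set them to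
  0.\<close>

lemma forests_uprod_labels:
  assumes "Dot P \<in> forests n"
  shows "Vertex (Min (set_uprod P)) \<in> forests n" "Vertex (Max (set_uprod P)) \<in> forests n"
proof -
  obtain \<alpha> \<beta> where "P = Upair \<alpha> \<beta>" "\<alpha> \<in> {1..n}" "\<beta> \<in> {1..n}"
    using assms by (auto simp: forests_def)
  then show "Vertex (Min (set_uprod P)) \<in> forests n" "Vertex (Max (set_uprod P)) \<in> forests n"
    by (auto simp: forests_def min_def max_def)
qed

text \<open>Linear parts multiply as matrices. The two summands of the second-order chain rule
  produce the quadratic part of \<open>a\<close> evaluated on transformed vertex components and the
  linear part of \<open>a\<close> applied to the quadratic part of \<open>b\<close>.\<close>

lemma jet_act_comp:
  "jet_act m n (jet_comp m a b) f = jet_act m n a (jet_act m n b f)"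
proof -
  obtain a1 a2 b1 b2 where ab: "a = (a1, a2)" "b = (b1, b2)" by (metis surj_pair)
  have lin: "(\<Sum>j<m. (\<Sum>p<m. a1 i p * b1 p j) * h j) = (\<Sum>p<m. a1 i p * (\<Sum>j<m. b1 p j * h j))"
    for i and h :: "nat \<Rightarrow> real"
    by (simp add: sum_distrib_left sum_distrib_right mult.assoc) (rule sum.swap)
  have quad: "(\<Sum>j<m. \<Sum>k<m. (\<Sum>q<m. \<Sum>p<m. a2 i q p * b1 q j * b1 p k) * g j * h k)
    = (\<Sum>q<m. \<Sum>p<m. a2 i q p * (\<Sum>j<m. b1 q j * g j) * (\<Sum>k<m. b1 p k * h k))"
    for i and g h :: "nat \<Rightarrow> real"
  proof -
    have "(\<Sum>j<m. \<Sum>k<m. (\<Sum>q<m. \<Sum>p<m. a2 i q p * b1 q j * b1 p k) * g j * h k)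
      = (\<Sum>j<m. \<Sum>k<m. \<Sum>q<m. \<Sum>p<m. a2 i q p * (b1 q j * g j) * (b1 p k * h k))"
      by (simp add: sum_distrib_left sum_distrib_right mult_ac)
    also have "\<dots> = (\<Sum>q<m. \<Sum>p<m. \<Sum>j<m. \<Sum>k<m. a2 i q p * (b1 q j * g j) * (b1 p k * h k))"
      by (rule sum_swap4)
    also have "\<dots> = (\<Sum>q<m. \<Sum>p<m. a2 i q p * (\<Sum>j<m. b1 q j * g j) * (\<Sum>k<m. b1 p k * h k))"
      by (simp add: sum_distrib_left sum_distrib_right mult_ac)
    finally show ?thesis .
  qed
  have lin2: "(\<Sum>j<m. \<Sum>k<m. (\<Sum>p<m. a1 i p * b2 p j k) * g j * h k)
    = (\<Sum>p<m. a1 i p * (\<Sum>j<m. \<Sum>k<m. b2 p j k * g j * h k))" for i and g h :: "nat \<Rightarrow> real"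
  proof -
    have "(\<Sum>j<m. \<Sum>k<m. (\<Sum>p<m. a1 i p * b2 p j k) * g j * h k)
      = (\<Sum>j<m. \<Sum>k<m. \<Sum>p<m. a1 i p * (b2 p j k * g j * h k))"
      by (simp add: sum_distrib_left sum_distrib_right mult_ac)
    also have "\<dots> = (\<Sum>j<m. \<Sum>p<m. \<Sum>k<m. a1 i p * (b2 p j k * g j * h k))"
      by (rule sum.cong[OF refl]) (rule sum.swap)
    also have "\<dots> = (\<Sum>p<m. \<Sum>j<m. \<Sum>k<m. a1 i p * (b2 p j k * g j * h k))"
      by (rule sum.swap)
    finally show ?thesis by (simp add: sum_distrib_left)
  qed
  have "jet_act m n (jet_comp m a b) f i \<tau> = jet_act m n a (jet_act m n b f) i \<tau>" for i \<tau>
  proof (cases "i < m \<and> \<tau> \<in> forests n")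
    case True
    show ?thesis
    proof (cases \<tau>)
      case (Dot P)
      note l = forests_uprod_labels[of P n]
      have "jet_act m n (jet_comp m a b) f i \<tau> =
        (\<Sum>p<m. a1 i p * (\<Sum>j<m. b1 p j * f j (Dot P))) +
        ((\<Sum>q<m. \<Sum>p<m. a2 i q p * (\<Sum>j<m. b1 q j * f j (Vertex (Min (set_uprod P)))) *
            (\<Sum>k<m. b1 p k * f k (Vertex (Max (set_uprod P))))) +
        (\<Sum>p<m. a1 i p * (\<Sum>j<m. \<Sum>k<m. b2 p j k *
           f j (Vertex (Min (set_uprod P))) * f k (Vertex (Max (set_uprod P))))))"
        using True Dot
        by (simp add: jet_act_def jet_comp_def ab lin quad[symmetric] lin2[symmetric]
            distrib_right sum.distrib)
      then show ?thesis using True Dot l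
        by (simp add: jet_act_def ab distrib_left sum.distrib)
    qed (use True in \<open>simp_all add: jet_act_def jet_comp_def ab lin\<close>)
  qed (auto simp: jet_act_def)
  then show ?thesis by (simp add: fun_eq_iff)
qed

lemma partial_deriv_const: "partial_deriv j (\<lambda>_. c) = (\<lambda>_. 0)"
  by (simp add: partial_deriv_def fun_eq_iff)

lemma partial_deriv_coord: "partial_deriv j (\<lambda>u. u i) = (\<lambda>_. if i = j then 1 else 0)"
  by (auto simp: partial_deriv_def fun_eq_iff)

lemma jet_at_id:
  "jet_at m id u = ((\<lambda>i j. if i < m \<and> i = j then 1 else 0), (\<lambda>i j k. 0))"
  by (auto simp: jet_at_def partial_deriv_coord partial_deriv_const fun_eq_iff)

text \<open>The action sets out-of-range entries to 0, so it can fix \<open>f\<close> only if they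
  already vanish; hence the membership in \<open>fiber_space\<close>.\<close>

lemma jet_act_id:
  assumes "f \<in> fiber_space m n" shows "jet_act m n (jet_at m id u) f = f"
proof -
  have "jet_act m n (jet_at m id u) f i \<tau> = f i \<tau>" for i \<tau>
  proof (cases "i < m \<and> \<tau> \<in> forests n")
    case True
    have "(\<Sum>j<m. (if i < m \<and> i = j then 1 else 0) * f j \<tau>) = f i \<tau>" for \<tau>
      using True by (simp add: if_distrib[of "\<lambda>x. x * _"] cong: if_cong)
    with True show ?thesis by (cases \<tau>) (simp_all add: jet_act_def jet_at_id)
  next
    case False
    then show ?thesis using assms by (auto simp: jet_act_def fiber_space_def)
  qed
  then show ?thesis by (simp add: fun_eq_iff)
qed

lemma smooth_on_const: "smooth_on m W (\<lambda>_. c)"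
proof -
  have "Ck_on m k W (\<lambda>_. c)" for k c
    by (induction k arbitrary: c) (simp_all add: partial_deriv_const)
  then show ?thesis by (simp add: smooth_on_def)
qed

lemma smooth_on_coord: "W \<subseteq> espace m \<Longrightarrow> smooth_on m W (\<lambda>u. u i)"
proof -
  assume W: "W \<subseteq> espace m"
  have c: "continuous_map (subtopology (Euclidean_space m) W) euclideanreal (\<lambda>u. u i)"
    using W by (simp add: subtopology_Euclidean_space continuous_on_subset[OF continuous_on_product_coordinates])
  have "Ck_on m k W (\<lambda>u. u i)" for k
  proof (cases k)
    case (Suc l)
    have "(\<lambda>h. (u(j := h)) i) differentiable at (u j)" for u :: "nat \<Rightarrow> real" and j
      by (cases "i = j") auto
    then show ?thesis using c Suc smooth_on_const
      by (simp add: partial_deriv_coord smooth_on_def)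
  qed (use c in simp)
  then show ?thesis by (simp add: smooth_on_def)
qed

lemma pointed_smooth_map_id: "pointed_smooth_map m id"
  by (simp add: pointed_smooth_map_def smooth_map_on_def smooth_on_coord topspace_eq_espace)

text \<open>Gives reflexivity of \<open>assoc_rel\<close>: a generator belongs to its own
  class.\<close>

lemma inverse_jets_id: "inverse_jets m id id"
  by (simp add: inverse_jets_def pointed_smooth_map_id)

lemma Ck_on_subset:
  assumes "Ck_on m k W F" "W' \<subseteq> W" shows "Ck_on m k W' F"
  using assms(1)
proof (induction k arbitrary: F)
  case 0
  then show ?case using assms(2) by (auto intro: continuous_map_from_subtopology_mono)
next
  case (Suc k)
  then show ?case using assms(2) by (auto intro: continuous_map_from_subtopology_mono)
qed

lemma smooth_on_Ck_on: "smooth_on m W F \<Longrightarrow> Ck_on m k W F"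
  by (simp add: smooth_on_def)

lemma smooth_map_on_Ck_on: "smooth_map_on m W \<phi> \<Longrightarrow> i < m \<Longrightarrow> Ck_on m k W (\<lambda>u. \<phi> u i)"
  by (simp add: smooth_map_on_def smooth_on_def)

section \<open>Fiber coordinates under a change of chart\<close>

locale manifold =
  fixes m :: nat and M :: "'a topology" and A :: "'a chart set"
  assumes smooth_manifold: "smooth_manifold m M A"
begin

lemma top_chart: "(U, x) \<in> A \<Longrightarrow> top_chart m M (U, x)"
  using smooth_manifold unfolding smooth_manifold_def by blast

lemma chart_openin: "(U, x) \<in> A \<Longrightarrow> openin M U"
  using top_chart by (auto simp: top_chart_def)

lemma chart_homeomorphic:
  "(U, x) \<in> A \<Longrightarrow> homeomorphic_map (subtopology M U) (subtopology (Euclidean_space m) (x ` U)) x"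
  using top_chart by (auto simp: top_chart_def)

lemma chart_inj: "(U, x) \<in> A \<Longrightarrow> inj_on x U"
  using chart_homeomorphic[of U x] chart_openin[of U x] openin_subset[of M U]
  by (auto simp: homeomorphic_eq_everything_map inf_absorb2)

lemma chart_image_openin:
  assumes c: "(U, x) \<in> A" and V: "openin M V" "V \<subseteq> U"
  shows "openin (Euclidean_space m) (x ` V)"
proof -
  have "openin (subtopology M U) V" using V by (simp add: openin_subset_topspace_eq openin_subtopology_Int2 inf_absorb2 openin_subtopology) (metis inf_absorb1)
  then have "openin (subtopology (Euclidean_space m) (x ` U)) (x ` V)"
    using chart_homeomorphic[OF c] by (auto simp: homeomorphic_eq_everything_map open_map_def)
  moreover have "openin (Euclidean_space m) (x ` U)" using top_chart[OF c] by (auto simp: top_chart_def)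
  ultimately show ?thesis by (rule openin_trans_full)
qed

definition transition :: "'a chart \<Rightarrow> ('a \<Rightarrow> nat \<Rightarrow> real) \<Rightarrow> (nat \<Rightarrow> real) \<Rightarrow> (nat \<Rightarrow> real)" where
  "transition c y u = y (inv_into (fst c) (snd c) u)"

lemma transition_apply: "(U, x) \<in> A \<Longrightarrow> q \<in> U \<Longrightarrow> transition (U, x) y (x q) = y q"
  by (simp add: transition_def chart_inj)

lemma transition_smooth:
  assumes "(U, x) \<in> A" "(V, y) \<in> A"
  shows "smooth_map_on m (x ` (U \<inter> V)) (transition (U, x) y)"
  using assms smooth_manifold unfolding smooth_manifold_def smoothly_compatible_def transition_def by fastforce

lemma overlap_image_openin:
  assumes "(U, x) \<in> A" "(V, y) \<in> A"
  shows "openin (Euclidean_space m) (x ` (U \<inter> V))"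
  using assms chart_openin by (intro chart_image_openin) auto

section \<open>Frames and the well-definedness of fiber coordinates\<close>

lemma local_diffeo_chart:
  assumes \<psi>: "local_diffeo m M A \<psi>" and c: "(U, x) \<in> A" and 0: "\<psi> origin \<in> U"
  obtains N where "openin (Euclidean_space m) N" "origin \<in> N" "\<And>v. v \<in> N \<Longrightarrow> \<psi> v \<in> U"
    "smooth_map_on m N (x \<circ> \<psi>)"
proof -
  obtain N where N: "openin (Euclidean_space m) N" "origin \<in> N" "openin M (\<psi> ` N)"
     "homeomorphic_map (subtopology (Euclidean_space m) N) (subtopology M (\<psi> ` N)) \<psi>"
     "smooth_map_on m (N \<inter> \<psi> -` U) (x \<circ> \<psi>)"
    using \<psi> c unfolding local_diffeo_def by blast
  \<comment> \<open>The neighborhood \<open>N\<close> of the local diffeomorphism need not map into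
    \<open>U\<close>. It is shrunk to the preimage of \<open>U\<close>, which is still open by
    continuity.\<close>
  have "openin (subtopology M (\<psi> ` N)) (\<psi> ` N \<inter> U)"
    using chart_openin[OF c] by (simp add: openin_subtopology_Int2)
  then have "openin (subtopology (Euclidean_space m) N)
      {v \<in> topspace (subtopology (Euclidean_space m) N). \<psi> v \<in> \<psi> ` N \<inter> U}"
    using N(4) openin_continuous_map_preimage homeomorphic_imp_continuous_map by blast
  moreover have "{v \<in> topspace (subtopology (Euclidean_space m) N). \<psi> v \<in> \<psi> ` N \<inter> U} = N \<inter> \<psi> -` U"
    using openin_subset[OF N(1)] by auto
  ultimately have "openin (Euclidean_space m) (N \<inter> \<psi> -` U)"
    using N(1) openin_trans_full by metis
  then show ?thesis using that N 0 by blast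
qed

lemma frame_ofD:
  assumes "\<psi>' \<in> frame_of m M A \<psi>"
  shows "local_diffeo m M A \<psi>'" "\<psi>' origin = \<psi> origin"
    "(U, x) \<in> A \<Longrightarrow> \<psi> origin \<in> U \<Longrightarrow> jet2 m (x \<circ> \<psi>') = jet2 m (x \<circ> \<psi>)"
  using assms unfolding frame_of_def by blast+

lemma local_diffeo_in_frame_of: "local_diffeo m M A \<psi> \<Longrightarrow> \<psi> \<in> frame_of m M A \<psi>"
  by (simp add: frame_of_def case_prod_beta)

text \<open>Related pairs have the same coordinates: the jet of \<phi> gained by the frame cancels
  against the jet of \<theta> applied to the fiber element.\<close>

lemma jet_act_change_frame:
  assumes \<psi>: "local_diffeo m M A \<psi>" and c: "(U, x) \<in> A" and 0: "\<psi> origin \<in> U"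
    and inv: "inverse_jets m \<phi> \<theta>" and f: "f \<in> fiber_space m n"
  shows "jet_act m n (jet2 m (x \<circ> (\<psi> \<circ> \<phi>))) (jet_act m n (jet2 m \<theta>) f) = jet_act m n (jet2 m (x \<circ> \<psi>)) f"
proof -
  obtain N where N: "openin (Euclidean_space m) N" "origin \<in> N" "\<And>v. v \<in> N \<Longrightarrow> \<psi> v \<in> U"
    "smooth_map_on m N (x \<circ> \<psi>)"
    using local_diffeo_chart[OF \<psi> c 0] by blast
  have sm: "\<And>i k. i < m \<Longrightarrow> Ck_on m k (espace m) (\<lambda>v. \<phi> v i)" "\<And>i k. i < m \<Longrightarrow> Ck_on m k (espace m) (\<lambda>v. \<theta> v i)"
    and o: "\<phi> origin = origin" "\<theta> origin = origin"
    and maps: "\<phi> \<in> espace m \<rightarrow> espace m" "\<theta> \<in> espace m \<rightarrow> espace m"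
    and id: "jet2 m (\<phi> \<circ> \<theta>) = jet2 m id"
    using inv by (auto simp: inverse_jets_def pointed_smooth_map_def topspace_eq_espace smooth_map_on_Ck_on)
  have E: "openin (Euclidean_space m) (espace m)" by (metis openin_topspace topspace_eq_espace)
  have oE: "origin \<in> espace m" by (simp add: espace_iff)
  \<comment> \<open>The map \<phi> is defined on the whole space, but
    \<open>x \<circ> \<psi>\<close> is known to be smooth only on \<open>N\<close>.\<close>
  define N' where "N' = espace m \<inter> \<phi> -` N"
  have N': "openin (Euclidean_space m) N'"
  proof -
    have "continuous_on (espace m) \<phi>"
    proof (intro continuous_on_coordinatewise_then_product)
      \<comment> \<open>Smoothness covers coordinates below \<open>m\<close>; the others vanish
        identically because \<phi> maps into \<open>espace m\<close>.\<close>
      fix i show "continuous_on (espace m) (\<lambda>v. \<phi> v i)"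
      proof (cases "i < m")
        case True
        then show ?thesis using sm(1)[OF True, of 0] Ck_on_continuous by blast
      next
        case False
        then have "\<phi> v i = 0" if "v \<in> espace m" for v
          using maps(1) that by (auto simp: espace_iff Pi_iff)
        then show ?thesis by (simp cong: continuous_on_cong)
      qed
    qed
    moreover have "openin (top_of_set (espace m)) N" using N(1) by (metis Euclidean_space_eq)
    ultimately have "openin (top_of_set (espace m)) N'"
      unfolding N'_def using maps(1) by (intro continuous_openin_preimage) auto
    then show ?thesis by (metis Euclidean_space_eq)
  qed
  have 1: "jet2 m (x \<circ> (\<psi> \<circ> \<phi>)) = jet_comp m (jet2 m (x \<circ> \<psi>)) (jet2 m \<phi>)"
  proof -
    have "jet_at m (\<lambda>v. (x \<circ> \<psi>) (\<phi> v)) origin = jet_comp m (jet_at m (x \<circ> \<psi>) (\<phi> origin)) (jet_at m \<phi> origin)"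
    proof (rule jet_at_comp[OF N(1) _ N'])
      show "origin \<in> N'" using N(2) o oE by (simp add: N'_def)
      show "Ck_on m 2 N' (\<lambda>v. \<phi> v k)" if "k < m" for k
        by (rule Ck_on_subset[OF sm(1)[OF that]]) (simp add: N'_def)
      show "Ck_on m 2 N (\<lambda>v. (x \<circ> \<psi>) v i)" if "i < m" for i
        by (rule smooth_map_on_Ck_on[OF N(4) that])
    qed (simp add: N'_def)
    then show ?thesis by (simp add: jet2_eq_jet_at o comp_def)
  qed
  have 2: "jet2 m (\<phi> \<circ> \<theta>) = jet_comp m (jet2 m \<phi>) (jet2 m \<theta>)"
    using jet_at_comp[OF E sm(1) E oE _ sm(2)] maps(2)
    by (simp add: jet2_eq_jet_at o comp_def Pi_iff)
  have "jet_act m n (jet2 m (x \<circ> (\<psi> \<circ> \<phi>))) (jet_act m n (jet2 m \<theta>) f)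
      = jet_act m n (jet2 m (x \<circ> \<psi>)) (jet_act m n (jet_comp m (jet2 m \<phi>) (jet2 m \<theta>)) f)"
    by (simp add: 1 jet_act_comp)
  also have "\<dots> = jet_act m n (jet2 m (x \<circ> \<psi>)) f"
    by (simp only: 2[symmetric] id jet2_eq_jet_at[of m id] jet_act_id[OF f])
  finally show ?thesis .
qed

text \<open>Both \<open>bundle_proj\<close> and \<open>fiber_coords\<close> are definite
  descriptions over a whole class, so all representatives must give one value. Every member of \<xi>
  is a single \<open>assoc_rel\<close> step from the generator \<open>(P0, f)\<close>, and such a
  step preserves base point and coordinates.\<close>

lemma fiber_coords_frame:
  assumes \<xi>: "\<xi> \<in> rough_velocity_bundle m n M A" and q: "bundle_proj \<xi> = q"
  obtains \<psi> f where "local_diffeo m M A \<psi>" "\<psi> origin = q"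
    "\<And>U x. (U, x) \<in> A \<Longrightarrow> q \<in> U \<Longrightarrow> fiber_coords m n x \<xi> = jet_act m n (jet2 m (x \<circ> \<psi>)) f"
proof -
  obtain P0 f where P0: "P0 \<in> frame_bundle m M A" and f: "f \<in> fiber_space m n"
    and \<xi>': "\<xi> = assoc_rel m n M A `` {(P0, f)}"
    using \<xi> unfolding rough_velocity_bundle_def quotient_def by blast
  obtain \<psi>0 where \<psi>0: "local_diffeo m M A \<psi>0" "P0 = frame_of m M A \<psi>0"
    using P0 by (auto simp: frame_bundle_def)
  have "jet_act m n (jet2 m id) f = f" by (simp add: jet2_eq_jet_at jet_act_id[OF f])
  then have "\<exists>\<psi>\<in>P0. \<exists>\<phi> \<theta>. inverse_jets m \<phi> \<theta> \<and>
      P0 = frame_of m M A (\<psi> \<circ> \<phi>) \<and> f = jet_act m n (jet2 m \<theta>) f"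
    using inverse_jets_id local_diffeo_in_frame_of[OF \<psi>0(1)] \<psi>0(2)
    by (intro bexI[of _ \<psi>0] exI[of _ id]) simp_all
  then have "((P0, f), (P0, f)) \<in> assoc_rel m n M A"
    unfolding assoc_rel_def using P0 f by blast
  then have mem: "(P0, f) \<in> \<xi>" "\<psi>0 \<in> P0"
    using \<xi>' local_diffeo_in_frame_of[OF \<psi>0(1)] \<psi>0(2) by auto
  have all: "\<psi> origin = \<psi>0 origin \<and> (\<forall>U x. (U, x) \<in> A \<longrightarrow> \<psi>0 origin \<in> U \<longrightarrow>
      jet_act m n (jet2 m (x \<circ> \<psi>)) f' = jet_act m n (jet2 m (x \<circ> \<psi>0)) f)"
    if "(P, f') \<in> \<xi>" "\<psi> \<in> P" for P f' \<psi>
  proof -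
    have "((P0, f), (P, f')) \<in> assoc_rel m n M A" using that(1) \<xi>' by auto
    then obtain \<psi>1 \<phi> \<theta> where *: "\<psi>1 \<in> P0" "inverse_jets m \<phi> \<theta>" "P = frame_of m M A (\<psi>1 \<circ> \<phi>)"
      "f' = jet_act m n (jet2 m \<theta>) f"
      unfolding assoc_rel_def by blast
    have o: "\<phi> origin = origin" using *(2) by (auto simp: inverse_jets_def pointed_smooth_map_def)
    note \<psi>1 = frame_ofD[OF *(1)[unfolded \<psi>0(2)]]
    note \<psi> = frame_ofD[OF that(2)[unfolded *(3)]]
    show ?thesis
    proof (intro conjI allI impI)
      show "\<psi> origin = \<psi>0 origin" using \<psi>(2) \<psi>1(2) o by simp
      fix U x assume c: "(U, x) \<in> A" and U: "\<psi>0 origin \<in> U"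
      have "jet2 m (x \<circ> \<psi>) = jet2 m (x \<circ> (\<psi>1 \<circ> \<phi>))"
        using \<psi>(3)[OF c] \<psi>1(2) o U by simp
      then have "jet_act m n (jet2 m (x \<circ> \<psi>)) f' = jet_act m n (jet2 m (x \<circ> \<psi>1)) f"
        using jet_act_change_frame[OF \<psi>1(1) c _ *(2) f] U \<psi>1(2) *(4) by simp
      then show "jet_act m n (jet2 m (x \<circ> \<psi>)) f' = jet_act m n (jet2 m (x \<circ> \<psi>0)) f"
        using \<psi>1(3)[OF c U] by simp
    qed
  qed
  have "bundle_proj \<xi> = \<psi>0 origin"
    unfolding bundle_proj_def
  proof (rule the_equality)
    show "\<exists>(P, f)\<in>\<xi>. \<exists>\<psi>\<in>P. \<psi>0 origin = \<psi> origin" using mem by blast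
    show "q' = \<psi>0 origin" if "\<exists>(P, f)\<in>\<xi>. \<exists>\<psi>\<in>P. q' = \<psi> origin" for q'
      using that all by blast
  qed
  then have 0: "\<psi>0 origin = q" using q by simp
  have "fiber_coords m n x \<xi> = jet_act m n (jet2 m (x \<circ> \<psi>0)) f" if "(U, x) \<in> A" "q \<in> U" for U x
    unfolding fiber_coords_def
  proof (rule the_equality)
    show "\<exists>(P, f')\<in>\<xi>. \<exists>\<psi>\<in>P. jet_act m n (jet2 m (x \<circ> \<psi>0)) f = jet_act m n (jet2 m (x \<circ> \<psi>)) f'"
      using mem by blast
    show "g = jet_act m n (jet2 m (x \<circ> \<psi>0)) f"
      if "\<exists>(P, f')\<in>\<xi>. \<exists>\<psi>\<in>P. g = jet_act m n (jet2 m (x \<circ> \<psi>)) f'" for g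
      using that all \<open>(U, x) \<in> A\<close> \<open>q \<in> U\<close> 0 by blast
  qed
  then show ?thesis using that[OF \<psi>0(1) 0] by blast
qed

text \<open>Near 0, \<open>y \<circ> \<psi>\<close> is the transition map composed with
  \<open>x \<circ> \<psi>\<close>; the jets multiply, and the action respects the product.\<close>

lemma fiber_coords_transition:
  assumes \<xi>: "\<xi> \<in> rough_velocity_bundle m n M A" and q: "bundle_proj \<xi> = q"
    and c: "(U, x) \<in> A" "(V, y) \<in> A" and qUV: "q \<in> U \<inter> V"
  shows "fiber_coords m n y \<xi> = jet_act m n (jet_at m (transition (U, x) y) (x q)) (fiber_coords m n x \<xi>)"
proof -
  obtain \<psi> f where \<psi>: "local_diffeo m M A \<psi>" "\<psi> origin = q"
    "\<And>U x. (U, x) \<in> A \<Longrightarrow> q \<in> U \<Longrightarrow> fiber_coords m n x \<xi> = jet_act m n (jet2 m (x \<circ> \<psi>)) f"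
    by (rule fiber_coords_frame[OF \<xi> q]) blast
  obtain N where N: "openin (Euclidean_space m) N" "origin \<in> N" "\<And>v. v \<in> N \<Longrightarrow> \<psi> v \<in> U"
    "smooth_map_on m N (x \<circ> \<psi>)"
    using local_diffeo_chart[OF \<psi>(1) c(1)] \<psi>(2) qUV by blast
  obtain N' where N': "openin (Euclidean_space m) N'" "origin \<in> N'" "\<And>v. v \<in> N' \<Longrightarrow> \<psi> v \<in> V"
    using local_diffeo_chart[OF \<psi>(1) c(2)] \<psi>(2) qUV by blast
  have NN: "openin (Euclidean_space m) (N \<inter> N')" "origin \<in> N \<inter> N'" using N N' by auto
  have "jet2 m (y \<circ> \<psi>) = jet_at m (\<lambda>v. transition (U, x) y ((x \<circ> \<psi>) v)) origin"
    unfolding jet2_eq_jet_at using N(3) by (intro jet_at_cong[OF NN]) (simp add: transition_apply[OF c(1)])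
  also have "\<dots> = jet_comp m (jet_at m (transition (U, x) y) ((x \<circ> \<psi>) origin)) (jet_at m (x \<circ> \<psi>) origin)"
  proof (rule jet_at_comp[OF overlap_image_openin[OF c] _ NN])
    show "Ck_on m 2 (x ` (U \<inter> V)) (\<lambda>v. transition (U, x) y v i)" if "i < m" for i
      using transition_smooth[OF c] that by (rule smooth_map_on_Ck_on)
    show "Ck_on m 2 (N \<inter> N') (\<lambda>v. (x \<circ> \<psi>) v i)" if "i < m" for i
      by (rule Ck_on_subset[OF smooth_map_on_Ck_on[OF N(4) that]]) auto
  qed (use N N' in auto)
  finally show ?thesis
    using \<psi>(3)[OF c(1)] \<psi>(3)[OF c(2)] \<psi>(2) qUV by (simp add: jet_act_comp jet2_eq_jet_at)
qed

end

section \<open>Admissibility in every chart\<close>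

locale admissible_field = manifold m M A
  for m :: nat and M :: "'a topology" and A :: "'a chart set" +
  fixes n :: nat and f :: "'a \<Rightarrow> 'a velocity"
  assumes rough_velocity_field: "rough_velocity_field m n M A f"
    and admissible: "admissible m n M A f"
begin

lemma local_rep_apply:
  "(U, x) \<in> A \<Longrightarrow> q \<in> U \<Longrightarrow> local_rep m n (U, x) f i \<tau> (x q) = fiber_coords m n x (f q) i \<tau>"
  by (simp add: local_rep_def chart_inj)

lemma local_rep_Ck_on:
  "(U, x) \<in> A \<Longrightarrow> i < m \<Longrightarrow> \<tau> \<in> forests n \<Longrightarrow> Ck_on m k (x ` U) (local_rep m n (U, x) f i \<tau>)"
  using rough_velocity_field unfolding rough_velocity_field_def by (blast intro: smooth_on_Ck_on)

text \<open>For \<open>Dot\<close>, the action orders the labels by \<open>Min\<close> and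
  \<open>Max\<close>. Symmetry of the second derivatives of the transition map allows any
  order.\<close>

lemma fiber_coords_change:
  assumes c: "(U, x) \<in> A" "(V, y) \<in> A" and q: "q \<in> U \<inter> V" and i: "i < m"
    and \<alpha>: "\<alpha> \<in> {1..n}" and \<beta>: "\<beta> \<in> {1..n}"
  defines "g \<equiv> \<lambda>u. transition (U, x) y u i" and "F \<equiv> fiber_coords m n x (f q)"
  shows "fiber_coords m n y (f q) i (Vertex \<alpha>) = (\<Sum>j<m. partial_deriv j g (x q) * F j (Vertex \<alpha>))"
    and "fiber_coords m n y (f q) i (Stack \<alpha> \<beta>) = (\<Sum>j<m. partial_deriv j g (x q) * F j (Stack \<alpha> \<beta>))"
    and "fiber_coords m n y (f q) i (Dot (Upair \<alpha> \<beta>)) =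
      (\<Sum>j<m. partial_deriv j g (x q) * F j (Dot (Upair \<alpha> \<beta>))) +
      (\<Sum>j<m. \<Sum>k<m. partial_deriv j (partial_deriv k g) (x q) * F j (Vertex \<alpha>) * F k (Vertex \<beta>))"
proof -
  have "q \<in> topspace M" using chart_openin[OF c(1)] q openin_subset by blast
  then have "f q \<in> rough_velocity_bundle m n M A" "bundle_proj (f q) = q"
    using rough_velocity_field by (auto simp: rough_velocity_field_def)
  note tr = fiber_coords_transition[OF this c q]
  show "fiber_coords m n y (f q) i (Vertex \<alpha>) = (\<Sum>j<m. partial_deriv j g (x q) * F j (Vertex \<alpha>))"
    "fiber_coords m n y (f q) i (Stack \<alpha> \<beta>) = (\<Sum>j<m. partial_deriv j g (x q) * F j (Stack \<alpha> \<beta>))"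
    unfolding tr using i forests_memI[OF \<alpha> \<beta>]
    by (simp_all add: jet_act_def jet_at_def g_def F_def)
  let ?a2 = "\<lambda>i j k. if i < m \<and> j < m \<and> k < m
    then partial_deriv j (partial_deriv k (\<lambda>u. transition (U, x) y u i)) (x q) else 0"
  have "?a2 i j k = ?a2 i k j" for i j k
    using partial_deriv_commute[OF overlap_image_openin[OF c] smooth_map_on_Ck_on[OF transition_smooth[OF c]]] q
    by auto
  from jet_act_Dot[of ?a2, OF this i \<alpha> \<beta>]
  show "fiber_coords m n y (f q) i (Dot (Upair \<alpha> \<beta>)) =
      (\<Sum>j<m. partial_deriv j g (x q) * F j (Dot (Upair \<alpha> \<beta>))) +
      (\<Sum>j<m. \<Sum>k<m. partial_deriv j (partial_deriv k g) (x q) * F j (Vertex \<alpha>) * F k (Vertex \<beta>))"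
    unfolding tr jet_at_def using i by (simp add: g_def F_def)
qed

text \<open>Differentiating the transformation law of the vertex coordinates yields two terms. The
  one with second derivatives of the transition map is the extra term in the law for
  \<open>Dot\<close>; the other is admissibility in the chart \<open>(V, y)\<close>.\<close>

lemma admissible_in_chart:
  assumes c: "(U, x) \<in> A" and q: "q \<in> U" and i: "i < m"
    and \<alpha>: "\<alpha> \<in> {1..n}" and \<beta>: "\<beta> \<in> {1..n}"
  shows "(\<Sum>j<m. partial_deriv j (local_rep m n (U, x) f i (Vertex \<beta>)) (x q)
                    * fiber_coords m n x (f q) j (Vertex \<alpha>))
           = fiber_coords m n x (f q) i (Dot (Upair \<alpha> \<beta>))
             + fiber_coords m n x (f q) i (Stack \<alpha> \<beta>)"
proof -
  have "q \<in> topspace M" using chart_openin[OF c] q openin_subset by blast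
  then obtain V y where d: "(V, y) \<in> A" and qV: "q \<in> V"
    and adm: "\<And>i. i < m \<Longrightarrow> (\<Sum>j<m. partial_deriv j (local_rep m n (V, y) f i (Vertex \<beta>)) (y q)
                    * fiber_coords m n y (f q) j (Vertex \<alpha>))
           = fiber_coords m n y (f q) i (Dot (Upair \<alpha> \<beta>)) + fiber_coords m n y (f q) i (Stack \<alpha> \<beta>)"
    using admissible \<alpha> \<beta> unfolding admissible_def by blast
  define g where "g i u = transition (V, y) x u i" for i u
  define G where "G j \<tau> = fiber_coords m n y (f q) j \<tau>" for j \<tau>
  define v where "v = y q"
  let ?F = "local_rep m n (U, x) f i (Vertex \<beta>)"
  let ?G = "\<lambda>j. local_rep m n (V, y) f j (Vertex \<beta>)"
  let ?N = "y ` (V \<inter> U)"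
  have qVU: "q \<in> V \<inter> U" using q qV by blast
  have N: "openin (Euclidean_space m) ?N" by (rule overlap_image_openin[OF d c])
  have vN: "v \<in> ?N" using qVU by (auto simp: v_def)
  have W: "openin (Euclidean_space m) (x ` U)" using chart_image_openin[OF c] chart_openin[OF c] by blast
  have gk: "Ck_on m k ?N (g j)" if "j < m" for j k
    unfolding g_def[abs_def] by (rule smooth_map_on_Ck_on[OF transition_smooth[OF d c] that])
  have V\<beta>: "Vertex \<beta> \<in> forests n" using forests_memI[OF \<beta> \<beta>] by simp
  note change = fiber_coords_change[OF d c]
  \<comment> \<open>One derivative is computed twice: here by the product rule from the
    transformation law, below by the chain rule. Comparison gives \<open>key\<close>.\<close>
  have "partial_deriv k (\<lambda>w. ?F (transition (V, y) x w)) v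
      = (\<Sum>p<m. partial_deriv k (partial_deriv p (g i)) v * G p (Vertex \<beta>)
          + partial_deriv k (?G p) v * partial_deriv p (g i) v)" if k: "k < m" for k
  proof -
    have "partial_deriv k (\<lambda>w. ?F (transition (V, y) x w)) v
      = partial_deriv k (\<lambda>w. \<Sum>p<m. partial_deriv p (g i) w * ?G p w) v"
    proof (rule partial_deriv_cong[OF N vN k])
      fix w assume "w \<in> ?N"
      then obtain r where r: "r \<in> V \<inter> U" "w = y r" by blast
      then show "?F (transition (V, y) x w) = (\<Sum>p<m. partial_deriv p (g i) w * ?G p w)"
        using change(1)[OF r(1) i \<beta> \<beta>]
        by (simp add: transition_apply[OF d] local_rep_apply[OF c] local_rep_apply[OF d] g_def[abs_def])
    qed
    also have "\<dots> = (\<Sum>p<m. partial_deriv k (partial_deriv p (g i)) v * ?G p v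
          + partial_deriv k (?G p) v * partial_deriv p (g i) v)"
    proof (intro partial_derivI DERIV_sum)
      fix p assume p: "p \<in> {..<m}"
      have 1: "((\<lambda>h. partial_deriv p (g i) (v(k := h))) has_field_derivative
         partial_deriv k (partial_deriv p (g i)) v) (at (v k))"
        using gk[OF i, of 2] p vN k by (intro has_partial_deriv[of m 0 ?N]) (auto simp: numeral_2_eq_2)
      have 2: "((\<lambda>h. ?G p (v(k := h))) has_field_derivative partial_deriv k (?G p) v) (at (v k))"
        using local_rep_Ck_on[OF d _ V\<beta>, of p 1] p qV k
        by (intro has_partial_deriv[of m 0 "y ` V"]) (auto simp: v_def)
      show "((\<lambda>h. partial_deriv p (g i) (v(k := h)) * ?G p (v(k := h))) has_field_derivative
         partial_deriv k (partial_deriv p (g i)) v * ?G p v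
          + partial_deriv k (?G p) v * partial_deriv p (g i) v) (at (v k))"
        using DERIV_mult[OF 1 2] by simp
    qed
    finally show ?thesis by (simp add: v_def G_def local_rep_apply[OF d qV])
  qed
  moreover have "partial_deriv k (\<lambda>w. ?F (transition (V, y) x w)) v
     = (\<Sum>j<m. partial_deriv j ?F (x q) * partial_deriv k (g j) v)" if k: "k < m" for k
  proof -
    have "partial_deriv k (\<lambda>w. ?F (transition (V, y) x w)) v
     = (\<Sum>j<m. partial_deriv j ?F (transition (V, y) x v) * partial_deriv k (\<lambda>w. transition (V, y) x w j) v)"
    proof (rule chain_rule_partial[OF W local_rep_Ck_on[OF c i V\<beta>] N vN k])
      show "transition (V, y) x w \<in> x ` U" if "w \<in> ?N" for w
        using that by (auto simp: transition_apply[OF d])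
      show "Ck_on m 1 ?N (\<lambda>w. transition (V, y) x w j)" if "j < m" for j
        using gk[OF that, of 1] unfolding g_def[abs_def] .
    qed
    then show ?thesis by (simp add: v_def transition_apply[OF d qV] g_def[abs_def])
  qed
  ultimately have key: "(\<Sum>j<m. partial_deriv j ?F (x q) * partial_deriv k (g j) v)
    = (\<Sum>p<m. partial_deriv k (partial_deriv p (g i)) v * G p (Vertex \<beta>)
          + partial_deriv k (?G p) v * partial_deriv p (g i) v)" if "k < m" for k
    using that by simp
  have "(\<Sum>j<m. partial_deriv j ?F (x q) * fiber_coords m n x (f q) j (Vertex \<alpha>))
    = (\<Sum>j<m. \<Sum>k<m. partial_deriv j ?F (x q) * partial_deriv k (g j) v * G k (Vertex \<alpha>))"
    using change(1)[OF qVU _ \<alpha> \<alpha>]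
    by (simp add: g_def[abs_def] G_def v_def sum_distrib_left mult.assoc)
  also have "\<dots> = (\<Sum>k<m. (\<Sum>j<m. partial_deriv j ?F (x q) * partial_deriv k (g j) v) * G k (Vertex \<alpha>))"
    by (subst sum.swap) (simp add: sum_distrib_right)
  also have "\<dots> = (\<Sum>k<m. (\<Sum>p<m. partial_deriv k (partial_deriv p (g i)) v * G p (Vertex \<beta>)
          + partial_deriv k (?G p) v * partial_deriv p (g i) v) * G k (Vertex \<alpha>))"
    by (simp add: key)
  also have "\<dots> = (\<Sum>k<m. \<Sum>p<m. partial_deriv k (partial_deriv p (g i)) v * G k (Vertex \<alpha>) * G p (Vertex \<beta>))
    + (\<Sum>k<m. \<Sum>p<m. partial_deriv p (g i) v * (partial_deriv k (?G p) v * G k (Vertex \<alpha>)))"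
    by (simp add: sum_distrib_right sum_distrib_left sum.distrib distrib_right distrib_left mult_ac)
  \<comment> \<open>Only here is the assumed admissibility of the field used, once for each
    component \<open>p\<close>.\<close>
  also have "(\<Sum>k<m. \<Sum>p<m. partial_deriv p (g i) v * (partial_deriv k (?G p) v * G k (Vertex \<alpha>)))
    = (\<Sum>p<m. partial_deriv p (g i) v * (G p (Dot (Upair \<alpha> \<beta>)) + G p (Stack \<alpha> \<beta>)))"
    using adm by (subst sum.swap) (simp add: G_def v_def flip: sum_distrib_left)
  finally show ?thesis
    using change(2,3)[OF qVU i \<alpha> \<beta>]
    by (simp add: g_def[abs_def] G_def v_def distrib_left sum.distrib)
qed

end

section \<open>Euler increments of a branched rough path\<close>

text \<open>Along a principal filter big-O is a bound uniform over the set. The algebra of big-O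
  then handles the constants, and this equivalence recovers an explicit one at the end.\<close>

lemma bigo_principal_iff:
  fixes f g :: "'i \<Rightarrow> real"
  shows "f \<in> O[principal Q](g) \<longleftrightarrow> (\<exists>c\<ge>0. \<forall>x\<in>Q. \<bar>f x\<bar> \<le> c * \<bar>g x\<bar>)"
proof
  assume "f \<in> O[principal Q](g)"
  then show "\<exists>c\<ge>0. \<forall>x\<in>Q. \<bar>f x\<bar> \<le> c * \<bar>g x\<bar>"
    by (elim landau_o.bigE) (auto simp: eventually_principal intro!: less_imp_le)
next
  assume "\<exists>c\<ge>0. \<forall>x\<in>Q. \<bar>f x\<bar> \<le> c * \<bar>g x\<bar>"
  then obtain c where "\<forall>x\<in>Q. \<bar>f x\<bar> \<le> c * \<bar>g x\<bar>" by blast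
  then show "f \<in> O[principal Q](g)" by (intro bigoI[of _ c]) (auto simp: eventually_principal)
qed

lemma bounded_comp_bigo:
  fixes F :: "'b::topological_space \<Rightarrow> real"
  assumes "compact K" "continuous_on K F" "\<forall>\<^sub>F p in Fil. Y p \<in> K"
  shows "(\<lambda>p. F (Y p)) \<in> O[Fil](\<lambda>_. 1)"
proof -
  obtain B where B: "\<And>v. v \<in> K \<Longrightarrow> \<bar>F v\<bar> \<le> B"
    using compact_imp_bounded[OF compact_continuous_image[OF assms(2,1)]]
    by (auto simp: bounded_iff)
  show ?thesis by (rule bigoI[of _ B], use assms(3) in eventually_elim) (simp add: B)
qed

text \<open>The defect of additivity of the Euler increments, with \<open>a\<close>, \<open>b\<close> the first-level and
  \<open>S1\<close>, \<open>S2\<close> the second-level increments over the two subintervals.\<close>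

lemma euler_defect_identity:
  fixes P P' a b :: "nat \<Rightarrow> real" and D D' Z Z' S1 S2 :: "nat \<Rightarrow> nat \<Rightarrow> real"
  assumes sym: "\<And>\<alpha> \<beta>. D \<alpha> \<beta> = D \<beta> \<alpha>"
  shows "((\<Sum>\<alpha>\<in>I. P \<alpha> * a \<alpha>) + 1/2 * (\<Sum>\<alpha>\<in>I. \<Sum>\<beta>\<in>I. D \<alpha> \<beta> * (a \<alpha> * a \<beta>)) + (\<Sum>\<alpha>\<in>I. \<Sum>\<beta>\<in>I. Z \<alpha> \<beta> * S1 \<alpha> \<beta>))
    + ((\<Sum>\<alpha>\<in>I. P' \<alpha> * b \<alpha>) + 1/2 * (\<Sum>\<alpha>\<in>I. \<Sum>\<beta>\<in>I. D' \<alpha> \<beta> * (b \<alpha> * b \<beta>)) + (\<Sum>\<alpha>\<in>I. \<Sum>\<beta>\<in>I. Z' \<alpha> \<beta> * S2 \<alpha> \<beta>))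
    - ((\<Sum>\<alpha>\<in>I. P \<alpha> * (a \<alpha> + b \<alpha>)) + 1/2 * (\<Sum>\<alpha>\<in>I. \<Sum>\<beta>\<in>I. D \<alpha> \<beta> * ((a \<alpha> + b \<alpha>) * (a \<beta> + b \<beta>)))
       + (\<Sum>\<alpha>\<in>I. \<Sum>\<beta>\<in>I. Z \<alpha> \<beta> * (S1 \<alpha> \<beta> + S2 \<alpha> \<beta> + a \<alpha> * b \<beta>)))
    = (\<Sum>\<beta>\<in>I. (P' \<beta> - P \<beta> - (\<Sum>\<alpha>\<in>I. (D \<alpha> \<beta> + Z \<alpha> \<beta>) * a \<alpha>)) * b \<beta>)
      + 1/2 * (\<Sum>\<alpha>\<in>I. \<Sum>\<beta>\<in>I. (D' \<alpha> \<beta> - D \<alpha> \<beta>) * (b \<alpha> * b \<beta>))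
      + (\<Sum>\<alpha>\<in>I. \<Sum>\<beta>\<in>I. (Z' \<alpha> \<beta> - Z \<alpha> \<beta>) * S2 \<alpha> \<beta>)"
proof -
  \<comment> \<open>Symmetry of \<open>D\<close> merges the two cross terms into twice one of them.
    The factor 1/2 leaves \<open>D\<close> paired with \<open>a \<alpha> * b \<beta>\<close>,
    exactly like the term of \<open>Z\<close> from Chen's relation; hence \<open>D + Z\<close>, the
    combination in the admissibility condition.\<close>
  have 1: "(\<Sum>\<alpha>\<in>I. \<Sum>\<beta>\<in>I. D \<alpha> \<beta> * ((a \<alpha> + b \<alpha>) * (a \<beta> + b \<beta>))) =
    (\<Sum>\<alpha>\<in>I. \<Sum>\<beta>\<in>I. D \<alpha> \<beta> * (a \<alpha> * a \<beta>)) + (\<Sum>\<alpha>\<in>I. \<Sum>\<beta>\<in>I. D \<alpha> \<beta> * (b \<alpha> * b \<beta>))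
     + 2 * (\<Sum>\<alpha>\<in>I. \<Sum>\<beta>\<in>I. D \<alpha> \<beta> * (a \<alpha> * b \<beta>))"
  proof -
    have "(\<Sum>\<alpha>\<in>I. \<Sum>\<beta>\<in>I. D \<alpha> \<beta> * (b \<alpha> * a \<beta>)) = (\<Sum>\<alpha>\<in>I. \<Sum>\<beta>\<in>I. D \<alpha> \<beta> * (a \<alpha> * b \<beta>))"
      by (subst sum.swap) (simp add: sym[of _ _] mult.commute)
    then show ?thesis by (simp add: algebra_simps sum.distrib)
  qed
  have 2: "(\<Sum>\<beta>\<in>I. (P' \<beta> - P \<beta> - (\<Sum>\<alpha>\<in>I. (D \<alpha> \<beta> + Z \<alpha> \<beta>) * a \<alpha>)) * b \<beta>)
     = (\<Sum>\<beta>\<in>I. P' \<beta> * b \<beta>) - (\<Sum>\<beta>\<in>I. P \<beta> * b \<beta>)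
     - ((\<Sum>\<alpha>\<in>I. \<Sum>\<beta>\<in>I. D \<alpha> \<beta> * (a \<alpha> * b \<beta>)) + (\<Sum>\<alpha>\<in>I. \<Sum>\<beta>\<in>I. Z \<alpha> \<beta> * (a \<alpha> * b \<beta>)))"
  proof -
    have "(\<Sum>\<beta>\<in>I. (\<Sum>\<alpha>\<in>I. (D \<alpha> \<beta> + Z \<alpha> \<beta>) * a \<alpha>) * b \<beta>)
      = (\<Sum>\<beta>\<in>I. \<Sum>\<alpha>\<in>I. D \<alpha> \<beta> * (a \<alpha> * b \<beta>) + Z \<alpha> \<beta> * (a \<alpha> * b \<beta>))"
      by (simp add: sum_distrib_right distrib_right mult.assoc)
    also have "\<dots> = (\<Sum>\<alpha>\<in>I. \<Sum>\<beta>\<in>I. D \<alpha> \<beta> * (a \<alpha> * b \<beta>) + Z \<alpha> \<beta> * (a \<alpha> * b \<beta>))"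
      by (rule sum.swap)
    finally show ?thesis by (simp add: left_diff_distrib sum_subtractf sum.distrib)
  qed
  show ?thesis
    unfolding 1 2 by (simp add: distrib_left left_diff_distrib sum.distrib sum_subtractf)
qed

text \<open>The quantity \<Xi>, with the coefficients \<open>F\<close> already evaluated at a point
  and one component \<open>i\<close> selected.\<close>

definition rough_increment ::
    "nat \<Rightarrow> (forest \<Rightarrow> real \<Rightarrow> real \<Rightarrow> real) \<Rightarrow> (forest \<Rightarrow> real) \<Rightarrow> real \<Rightarrow> real \<Rightarrow> real" where
  "rough_increment n X F s t = (\<Sum>\<tau>\<in>forests n. 1 / symmetry_factor \<tau> * F \<tau> * X \<tau> s t)"

lemma rough_increment_eq:
  "rough_increment n X F s t = (\<Sum>\<alpha>=1..n. F (Vertex \<alpha>) * X (Vertex \<alpha>) s t)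
    + 1/2 * (\<Sum>\<alpha>=1..n. \<Sum>\<beta>=1..n. F (Dot (Upair \<alpha> \<beta>)) * X (Dot (Upair \<alpha> \<beta>)) s t)
    + (\<Sum>\<alpha>=1..n. \<Sum>\<beta>=1..n. F (Stack \<alpha> \<beta>) * X (Stack \<alpha> \<beta>) s t)"
  unfolding rough_increment_def using sum_forests[where g = "\<lambda>\<tau>. F \<tau> * X \<tau> s t"] by (simp add: mult.assoc)

section \<open>Orders of magnitude in the control\<close>

locale rough_driver =
  fixes S T p :: real and n :: nat and \<omega> :: "real \<Rightarrow> real \<Rightarrow> real"
    and X :: "forest \<Rightarrow> real \<Rightarrow> real \<Rightarrow> real"
  assumes p1: "1 \<le> p" and p3: "p < 3"
    and control: "control S T \<omega>"
    and rough: "branched_rough_path n S T p \<omega> X"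
begin

text \<open>The size of a first-level increment. Second-level increments and the admissible error
  become its natural powers 2 and 3, so no real exponents occur in the big-O calculations.\<close>

definition gauge :: "real \<Rightarrow> real \<Rightarrow> real" where
  "gauge s t = \<omega> s t powr (1 / p)"

lemma control_nonneg: "S \<le> s \<Longrightarrow> s \<le> t \<Longrightarrow> t \<le> T \<Longrightarrow> 0 \<le> \<omega> s t"
  using control by (auto simp: control_def)

lemma control_superadditive:
  "S \<le> s \<Longrightarrow> s \<le> u \<Longrightarrow> u \<le> t \<Longrightarrow> t \<le> T \<Longrightarrow> \<omega> s u + \<omega> u t \<le> \<omega> s t"
  using control by (auto simp: control_def)

lemma control_refl: "S \<le> s \<Longrightarrow> s \<le> T \<Longrightarrow> \<omega> s s = 0"
  using control by (auto simp: control_def)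

lemma control_mono:
  assumes "S \<le> s" "s \<le> s'" "s' \<le> t'" "t' \<le> t" "t \<le> T"
  shows "\<omega> s' t' \<le> \<omega> s t"
  using control_superadditive[of s s' t] control_superadditive[of s' t' t]
    control_nonneg[of s s'] control_nonneg[of t' t] assms by linarith

lemma gauge_nonneg [simp]: "0 \<le> gauge s t"
  by (simp add: gauge_def)

lemma gauge_mono:
  assumes "S \<le> s" "s \<le> s'" "s' \<le> t'" "t' \<le> t" "t \<le> T"
  shows "gauge s' t' \<le> gauge s t"
  unfolding gauge_def using control_mono[OF assms] control_nonneg[of s' t'] assms p1
  by (intro powr_mono2) auto

text \<open>The case \<open>k = 0\<close> is excluded because \<open>0 powr 0 = 0\<close>, whereas
  \<open>0 ^ 0 = 1\<close>.\<close>

lemma gauge_power: "0 < k \<Longrightarrow> gauge s t ^ k = \<omega> s t powr (real k / p)"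
  unfolding gauge_def by (cases "\<omega> s t = 0") (auto simp: powr_power)

lemma rough_bounds:
  obtains C where "0 \<le> C"
    "\<And>\<alpha> s t. \<alpha> \<in> {1..n} \<Longrightarrow> S \<le> s \<Longrightarrow> s \<le> t \<Longrightarrow> t \<le> T \<Longrightarrow> \<bar>X (Vertex \<alpha>) s t\<bar> \<le> C * gauge s t"
    "\<And>\<alpha> \<beta> s t. \<alpha> \<in> {1..n} \<Longrightarrow> \<beta> \<in> {1..n} \<Longrightarrow> S \<le> s \<Longrightarrow> s \<le> t \<Longrightarrow> t \<le> T \<Longrightarrow>
      \<bar>X (Stack \<alpha> \<beta>) s t\<bar> \<le> C * gauge s t ^ 2"
proof -
  obtain C where "0 < C" and C: "\<forall>\<alpha>\<in>{1..n}. \<forall>\<beta>\<in>{1..n}. \<forall>s t. S \<le> s \<and> s \<le> t \<and> t \<le> T \<longrightarrow>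
        \<bar>X (Vertex \<alpha>) s t\<bar> \<le> C * \<omega> s t powr (1 / p) \<and>
        \<bar>X (Dot (Upair \<alpha> \<beta>)) s t\<bar> \<le> C * \<omega> s t powr (2 / p) \<and>
        \<bar>X (Stack \<alpha> \<beta>) s t\<bar> \<le> C * \<omega> s t powr (2 / p)"
    using rough unfolding branched_rough_path_def by blast
  show ?thesis
  proof (rule that[of C])
    show "\<bar>X (Vertex \<alpha>) s t\<bar> \<le> C * gauge s t"
      if "\<alpha> \<in> {1..n}" "S \<le> s" "s \<le> t" "t \<le> T" for \<alpha> s t
      using C that unfolding gauge_def by blast
    show "\<bar>X (Stack \<alpha> \<beta>) s t\<bar> \<le> C * gauge s t ^ 2"
      if "\<alpha> \<in> {1..n}" "\<beta> \<in> {1..n}" "S \<le> s" "s \<le> t" "t \<le> T" for \<alpha> \<beta> s t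
      using C that gauge_power[of 2 s t] by simp
  qed (use \<open>0 < C\<close> in simp)
qed

lemma X_Dot:
  "\<alpha> \<in> {1..n} \<Longrightarrow> \<beta> \<in> {1..n} \<Longrightarrow> S \<le> s \<Longrightarrow> s \<le> t \<Longrightarrow> t \<le> T \<Longrightarrow>
    X (Dot (Upair \<alpha> \<beta>)) s t = X (Vertex \<alpha>) s t * X (Vertex \<beta>) s t"
  using rough unfolding branched_rough_path_def by blast

lemma X_Chen:
  assumes "\<alpha> \<in> {1..n}" "\<beta> \<in> {1..n}" "S \<le> s" "s \<le> u" "u \<le> t" "t \<le> T"
  shows "X (Vertex \<alpha>) s t = X (Vertex \<alpha>) s u + X (Vertex \<alpha>) u t"
    "X (Stack \<alpha> \<beta>) s t = X (Stack \<alpha> \<beta>) s u + X (Stack \<alpha> \<beta>) u t + X (Vertex \<alpha>) s u * X (Vertex \<beta>) u t"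
  using assms rough unfolding branched_rough_path_def by blast+

text \<open>Since the gauge is monotone under inclusion, increments over all subintervals
  \<open>[a, b]\<close> are measured by the one gauge of \<open>[s, t]\<close>.\<close>

lemma X_bigo:
  assumes ev: "\<forall>\<^sub>F q in Fil. S \<le> s q \<and> s q \<le> a q \<and> a q \<le> b q \<and> b q \<le> t q \<and> t q \<le> T"
  shows "\<alpha> \<in> {1..n} \<Longrightarrow> (\<lambda>q. X (Vertex \<alpha>) (a q) (b q)) \<in> O[Fil](\<lambda>q. gauge (s q) (t q))"
    and "\<alpha> \<in> {1..n} \<Longrightarrow> \<beta> \<in> {1..n} \<Longrightarrow>
      (\<lambda>q. X (Stack \<alpha> \<beta>) (a q) (b q)) \<in> O[Fil](\<lambda>q. gauge (s q) (t q) ^ 2)"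
    and "\<alpha> \<in> {1..n} \<Longrightarrow> \<beta> \<in> {1..n} \<Longrightarrow>
      (\<lambda>q. X (Dot (Upair \<alpha> \<beta>)) (a q) (b q)) \<in> O[Fil](\<lambda>q. gauge (s q) (t q) ^ 2)"
proof -
  obtain C where C: "0 \<le> C"
    "\<And>\<alpha> s t. \<alpha> \<in> {1..n} \<Longrightarrow> S \<le> s \<Longrightarrow> s \<le> t \<Longrightarrow> t \<le> T \<Longrightarrow> \<bar>X (Vertex \<alpha>) s t\<bar> \<le> C * gauge s t"
    "\<And>\<alpha> \<beta> s t. \<alpha> \<in> {1..n} \<Longrightarrow> \<beta> \<in> {1..n} \<Longrightarrow> S \<le> s \<Longrightarrow> s \<le> t \<Longrightarrow> t \<le> T \<Longrightarrow>
      \<bar>X (Stack \<alpha> \<beta>) s t\<bar> \<le> C * gauge s t ^ 2"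
    using rough_bounds by blast
  show 1: "(\<lambda>q. X (Vertex \<alpha>) (a q) (b q)) \<in> O[Fil](\<lambda>q. gauge (s q) (t q))" if \<alpha>: "\<alpha> \<in> {1..n}" for \<alpha>
  proof (rule bigoI[of _ C], use ev in eventually_elim)
    fix q assume q: "S \<le> s q \<and> s q \<le> a q \<and> a q \<le> b q \<and> b q \<le> t q \<and> t q \<le> T"
    then have "\<bar>X (Vertex \<alpha>) (a q) (b q)\<bar> \<le> C * gauge (a q) (b q)" by (intro C(2)[OF \<alpha>]) auto
    also have "\<dots> \<le> C * gauge (s q) (t q)" using q C(1) by (intro mult_left_mono gauge_mono) auto
    finally show "norm (X (Vertex \<alpha>) (a q) (b q)) \<le> C * norm (gauge (s q) (t q))" by simp
  qed
  show "(\<lambda>q. X (Stack \<alpha> \<beta>) (a q) (b q)) \<in> O[Fil](\<lambda>q. gauge (s q) (t q) ^ 2)"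
    if \<alpha>: "\<alpha> \<in> {1..n}" "\<beta> \<in> {1..n}"
  proof (rule bigoI[of _ C], use ev in eventually_elim)
    fix q assume q: "S \<le> s q \<and> s q \<le> a q \<and> a q \<le> b q \<and> b q \<le> t q \<and> t q \<le> T"
    then have "\<bar>X (Stack \<alpha> \<beta>) (a q) (b q)\<bar> \<le> C * gauge (a q) (b q) ^ 2" by (intro C(3)[OF \<alpha>]) auto
    also have "\<dots> \<le> C * gauge (s q) (t q) ^ 2"
      using q C(1) by (intro mult_left_mono power_mono gauge_mono) auto
    finally show "norm (X (Stack \<alpha> \<beta>) (a q) (b q)) \<le> C * norm (gauge (s q) (t q) ^ 2)" by simp
  qed
  show "(\<lambda>q. X (Dot (Upair \<alpha> \<beta>)) (a q) (b q)) \<in> O[Fil](\<lambda>q. gauge (s q) (t q) ^ 2)"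
    if \<alpha>: "\<alpha> \<in> {1..n}" "\<beta> \<in> {1..n}"
  proof -
    have "(\<lambda>q. X (Vertex \<alpha>) (a q) (b q) * X (Vertex \<beta>) (a q) (b q)) \<in> O[Fil](\<lambda>q. gauge (s q) (t q) * gauge (s q) (t q))"
      using 1 \<alpha> by (intro landau_o.big.mult) auto
    moreover have "\<forall>\<^sub>F q in Fil. X (Dot (Upair \<alpha> \<beta>)) (a q) (b q) = X (Vertex \<alpha>) (a q) (b q) * X (Vertex \<beta>) (a q) (b q)"
      using ev by eventually_elim (auto intro!: X_Dot[OF \<alpha>])
    ultimately show ?thesis by (simp add: landau_o.big.in_cong power2_eq_square)
  qed
qed

lemma gauge_bounded:
  assumes ev: "\<forall>\<^sub>F q in Fil. S \<le> s q \<and> s q \<le> t q \<and> t q \<le> T"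
  shows "(\<lambda>q. gauge (s q) (t q)) \<in> O[Fil](\<lambda>_. 1)"
  by (rule bigoI[of _ "gauge S T"], use ev in eventually_elim) (auto intro: gauge_mono)

lemma bigo_gauge_weaken:
  assumes ev: "\<forall>\<^sub>F q in Fil. S \<le> s q \<and> s q \<le> t q \<and> t q \<le> T"
    and "h \<in> O[Fil](\<lambda>q. gauge (s q) (t q) ^ l)" "k \<le> l"
  shows "h \<in> O[Fil](\<lambda>q. gauge (s q) (t q) ^ k)"
proof -
  have "(\<lambda>q. gauge (s q) (t q) ^ (l - k)) \<in> O[Fil](\<lambda>_. 1 ^ (l - k))"
    by (intro landau_o.big_power gauge_bounded[OF ev])
  then have "(\<lambda>q. gauge (s q) (t q) ^ k * gauge (s q) (t q) ^ (l - k)) \<in> O[Fil](\<lambda>q. gauge (s q) (t q) ^ k * 1)"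
    by (intro landau_o.big.mult) auto
  then have "(\<lambda>q. gauge (s q) (t q) ^ l) \<in> O[Fil](\<lambda>q. gauge (s q) (t q) ^ k)"
    using assms(3) by (simp flip: power_add)
  with assms(2) show ?thesis by (rule landau_o.big_trans)
qed

text \<open>With bounded coefficients the single vertices dominate; all forests with two vertices
  are of second order.\<close>

lemma rough_increment_bigo:
  assumes ev: "\<forall>\<^sub>F q in Fil. S \<le> s q \<and> s q \<le> a q \<and> a q \<le> b q \<and> b q \<le> t q \<and> t q \<le> T"
    and F: "\<And>\<tau>. \<tau> \<in> forests n \<Longrightarrow> (\<lambda>q. F q \<tau>) \<in> O[Fil](\<lambda>_. 1)"
  shows "(\<lambda>q. rough_increment n X (F q) (a q) (b q) - (\<Sum>\<alpha>=1..n. F q (Vertex \<alpha>) * X (Vertex \<alpha>) (a q) (b q)))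
      \<in> O[Fil](\<lambda>q. gauge (s q) (t q) ^ 2)"
    and "(\<lambda>q. \<Sum>\<alpha>=1..n. F q (Vertex \<alpha>) * X (Vertex \<alpha>) (a q) (b q)) \<in> O[Fil](\<lambda>q. gauge (s q) (t q))"
    and "(\<lambda>q. rough_increment n X (F q) (a q) (b q)) \<in> O[Fil](\<lambda>q. gauge (s q) (t q))"
proof -
  have mult1: "(\<lambda>q. g q * h q) \<in> O[Fil](k)" if "g \<in> O[Fil](\<lambda>_. 1)" "h \<in> O[Fil](k)"
    for g h k :: "'a \<Rightarrow> real"
    using landau_o.big.mult[OF that] by simp
  show 1: "(\<lambda>q. rough_increment n X (F q) (a q) (b q) - (\<Sum>\<alpha>=1..n. F q (Vertex \<alpha>) * X (Vertex \<alpha>) (a q) (b q)))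
      \<in> O[Fil](\<lambda>q. gauge (s q) (t q) ^ 2)"
  proof -
    have "(\<lambda>q. 1/2 * (\<Sum>\<alpha>=1..n. \<Sum>\<beta>=1..n. F q (Dot (Upair \<alpha> \<beta>)) * X (Dot (Upair \<alpha> \<beta>)) (a q) (b q))
      + (\<Sum>\<alpha>=1..n. \<Sum>\<beta>=1..n. F q (Stack \<alpha> \<beta>) * X (Stack \<alpha> \<beta>) (a q) (b q)))
       \<in> O[Fil](\<lambda>q. gauge (s q) (t q) ^ 2)"
      by (intro sum_in_bigo(1) landau_o.big.cmult_in_iff[THEN iffD2] big_sum_in_bigo mult1 F X_bigo[OF ev] forests_memI) auto
    then show ?thesis unfolding rough_increment_eq by simp
  qed
  show 2: "(\<lambda>q. \<Sum>\<alpha>=1..n. F q (Vertex \<alpha>) * X (Vertex \<alpha>) (a q) (b q)) \<in> O[Fil](\<lambda>q. gauge (s q) (t q))"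
    by (intro big_sum_in_bigo mult1 F X_bigo[OF ev] forests_memI)
  have "\<forall>\<^sub>F q in Fil. S \<le> s q \<and> s q \<le> t q \<and> t q \<le> T" using ev by eventually_elim auto
  from bigo_gauge_weaken[OF this 1, of 1]
  have "(\<lambda>q. rough_increment n X (F q) (a q) (b q) - (\<Sum>\<alpha>=1..n. F q (Vertex \<alpha>) * X (Vertex \<alpha>) (a q) (b q)))
      \<in> O[Fil](\<lambda>q. gauge (s q) (t q))" by simp
  from sum_in_bigo(1)[OF this 2]
  show "(\<lambda>q. rough_increment n X (F q) (a q) (b q)) \<in> O[Fil](\<lambda>q. gauge (s q) (t q))" by simp
qed

end

lemma taylor_bigo:
  fixes Y Z :: "'i \<Rightarrow> nat \<Rightarrow> real" and g :: "'i \<Rightarrow> real"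
  assumes W: "openin (Euclidean_space m) W" and F: "Ck_on m k W F" and k: "0 < k"
    and K: "compact K" "K \<subseteq> W"
    and ev: "\<forall>\<^sub>F q in Fil. Y q \<in> K \<and> Z q \<in> K"
    and close: "\<And>j. j < m \<Longrightarrow> (\<lambda>q. Z q j - Y q j) \<in> O[Fil](g)"
  shows "(\<lambda>q. taylor_remainder m k F (Y q) (Z q)) \<in> O[Fil](\<lambda>q. g q ^ k)"
proof -
  obtain C where C: "\<And>y z. y \<in> K \<Longrightarrow> z \<in> K \<Longrightarrow>
      \<bar>taylor_remainder m k F y z\<bar> \<le> C * l1 m (\<lambda>j. z j - y j) ^ k"
    using taylor_compact[OF W F k K] by blast
  have "(\<lambda>q. l1 m (\<lambda>j. Z q j - Y q j)) \<in> O[Fil](g)"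
    using close by (intro big_sum_in_bigo) simp
  then have "(\<lambda>q. l1 m (\<lambda>j. Z q j - Y q j) ^ k) \<in> O[Fil](\<lambda>q. g q ^ k)"
    by (rule landau_o.big_power)
  moreover have "(\<lambda>q. taylor_remainder m k F (Y q) (Z q)) \<in> O[Fil](\<lambda>q. l1 m (\<lambda>j. Z q j - Y q j) ^ k)"
    by (rule bigoI[of _ C], use ev in eventually_elim) (use C in \<open>simp add: sum_nonneg\<close>)
  ultimately show ?thesis by (rule landau_o.big_trans[rotated])
qed

section \<open>Third-order defect of additivity of the Euler increments\<close>

context rough_driver
begin

text \<open>\<open>Z\<close> is only required to be the Euler step from \<open>Y\<close> up to
  second order. This suffices because the change of the vertex coefficients is multiplied by a
  further first-level increment.\<close>

lemma euler_defect_bigo: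
  fixes Y Z :: "'i \<Rightarrow> nat \<Rightarrow> real"
  assumes W: "openin (Euclidean_space m) W" and K: "compact K" "K \<subseteq> W"
    and F: "\<And>i \<tau>. i < m \<Longrightarrow> \<tau> \<in> forests n \<Longrightarrow> Ck_on m 2 W (F i \<tau>)"
    and adm: "\<And>y i \<alpha> \<beta>. y \<in> K \<Longrightarrow> i < m \<Longrightarrow> \<alpha> \<in> {1..n} \<Longrightarrow> \<beta> \<in> {1..n} \<Longrightarrow>
      (\<Sum>j<m. partial_deriv j (F i (Vertex \<beta>)) y * F j (Vertex \<alpha>) y)
        = F i (Dot (Upair \<alpha> \<beta>)) y + F i (Stack \<alpha> \<beta>) y"
    and ev: "\<forall>\<^sub>F q in Fil. S \<le> s q \<and> s q \<le> u q \<and> u q \<le> t q \<and> t q \<le> T \<and> Y q \<in> K \<and> Z q \<in> K"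
    and close: "\<And>j. j < m \<Longrightarrow> (\<lambda>q. Z q j - Y q j - rough_increment n X (\<lambda>\<tau>. F j \<tau> (Y q)) (s q) (u q))
       \<in> O[Fil](\<lambda>q. gauge (s q) (t q) ^ 2)"
    and i: "i < m"
  shows "(\<lambda>q. rough_increment n X (\<lambda>\<tau>. F i \<tau> (Y q)) (s q) (u q)
      + rough_increment n X (\<lambda>\<tau>. F i \<tau> (Z q)) (u q) (t q)
      - rough_increment n X (\<lambda>\<tau>. F i \<tau> (Y q)) (s q) (t q)) \<in> O[Fil](\<lambda>q. gauge (s q) (t q) ^ 3)"
proof -
  let ?g = "\<lambda>q. gauge (s q) (t q)"
  have evst: "\<forall>\<^sub>F q in Fil. S \<le> s q \<and> s q \<le> t q \<and> t q \<le> T"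
    and evsu: "\<forall>\<^sub>F q in Fil. S \<le> s q \<and> s q \<le> s q \<and> s q \<le> u q \<and> u q \<le> t q \<and> t q \<le> T"
    and evut: "\<forall>\<^sub>F q in Fil. S \<le> s q \<and> s q \<le> u q \<and> u q \<le> t q \<and> t q \<le> t q \<and> t q \<le> T"
    and evYZ: "\<forall>\<^sub>F q in Fil. Y q \<in> K \<and> Z q \<in> K" and evY: "\<forall>\<^sub>F q in Fil. Y q \<in> K"
    using ev by (eventually_elim; auto)+
  have sub: "W \<subseteq> espace m" using W openin_subset topspace_eq_espace by blast
  have F1: "Ck_on m (Suc 0) W (F j \<tau>)" if "j < m" "\<tau> \<in> forests n" for j \<tau>
    using Ck_on_le[OF _ F[OF that], of "Suc 0"] by simp
  have contK: "continuous_on K G" if "Ck_on m k W G" for k G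
    using Ck_on_continuous[OF that sub] K(2) by (rule continuous_on_subset)
  have FY: "(\<lambda>q. F j \<tau> (Y q)) \<in> O[Fil](\<lambda>_. 1)" if "j < m" "\<tau> \<in> forests n" for j \<tau>
    by (rule bounded_comp_bigo[OF K(1) contK[OF F1[OF that]] evY])
  have pFY: "(\<lambda>q. partial_deriv k (F j \<tau>) (Y q)) \<in> O[Fil](\<lambda>_. 1)"
    if "j < m" "\<tau> \<in> forests n" "k < m" for j \<tau> k
    by (rule bounded_comp_bigo[OF K(1) contK[OF Ck_on_partial[OF F1[OF that(1,2)] that(3)]] evY])
  define a where "a \<alpha> q = X (Vertex \<alpha>) (s q) (u q)" for \<alpha> q
  define b where "b \<alpha> q = X (Vertex \<alpha>) (u q) (t q)" for \<alpha> q
  \<comment> \<open>The first-level part of the Euler step; it agrees with the displacement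
    \<open>Z - Y\<close> up to second order.\<close>
  define V where "V j q = (\<Sum>\<alpha>=1..n. F j (Vertex \<alpha>) (Y q) * a \<alpha> q)" for j q
  have d2: "(\<lambda>q. Z q j - Y q j - V j q) \<in> O[Fil](\<lambda>q. ?g q ^ 2)" if j: "j < m" for j
  proof -
    let ?I = "\<lambda>q. rough_increment n X (\<lambda>\<tau>. F j \<tau> (Y q)) (s q) (u q)"
    have "(\<lambda>q. ?I q - V j q) \<in> O[Fil](\<lambda>q. ?g q ^ 2)"
      using rough_increment_bigo(1)[where F = "\<lambda>q \<tau>. F j \<tau> (Y q)", OF evsu FY[OF j]]
      by (simp add: V_def a_def)
    with close[OF j] have "(\<lambda>q. (Z q j - Y q j - ?I q) + (?I q - V j q)) \<in> O[Fil](\<lambda>q. ?g q ^ 2)"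
      by (rule sum_in_bigo(1))
    moreover have "(Z q j - Y q j - ?I q) + (?I q - V j q) = Z q j - Y q j - V j q" for q by simp
    ultimately show ?thesis by (simp only:)
  qed
  have d1: "(\<lambda>q. Z q j - Y q j) \<in> O[Fil](?g)" if j: "j < m" for j
  proof -
    have "(\<lambda>q. Z q j - Y q j - V j q) \<in> O[Fil](?g)"
      using bigo_gauge_weaken[OF evst d2[OF j], of 1] by simp
    moreover have "V j \<in> O[Fil](?g)"
      unfolding V_def a_def by (rule rough_increment_bigo(2)[where F = "\<lambda>q \<tau>. F j \<tau> (Y q)", OF evsu FY[OF j]])
    ultimately have "(\<lambda>q. Z q j - Y q j - V j q + V j q) \<in> O[Fil](?g)" by (rule sum_in_bigo(1))
    then show ?thesis by simp
  qed
  have T1: "(\<lambda>q. F i \<tau> (Z q) - F i \<tau> (Y q)) \<in> O[Fil](?g)" if "\<tau> \<in> forests n" for \<tau>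
    using taylor_bigo[OF W F1[OF i that] _ K evYZ d1] by (simp add: taylor_remainder_def)
  have T2: "(\<lambda>q. F i (Vertex \<beta>) (Z q) - F i (Vertex \<beta>) (Y q)
      - (\<Sum>\<alpha>=1..n. (F i (Dot (Upair \<alpha> \<beta>)) (Y q) + F i (Stack \<alpha> \<beta>) (Y q)) * a \<alpha> q))
      \<in> O[Fil](\<lambda>q. ?g q ^ 2)" (is "?h \<in> _") if \<beta>: "\<beta> \<in> {1..n}" for \<beta>
  proof -
    let ?F = "F i (Vertex \<beta>)"
    have \<beta>': "Vertex \<beta> \<in> forests n" using forests_memI[OF \<beta> \<beta>] by simp
    have "(\<lambda>q. ?F (Z q) - ?F (Y q) - (\<Sum>j<m. (Z q j - Y q j) * partial_deriv j ?F (Y q)))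
       \<in> O[Fil](\<lambda>q. ?g q ^ 2)"
      using taylor_bigo[OF W F[OF i \<beta>'] _ K evYZ d1]
      by (simp add: taylor_remainder_def numeral_2_eq_2 diff_diff_eq)
    \<comment> \<open>In the linear Taylor term the displacement is replaced by \<open>V\<close> at
      second-order cost. Admissibility then evaluates the derivative along \<open>V\<close> in terms
      of \<open>Dot\<close> and \<open>Stack\<close>.\<close>
    moreover have "(\<lambda>q. \<Sum>j<m. (Z q j - Y q j - V j q) * partial_deriv j ?F (Y q)) \<in> O[Fil](\<lambda>q. ?g q ^ 2 * 1)"
      using d2 pFY[OF i \<beta>'] by (intro big_sum_in_bigo landau_o.big.mult) auto
    ultimately have *: "(\<lambda>q. ?F (Z q) - ?F (Y q) - (\<Sum>j<m. (Z q j - Y q j) * partial_deriv j ?F (Y q))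
       + (\<Sum>j<m. (Z q j - Y q j - V j q) * partial_deriv j ?F (Y q))) \<in> O[Fil](\<lambda>q. ?g q ^ 2)" (is "?k \<in> _")
      by (intro sum_in_bigo(1)) simp_all
    have "\<forall>\<^sub>F q in Fil. ?k q = ?h q"
      using evY
    proof eventually_elim
      fix q assume Y: "Y q \<in> K"
      have "(\<Sum>j<m. V j q * partial_deriv j ?F (Y q)) =
        (\<Sum>j<m. \<Sum>\<alpha>=1..n. partial_deriv j ?F (Y q) * F j (Vertex \<alpha>) (Y q) * a \<alpha> q)"
        by (simp add: V_def sum_distrib_right sum_distrib_left mult_ac)
      also have "\<dots> = (\<Sum>\<alpha>=1..n. (\<Sum>j<m. partial_deriv j ?F (Y q) * F j (Vertex \<alpha>) (Y q)) * a \<alpha> q)"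
        by (subst sum.swap) (simp add: sum_distrib_right)
      also have "\<dots> = (\<Sum>\<alpha>=1..n. (F i (Dot (Upair \<alpha> \<beta>)) (Y q) + F i (Stack \<alpha> \<beta>) (Y q)) * a \<alpha> q)"
        using adm[OF Y i _ \<beta>] by simp
      finally show "?k q = ?h q" by (simp add: left_diff_distrib sum_subtractf)
    qed
    from landau_o.big.in_cong[OF this] * show ?thesis by blast
  qed
  \<comment> \<open>The three sums of the algebraic identity have orders 2 + 1, 1 + 2 and 1 + 2: a
    change of coefficients times an increment over the second subinterval.\<close>
  have "(\<lambda>q. (\<Sum>\<beta>=1..n. (F i (Vertex \<beta>) (Z q) - F i (Vertex \<beta>) (Y q)
      - (\<Sum>\<alpha>=1..n. (F i (Dot (Upair \<alpha> \<beta>)) (Y q) + F i (Stack \<alpha> \<beta>) (Y q)) * a \<alpha> q)) * b \<beta> q)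
     + 1/2 * (\<Sum>\<alpha>=1..n. \<Sum>\<beta>=1..n. (F i (Dot (Upair \<alpha> \<beta>)) (Z q) - F i (Dot (Upair \<alpha> \<beta>)) (Y q)) * (b \<alpha> q * b \<beta> q))
     + (\<Sum>\<alpha>=1..n. \<Sum>\<beta>=1..n. (F i (Stack \<alpha> \<beta>) (Z q) - F i (Stack \<alpha> \<beta>) (Y q)) * X (Stack \<alpha> \<beta>) (u q) (t q)))
     \<in> O[Fil](\<lambda>q. ?g q ^ 3)" (is "?k \<in> _")
  proof (intro sum_in_bigo(1) landau_o.big.cmult_in_iff[THEN iffD2] big_sum_in_bigo)
    have b: "b \<alpha> \<in> O[Fil](?g)" if "\<alpha> \<in> {1..n}" for \<alpha>
      using X_bigo(1)[OF evut that] by (simp add: b_def[abs_def])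
    show "(\<lambda>q. (F i (Vertex \<beta>) (Z q) - F i (Vertex \<beta>) (Y q)
      - (\<Sum>\<alpha>=1..n. (F i (Dot (Upair \<alpha> \<beta>)) (Y q) + F i (Stack \<alpha> \<beta>) (Y q)) * a \<alpha> q)) * b \<beta> q)
      \<in> O[Fil](\<lambda>q. ?g q ^ 3)" if "\<beta> \<in> {1..n}" for \<beta>
      using landau_o.big.mult[OF T2[OF that] b[OF that]] by (simp add: power3_eq_cube power2_eq_square)
    fix \<alpha> \<beta> assume ab: "\<alpha> \<in> {1..n}" "\<beta> \<in> {1..n}"
    show "(\<lambda>q. (F i (Dot (Upair \<alpha> \<beta>)) (Z q) - F i (Dot (Upair \<alpha> \<beta>)) (Y q)) * (b \<alpha> q * b \<beta> q))
      \<in> O[Fil](\<lambda>q. ?g q ^ 3)"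
      using landau_o.big.mult[OF T1[OF forests_memI(2)[OF ab]] landau_o.big.mult[OF b[OF ab(1)] b[OF ab(2)]]]
      by (simp add: power3_eq_cube mult.assoc)
    show "(\<lambda>q. (F i (Stack \<alpha> \<beta>) (Z q) - F i (Stack \<alpha> \<beta>) (Y q)) * X (Stack \<alpha> \<beta>) (u q) (t q))
      \<in> O[Fil](\<lambda>q. ?g q ^ 3)"
      using landau_o.big.mult[OF T1[OF forests_memI(3)[OF ab]] X_bigo(2)[OF evut ab]]
      by (simp add: power3_eq_cube power2_eq_square mult.assoc)
  qed simp
  moreover have "\<forall>\<^sub>F q in Fil. ?k q = rough_increment n X (\<lambda>\<tau>. F i \<tau> (Y q)) (s q) (u q)
      + rough_increment n X (\<lambda>\<tau>. F i \<tau> (Z q)) (u q) (t q)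
      - rough_increment n X (\<lambda>\<tau>. F i \<tau> (Y q)) (s q) (t q)"
    using ev
  proof eventually_elim
    fix q assume "S \<le> s q \<and> s q \<le> u q \<and> u q \<le> t q \<and> t q \<le> T \<and> Y q \<in> K \<and> Z q \<in> K"
    then have q: "S \<le> s q" "s q \<le> u q" "u q \<le> t q" "t q \<le> T" by auto
    have st: "s q \<le> t q" "S \<le> u q" "u q \<le> T" using q by auto
    have sym: "F i (Dot (Upair \<alpha> \<beta>)) (Y q) = F i (Dot (Upair \<beta> \<alpha>)) (Y q)" for \<alpha> \<beta>
    proof -
      have "Upair \<alpha> \<beta> = Upair \<beta> \<alpha>" by auto
      then show ?thesis by (rule arg_cong)
    qed
    show "?k q = rough_increment n X (\<lambda>\<tau>. F i \<tau> (Y q)) (s q) (u q)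
      + rough_increment n X (\<lambda>\<tau>. F i \<tau> (Z q)) (u q) (t q)
      - rough_increment n X (\<lambda>\<tau>. F i \<tau> (Y q)) (s q) (t q)"
      unfolding rough_increment_eq
      using euler_defect_identity[of "\<lambda>\<alpha> \<beta>. F i (Dot (Upair \<alpha> \<beta>)) (Y q)", OF sym,
        of "\<lambda>\<alpha>. F i (Vertex \<alpha>) (Y q)" "\<lambda>\<alpha>. a \<alpha> q" "{1..n}"
        "\<lambda>\<alpha> \<beta>. F i (Stack \<alpha> \<beta>) (Y q)" "\<lambda>\<alpha> \<beta>. X (Stack \<alpha> \<beta>) (s q) (u q)"
        "\<lambda>\<alpha>. F i (Vertex \<alpha>) (Z q)" "\<lambda>\<alpha>. b \<alpha> q" "\<lambda>\<alpha> \<beta>. F i (Dot (Upair \<alpha> \<beta>)) (Z q)"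
        "\<lambda>\<alpha> \<beta>. F i (Stack \<alpha> \<beta>) (Z q)" "\<lambda>\<alpha> \<beta>. X (Stack \<alpha> \<beta>) (u q) (t q)"]
      by (simp add: X_Dot q st X_Chen(1)[OF _ _ q] X_Chen(2)[OF _ _ q] a_def b_def)
  qed
  ultimately show ?thesis by (simp add: landau_o.big.in_cong)
qed

end

section \<open>Convergence of the Euler scheme\<close>

text \<open>Davie's argument: splitting \<open>[i, j]\<close> at the last \<open>k\<close> with \<open>w i k \<le> w i j / 2\<close> and at
  \<open>Suc k\<close> leaves two pieces of size at most \<open>w i j / 2\<close>, so superlinearity of \<open>x powr \<theta>\<close>
  reproduces the bound.\<close>

lemma discrete_sewing:
  fixes w R :: "nat \<Rightarrow> nat \<Rightarrow> real" and \<theta> c \<kappa> :: real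
  assumes \<theta>: "1 < \<theta>" and c: "0 \<le> c" and \<kappa>: "0 \<le> \<kappa>" "2 * c \<le> \<kappa> * (1 - 2 powr (1 - \<theta>))"
    and w_add: "\<And>i k j. i \<le> k \<Longrightarrow> k \<le> j \<Longrightarrow> j \<le> N \<Longrightarrow> w i k + w k j \<le> w i j"
    and w_nonneg: "\<And>i j. i \<le> j \<Longrightarrow> j \<le> N \<Longrightarrow> 0 \<le> w i j"
    and w_refl: "\<And>i. i \<le> N \<Longrightarrow> w i i = 0"
    and R_refl: "\<And>i. i \<le> N \<Longrightarrow> R i i \<le> 0"
    and R_Suc: "\<And>i. Suc i \<le> N \<Longrightarrow> R i (Suc i) \<le> 0"
    and good: "\<And>j. j \<le> N \<Longrightarrow> R 0 j \<le> \<kappa> * w 0 j powr \<theta> \<Longrightarrow> good j"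
    and step: "\<And>i k j. i \<le> k \<Longrightarrow> k < j \<Longrightarrow> j \<le> N \<Longrightarrow> good i \<Longrightarrow> good k \<Longrightarrow>
      R i k \<le> \<kappa> * w i k powr \<theta> \<Longrightarrow> R i j \<le> R i k + R k j + c * w i j powr \<theta>"
    and j: "j \<le> N"
  shows "good j \<and> (\<forall>i\<le>j. R i j \<le> \<kappa> * w i j powr \<theta>)"
  using j
proof (induction j rule: less_induct)
  case (less j)
  \<comment> \<open>Two nested inductions: the outer one, on \<open>j\<close>, supplies
    \<open>good\<close> and the bound for \<open>R i k\<close>; the inner one, on
    \<open>j - i\<close>, supplies the bound for \<open>R (Suc k) j\<close>.\<close>
  have "R i j \<le> \<kappa> * w i j powr \<theta>" if "i \<le> j" for i
    using that
  proof (induction "j - i" arbitrary: i rule: less_induct)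
    case inner: less
    show ?case
    proof (cases "i = j")
      case True
      then show ?thesis using R_refl[of i] less.prems \<kappa>(1) w_refl by simp
    next
      case False
      then have ij: "i < j" using inner.prems by simp
      define a where "a = w i j"
      have a: "0 \<le> a" unfolding a_def using w_nonneg ij less.prems by simp
      define k where "k = Max {k. i \<le> k \<and> k < j \<and> w i k \<le> a / 2}"
      have fin: "finite {k. i \<le> k \<and> k < j \<and> w i k \<le> a / 2}" by (rule finite_subset[of _ "{..<j}"]) auto
      moreover have "i \<in> {k. i \<le> k \<and> k < j \<and> w i k \<le> a / 2}" using ij a w_refl less.prems by simp
      ultimately have k: "i \<le> k" "k < j" "w i k \<le> a / 2"
        using Max_in[OF fin] unfolding k_def by blast+
      have maximal: "k' \<le> k" if "i \<le> k'" "k' < j" "w i k' \<le> a / 2" for k'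
        unfolding k_def using fin that by (intro Max_ge) auto
      have half: "\<kappa> * v powr \<theta> \<le> \<kappa> * (a / 2) powr \<theta>" if "0 \<le> v" "v \<le> a / 2" for v
        using that \<theta> \<kappa>(1) by (intro mult_left_mono powr_mono2) auto
      have gi: "good i" and gk: "good k" and Rik: "R i k \<le> \<kappa> * w i k powr \<theta>"
        using less.IH[OF ij] less.IH[OF k(2)] ij k less.prems by auto
      have Rik': "R i k \<le> \<kappa> * (a / 2) powr \<theta>"
        using Rik half[of "w i k"] k w_nonneg[of i k] less.prems by linarith
      have Rkj: "R k j \<le> \<kappa> * (a / 2) powr \<theta> + c * a powr \<theta>"
      proof (cases "Suc k = j")
        case True
        then have "R k j \<le> 0" using R_Suc[of k] less.prems by simp
        moreover have "0 \<le> \<kappa> * (a / 2) powr \<theta> + c * a powr \<theta>" using \<kappa>(1) c by simp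
        ultimately show ?thesis by linarith
      next
        case False
        then have kj: "Suc k < j" using k by simp
        have "a / 2 < w i (Suc k)" using maximal[of "Suc k"] kj k by force
        then have "w (Suc k) j \<le> a / 2"
          using w_add[of i "Suc k" j] kj k less.prems unfolding a_def by simp
        then have "R (Suc k) j \<le> \<kappa> * (a / 2) powr \<theta>"
          using inner.hyps[of "Suc k"] half[of "w (Suc k) j"] w_nonneg[of "Suc k" j] kj k less.prems by linarith
        moreover have "R k (Suc k) \<le> 0" using R_Suc kj less.prems by simp
        moreover have "R k (Suc k) \<le> \<kappa> * w k (Suc k) powr \<theta>"
          using \<open>R k (Suc k) \<le> 0\<close> mult_nonneg_nonneg[OF \<kappa>(1) powr_ge_zero] by (rule order_trans)
        then have "R k j \<le> R k (Suc k) + R (Suc k) j + c * w k j powr \<theta>"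
          using less.IH[OF kj] kj k less.prems gk by (intro step) auto
        moreover have "w k j \<le> a"
          using w_add[of i k j] w_nonneg[of i k] k less.prems unfolding a_def by simp
        then have "c * w k j powr \<theta> \<le> c * a powr \<theta>"
          using c \<theta> w_nonneg[of k j] k less.prems by (intro mult_left_mono powr_mono2) auto
        ultimately show ?thesis by linarith
      qed
      have "R i j \<le> R i k + R k j + c * a powr \<theta>"
        unfolding a_def using k gi gk Rik less.prems by (intro step) auto
      also have "\<dots> \<le> 2 * (\<kappa> * (a / 2) powr \<theta>) + 2 * c * a powr \<theta>" using Rik' Rkj by linarith
      \<comment> \<open>Two half-size pieces cost the factor
        \<open>2 powr (1 - \<theta>) < 1\<close>, and two splittings cost \<open>2 * c\<close>. The
        hypothesis relating \<kappa> and \<open>c\<close> says that the sum is at most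
        \<kappa>.\<close>
      also have "2 * (\<kappa> * (a / 2) powr \<theta>) = \<kappa> * 2 powr (1 - \<theta>) * a powr \<theta>"
        using a by (simp add: powr_divide powr_diff)
      also have "\<kappa> * 2 powr (1 - \<theta>) * a powr \<theta> + 2 * c * a powr \<theta>
        \<le> \<kappa> * 2 powr (1 - \<theta>) * a powr \<theta> + \<kappa> * (1 - 2 powr (1 - \<theta>)) * a powr \<theta>"
        using \<kappa>(2) by (intro add_left_mono mult_right_mono) auto
      also have "\<dots> = \<kappa> * a powr \<theta>" by (simp add: algebra_simps)
      finally show ?thesis by (simp add: a_def)
    qed
  qed
  then show ?case using good[of j] less.prems by blast
qed

section \<open>Tychonoff's theorem for functions and closed cubes\<close>

lemma compact_Pi_UNIV:
  fixes B :: "'i \<Rightarrow> 'b::topological_space set"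
  assumes "\<And>i. compact (B i)"
  shows "compact (Pi UNIV B)"
proof -
  have "compactin (product_topology (\<lambda>_::'i. euclidean) UNIV) (PiE UNIV B)"
    using assms by (simp add: compactin_PiE)
  then show ?thesis by (simp add: euclidean_product_topology PiE_UNIV_domain)
qed

lemma compact_closed_cube: "compact {v \<in> espace m. \<forall>i<m. \<bar>v i - u i\<bar> \<le> d}"
proof -
  have "v \<in> (if i < m then {u i - d..u i + d} else {0}) \<longleftrightarrow>
      (i < m \<longrightarrow> \<bar>v - u i\<bar> \<le> d) \<and> (m \<le> i \<longrightarrow> v = 0)" for v i by auto
  then have "{v \<in> espace m. \<forall>i<m. \<bar>v i - u i\<bar> \<le> d} = Pi UNIV (\<lambda>i. if i < m then {u i - d..u i + d} else {0})"
    unfolding Pi_iff espace_iff by blast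
  then show ?thesis by (simp add: compact_Pi_UNIV)
qed

section \<open>The Euler scheme inside one coordinate cube\<close>

context rough_driver
begin

lemma X_refl:
  assumes "S \<le> s" "s \<le> T" "\<alpha> \<in> {1..n}" "\<beta> \<in> {1..n}"
  shows "X (Vertex \<alpha>) s s = 0" "X (Stack \<alpha> \<beta>) s s = 0" "X (Dot (Upair \<alpha> \<beta>)) s s = 0"
  using X_Chen[OF assms(3,4,1) order_refl order_refl assms(2)] X_Dot[OF assms(3,4,1) order_refl assms(2)]
  by auto

lemma rough_increment_refl: "S \<le> s \<Longrightarrow> s \<le> T \<Longrightarrow> rough_increment n X F s s = 0"
  unfolding rough_increment_eq by (simp add: X_refl)

end

text \<open>\<open>B\<close> and \<open>c\<close> are the first-order and defect constants on
  \<open>K\<close>. The first condition in \<open>small\<close> makes the error satisfy the premise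
  of \<open>defect\<close>; the second confines the scheme to the cube of radius \<open>d\<close>.
  Both are imposed up to time \<open>b\<close> only.\<close>

locale euler_scheme = rough_driver +
  fixes m :: nat and F :: "nat \<Rightarrow> forest \<Rightarrow> (nat \<Rightarrow> real) \<Rightarrow> real" and y0 :: "nat \<Rightarrow> real"
    and b d B c \<kappa> :: real and K :: "(nat \<Rightarrow> real) set"
  assumes b: "S \<le> b" "b \<le> T"
    and K_def: "K = {v \<in> espace m. \<forall>i<m. \<bar>v i - y0 i\<bar> \<le> d}"
    and y0: "y0 \<in> espace m"
    and cont: "\<And>i \<tau>. i < m \<Longrightarrow> \<tau> \<in> forests n \<Longrightarrow> continuous_on K (F i \<tau>)"
    and increment: "\<And>y s t. y \<in> K \<Longrightarrow> S \<le> s \<Longrightarrow> s \<le> t \<Longrightarrow> t \<le> T \<Longrightarrow>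
      l1 m (\<lambda>i. rough_increment n X (\<lambda>\<tau>. F i \<tau> y) s t) \<le> B * gauge s t"
    and defect: "\<And>y z s u t. y \<in> K \<Longrightarrow> z \<in> K \<Longrightarrow> S \<le> s \<Longrightarrow> s \<le> u \<Longrightarrow> u \<le> t \<Longrightarrow> t \<le> T \<Longrightarrow>
      (\<And>j. j < m \<Longrightarrow> \<bar>z j - y j - rough_increment n X (\<lambda>\<tau>. F j \<tau> y) s u\<bar> \<le> gauge s t ^ 2) \<Longrightarrow>
      l1 m (\<lambda>i. rough_increment n X (\<lambda>\<tau>. F i \<tau> y) s u + rough_increment n X (\<lambda>\<tau>. F i \<tau> z) u t
        - rough_increment n X (\<lambda>\<tau>. F i \<tau> y) s t) \<le> c * gauge s t ^ 3"
    and small: "\<And>s t. S \<le> s \<Longrightarrow> s \<le> t \<Longrightarrow> t \<le> b \<Longrightarrow> \<kappa> * gauge s t \<le> 1"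
      "\<And>s t. S \<le> s \<Longrightarrow> s \<le> t \<Longrightarrow> t \<le> b \<Longrightarrow> B * gauge s t + \<kappa> * gauge s t ^ 3 \<le> d"
    and c: "0 \<le> c" and \<kappa>: "0 \<le> \<kappa>" "2 * c \<le> \<kappa> * (1 - 2 powr (1 - 3 / p))"
begin

abbreviation incr :: "(nat \<Rightarrow> real) \<Rightarrow> real \<Rightarrow> real \<Rightarrow> nat \<Rightarrow> real" where
  "incr y s t i \<equiv> rough_increment n X (\<lambda>\<tau>. F i \<tau> y) s t"

text \<open>On the degenerate interval \<open>[S, S]\<close> the gauge is 0 and the second smallness
  condition reads \<open>0 \<le> d\<close>.\<close>

lemma d_nonneg: "0 \<le> d"
  using small(2)[of S S] b control_refl[of S] p1 by (simp add: gauge_def)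

lemma y0_in_K: "y0 \<in> K"
  using y0 d_nonneg by (simp add: K_def)

lemma compact_K: "compact K"
  unfolding K_def by (rule compact_closed_cube)

text \<open>Components from \<open>m\<close> on are set to 0 to remain in \<open>espace m\<close>.
  Adjacent steps are exact, so the remainder \<open>R i (Suc i)\<close> vanishes.\<close>

primrec euler :: "(nat \<Rightarrow> real) \<Rightarrow> nat \<Rightarrow> nat \<Rightarrow> real" where
  "euler t 0 = y0"
| "euler t (Suc k) = (\<lambda>i. if i < m then euler t k i + incr (euler t k) (t k) (t (Suc k)) i else 0)"

text \<open>Sewing with exponent \<open>3 / p\<close>, the control at the partition points, and
  membership in \<open>K\<close> as \<open>good\<close>. The constants do not depend on the
  partition.\<close>

lemma euler_estimate:
  assumes t0: "t 0 = S" and mono: "\<And>i j. i \<le> j \<Longrightarrow> j \<le> N \<Longrightarrow> t i \<le> t j" and tN: "t N \<le> b"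
    and j: "j \<le> N"
  shows "euler t j \<in> K \<and> (\<forall>i\<le>j. l1 m (\<lambda>l. euler t j l - euler t i l - incr (euler t i) (t i) (t j) l)
     \<le> \<kappa> * \<omega> (t i) (t j) powr (3 / p))"
proof -
  let ?Y = "euler t" and ?w = "\<lambda>i j. \<omega> (t i) (t j)"
  let ?R = "\<lambda>i j. l1 m (\<lambda>l. ?Y j l - ?Y i l - incr (?Y i) (t i) (t j) l)"
  have esp: "?Y k \<in> espace m" for k
    using y0 by (cases k) (auto simp: espace_iff)
  have tS: "S \<le> t i" and tb: "t i \<le> b" and tT: "t i \<le> T" if "i \<le> N" for i
    using mono[of 0 i] mono[of i N] that t0 tN b by auto
  have g3: "?w i j powr (3 / p) = gauge (t i) (t j) ^ 3" for i j
    using gauge_power[of 3] by simp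
  show ?thesis
  proof (rule discrete_sewing[where R = ?R and w = ?w and c = c and N = N])
    show "1 < 3 / p" using p1 p3 by simp
    show "?w i k + ?w k j \<le> ?w i j" if "i \<le> k" "k \<le> j" "j \<le> N" for i k j
      using that by (intro control_superadditive tS tT mono) auto
    show "0 \<le> ?w i j" if "i \<le> j" "j \<le> N" for i j
      using that by (intro control_nonneg tS tT mono) auto
    show "?w i i = 0" if "i \<le> N" for i using that by (intro control_refl tS tT)
    show "?R i i \<le> 0" if "i \<le> N" for i
      using rough_increment_refl[OF tS[OF that] tT[OF that]] by simp
    show "?R i (Suc i) \<le> 0" for i by simp
    show "?Y j \<in> K" if j: "j \<le> N" and R: "?R 0 j \<le> \<kappa> * ?w 0 j powr (3 / p)" for j
    proof -
      have S: "S \<le> t 0" "t 0 \<le> t j" "t j \<le> T" "t j \<le> b" using mono[of 0 j] tT tb j t0 by auto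
      have "\<bar>?Y j l - y0 l\<bar> \<le> d" if l: "l < m" for l
      proof -
        \<comment> \<open>The displacement from \<open>y0\<close> is one Euler increment over the
          whole of \<open>[t 0, t j]\<close> plus the error already bounded, so it does not grow
          with the number of steps.\<close>
        let ?r = "?Y j l - y0 l - incr y0 (t 0) (t j) l"
        have "\<bar>?r\<bar> \<le> ?R 0 j" using l by (simp, intro member_le_sum) auto
        moreover have "\<bar>incr y0 (t 0) (t j) l\<bar> \<le> l1 m (incr y0 (t 0) (t j))"
          using l by (intro member_le_sum) auto
        moreover have "l1 m (incr y0 (t 0) (t j)) \<le> B * gauge (t 0) (t j)"
          by (rule increment[OF y0_in_K S(1-3)])
        moreover have "B * gauge (t 0) (t j) + \<kappa> * gauge (t 0) (t j) ^ 3 \<le> d"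
          by (rule small(2)[OF S(1,2,4)])
        ultimately show ?thesis using R unfolding g3 by linarith
      qed
      then show ?thesis using esp by (simp add: K_def)
    qed
    show "?R i j \<le> ?R i k + ?R k j + c * ?w i j powr (3 / p)"
      if ik: "i \<le> k" and kj: "k < j" and j: "j \<le> N" and good: "?Y i \<in> K" "?Y k \<in> K"
        and R: "?R i k \<le> \<kappa> * ?w i k powr (3 / p)" for i k j
    proof -
      have st: "S \<le> t i" "t i \<le> t k" "t k \<le> t j" "t j \<le> T" "t k \<le> b"
        using tS mono tT tb ik kj j by auto
      \<comment> \<open>One factor of the third-order error is spent against \<kappa>, leaving
        second order with constant 1.\<close>
      have "\<bar>?Y k l - ?Y i l - incr (?Y i) (t i) (t k) l\<bar> \<le> gauge (t i) (t j) ^ 2" if l: "l < m" for l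
      proof -
        have "\<bar>?Y k l - ?Y i l - incr (?Y i) (t i) (t k) l\<bar> \<le> ?R i k"
          using l by (intro member_le_sum) auto
        also have "\<dots> \<le> (\<kappa> * gauge (t i) (t k)) * gauge (t i) (t k) ^ 2"
          using R unfolding g3 by (simp add: power3_eq_cube power2_eq_square mult.assoc)
        also have "\<dots> \<le> 1 * gauge (t i) (t k) ^ 2"
          using small(1)[OF st(1,2,5)] by (intro mult_right_mono) auto
        also have "\<dots> \<le> gauge (t i) (t j) ^ 2"
          using st by (simp, intro power_mono gauge_mono) auto
        finally show ?thesis .
      qed
      from defect[OF good st(1-4) this]
      have def: "l1 m (\<lambda>l. incr (?Y i) (t i) (t k) l + incr (?Y k) (t k) (t j) l - incr (?Y i) (t i) (t j) l)
        \<le> c * ?w i j powr (3 / p)" unfolding g3 by simp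
      have "?R i j \<le> (\<Sum>l<m. \<bar>?Y k l - ?Y i l - incr (?Y i) (t i) (t k) l\<bar>
         + \<bar>?Y j l - ?Y k l - incr (?Y k) (t k) (t j) l\<bar>
         + \<bar>incr (?Y i) (t i) (t k) l + incr (?Y k) (t k) (t j) l - incr (?Y i) (t i) (t j) l\<bar>)"
        by (rule sum_mono) linarith
      also have "\<dots> = ?R i k + ?R k j + l1 m (\<lambda>l. incr (?Y i) (t i) (t k) l + incr (?Y k) (t k) (t j) l - incr (?Y i) (t i) (t j) l)"
        by (simp add: sum.distrib)
      finally show ?thesis using def by linarith
    qed
  qed (use c \<kappa> j in auto)
qed

lemma euler_on_finite_set:
  assumes D: "finite D" "D \<subseteq> {S..b}"
  shows "\<exists>Z. Z S = y0 \<and> (\<forall>t. Z t \<in> K) \<and> (\<forall>s\<in>D. \<forall>t\<in>D. s \<le> t \<longrightarrow>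
    l1 m (\<lambda>l. Z t l - Z s l - incr (Z s) s t l) \<le> \<kappa> * \<omega> s t powr (3 / p))"
proof -
  \<comment> \<open>Adding \<open>S\<close> lets the scheme start there from \<open>y0\<close>,
    whether or not \<open>S\<close> belongs to \<open>D\<close>.\<close>
  let ?D = "insert S D"
  obtain xs where xs: "sorted xs" "distinct xs" "set xs = ?D"
    using finite_sorted_distinct_unique[of ?D] D(1) by auto
  define N where "N = length xs - 1"
  have N: "length xs = Suc N" using xs(3) by (cases xs) (auto simp: N_def)
  define t where "t = (\<lambda>i. xs ! i)"
  have mono: "t i \<le> t j" if "i \<le> j" "j \<le> N" for i j
    using sorted_nth_mono[OF xs(1)] that N by (simp add: t_def)
  have memt: "t i \<in> ?D" if "i \<le> N" for i using that N xs(3) by (metis nth_mem less_Suc_eq_le t_def)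
  have "S \<in> set xs" using xs(3) by simp
  then obtain k where "k \<le> N" "t k = S" using N by (metis in_set_conv_nth less_Suc_eq_le t_def)
  then have t0: "t 0 = S" using mono[of 0 k] memt[of 0] D b by auto
  have tN: "t N \<le> b" using memt[of N] D b by auto
  have "\<forall>s\<in>?D. \<exists>i\<le>N. t i = s"
    using N xs(3) by (metis in_set_conv_nth less_Suc_eq_le t_def)
  then obtain idx where idx: "\<And>s. s \<in> ?D \<Longrightarrow> idx s \<le> N" "\<And>s. s \<in> ?D \<Longrightarrow> t (idx s) = s" by metis
  have inj: "i = j" if "i \<le> N" "j \<le> N" "t i = t j" for i j
    using that N nth_eq_iff_index_eq[OF xs(2)] by (simp add: t_def)
  have idx_mono: "idx s \<le> idx u" if "s \<in> ?D" "u \<in> ?D" "s \<le> u" for s u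
  proof (rule ccontr)
    assume "\<not> ?thesis"
    then have "t (idx u) \<le> t (idx s)" using mono idx(1) that by simp
    then have "s = u" using idx(2) that by simp
    with \<open>\<not> ?thesis\<close> show False by simp
  qed
  note est = euler_estimate[of t N, OF t0 mono tN]
  \<comment> \<open>Away from the partition \<open>y0\<close> is a filler value: it keeps
    \<open>Z\<close> in \<open>K\<close> at every real time, as the compact product demands.\<close>
  define Z where "Z s = (if s \<in> ?D then euler t (idx s) else y0)" for s
  have "idx S = 0" using idx[of S] inj[of "idx S" 0] t0 by simp
  then have "Z S = y0" by (simp add: Z_def)
  moreover have "Z s \<in> K" for s using est idx y0_in_K by (simp add: Z_def)
  moreover have "l1 m (\<lambda>l. Z u l - Z s l - incr (Z s) s u l) \<le> \<kappa> * \<omega> s u powr (3 / p)"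
    if "s \<in> D" "u \<in> D" "s \<le> u" for s u
    using est[of "idx u"] idx(1)[of u] idx_mono[of s u] idx(2)[of s] idx(2)[of u] that
    unfolding Z_def by auto
  ultimately show ?thesis by blast
qed

lemma euler_limit:
  "\<exists>Z. Z S = y0 \<and> (\<forall>t. Z t \<in> K) \<and> (\<forall>s t. S \<le> s \<longrightarrow> s \<le> t \<longrightarrow> t \<le> b \<longrightarrow>
    l1 m (\<lambda>l. Z t l - Z s l - incr (Z s) s t l) \<le> \<kappa> * \<omega> s t powr (3 / p))"
proof -
  \<comment> \<open>Paths indexed by all reals with the topology of pointwise convergence; the
    initial condition is built into the factor at \<open>S\<close>.\<close>
  define P where "P = Pi UNIV (\<lambda>t. if t = S then {y0} else K)"
  define C where "C st = {Z \<in> P. l1 m (\<lambda>l. Z (snd st) l - Z (fst st) l - incr (Z (fst st)) (fst st) (snd st) l)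
       \<le> \<kappa> * \<omega> (fst st) (snd st) powr (3 / p)}" for st
  define I where "I = {(s, t). S \<le> s \<and> s \<le> t \<and> t \<le> b}"
  have PK: "Z t \<in> K" if "Z \<in> P" for Z t
    using that y0_in_K by (auto simp: P_def Pi_iff split: if_splits)
  have cP: "compact P" unfolding P_def using compact_K by (intro compact_Pi_UNIV) auto
  have "closed (if t = S then {y0} else K)" for t using compact_imp_closed[OF compact_K] by simp
  then have "closed (\<Inter>t. (\<lambda>Z. Z t) -` (if t = S then {y0} else K))"
    by (intro closed_INT ballI closed_vimage) auto
  moreover have "P = (\<Inter>t. (\<lambda>Z. Z t) -` (if t = S then {y0} else K))"
    unfolding P_def by (auto simp: Pi_iff)
  ultimately have clP: "closed P" by simp
  have closed: "closed (C st)" for st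
  proof -
    obtain s t where st: "st = (s, t)" by (cases st)
    have ev: "continuous_on P (\<lambda>Z. Z u)" for u :: real
      by (rule continuous_on_subset[OF continuous_on_product_coordinates]) simp
    have ev2: "continuous_on P (\<lambda>Z. Z u l)" for u :: real and l :: nat
      using continuous_on_compose2[OF continuous_on_product_coordinates ev] by blast
    \<comment> \<open>The coefficients are continuous on \<open>K\<close> only, which suffices
      because evaluation at any time maps \<open>P\<close> into \<open>K\<close>.\<close>
    have "continuous_on P (\<lambda>Z. incr (Z s) s t l)" if "l < m" for l
      unfolding rough_increment_def
      using PK by (intro continuous_intros continuous_on_compose2[OF cont[OF that] ev]) auto
    then have "continuous_on P (\<lambda>Z. l1 m (\<lambda>l. Z t l - Z s l - incr (Z s) s t l))"
      by (intro continuous_intros ev2) auto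
    then have "closed (P \<inter> (\<lambda>Z. l1 m (\<lambda>l. Z t l - Z s l - incr (Z s) s t l)) -` {..\<kappa> * \<omega> s t powr (3 / p)})"
      using clP by (rule continuous_closed_preimage) simp
    moreover have "P \<inter> (\<lambda>Z. l1 m (\<lambda>l. Z t l - Z s l - incr (Z s) s t l)) -` {..\<kappa> * \<omega> s t powr (3 / p)} = C st"
      by (auto simp: C_def st)
    ultimately show ?thesis by simp
  qed
  have "P \<inter> (\<Inter>st\<in>I. C st) \<noteq> {}"
  proof (rule compact_imp_fip_image[OF cP closed])
    fix J assume J: "finite J" "J \<subseteq> I"
    define D where "D = fst ` J \<union> snd ` J"
    have "finite D" using J by (simp add: D_def)
    moreover have "D \<subseteq> {S..b}" using J(2) by (force simp: D_def I_def)
    ultimately obtain Z where Z: "Z S = y0" "\<And>t. Z t \<in> K"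
      "\<And>s t. s \<in> D \<Longrightarrow> t \<in> D \<Longrightarrow> s \<le> t \<Longrightarrow>
        l1 m (\<lambda>l. Z t l - Z s l - incr (Z s) s t l) \<le> \<kappa> * \<omega> s t powr (3 / p)"
      using euler_on_finite_set by meson
    have ZP: "Z \<in> P" using Z(1,2) by (auto simp: P_def)
    have "Z \<in> C st" if "st \<in> J" for st
    proof -
      have "fst st \<in> D" "snd st \<in> D" using that unfolding D_def by auto
      moreover have "fst st \<le> snd st" using that J unfolding I_def by auto
      ultimately show ?thesis using Z(3) ZP by (simp add: C_def)
    qed
    then show "P \<inter> (\<Inter>st\<in>J. C st) \<noteq> {}" using ZP by blast
  qed
  then obtain Z where Z: "Z \<in> P" "\<And>st. st \<in> I \<Longrightarrow> Z \<in> C st" by blast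
  have "Z S = y0" using Z(1) by (auto simp: P_def Pi_iff split: if_splits)
  moreover have "l1 m (\<lambda>l. Z t l - Z s l - incr (Z s) s t l) \<le> \<kappa> * \<omega> s t powr (3 / p)"
    if "S \<le> s" "s \<le> t" "t \<le> b" for s t
    using Z(2)[of "(s, t)"] that by (simp add: C_def I_def)
  ultimately show ?thesis using PK[OF Z(1)] by blast
qed

end

section \<open>Short intervals and uniform constants\<close>

context rough_driver
begin

lemma gauge_continuous:
  assumes a: "S \<le> a" "a \<le> T" and \<delta>: "0 < \<delta>"
  shows "\<exists>\<epsilon>>0. \<forall>s t. S \<le> s \<longrightarrow> s \<le> t \<longrightarrow> t \<le> T \<longrightarrow> \<bar>s - a\<bar> < \<epsilon> \<longrightarrow> \<bar>t - a\<bar> < \<epsilon> \<longrightarrow> gauge s t < \<delta>"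
proof -
  let ?\<Delta> = "{(s, t). S \<le> s \<and> s \<le> t \<and> t \<le> T}"
  define f where "f = (\<lambda>(s, t). \<omega> s t)"
  \<comment> \<open>The control is continuous and vanishes at \<open>(a, a)\<close>. The tolerance
    \<open>\<delta> powr p\<close> becomes \<delta> after taking the power
    \<open>1 / p\<close>.\<close>
  have "continuous_on ?\<Delta> f" using control by (simp add: control_def f_def)
  moreover have "(a, a) \<in> ?\<Delta>" "0 < \<delta> powr p" using a \<delta> by auto
  ultimately obtain e where e: "e > 0" "\<forall>q\<in>?\<Delta>. dist q (a, a) < e \<longrightarrow> dist (f q) (f (a, a)) < \<delta> powr p"
    unfolding continuous_on_iff by blast
  have "gauge s t < \<delta>" if st: "S \<le> s" "s \<le> t" "t \<le> T" "\<bar>s - a\<bar> < e / 2" "\<bar>t - a\<bar> < e / 2" for s t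
  proof -
    have "dist (s, t) (a, a) \<le> \<bar>s - a\<bar> + \<bar>t - a\<bar>"
      unfolding dist_Pair_Pair dist_real_def using sqrt_sum_squares_le_sum_abs[of "\<bar>s - a\<bar>" "\<bar>t - a\<bar>"] by simp
    then have "dist (s, t) (a, a) < e" using st by linarith
    moreover have "(s, t) \<in> ?\<Delta>" using st by simp
    ultimately have "dist (f (s, t)) (f (a, a)) < \<delta> powr p" using e(2) by blast
    then have "\<bar>\<omega> s t - \<omega> a a\<bar> < \<delta> powr p" by (simp add: f_def dist_real_def)
    then have "\<omega> s t < \<delta> powr p" using control_refl[OF a] by simp
    then have "gauge s t < (\<delta> powr p) powr (1 / p)"
      unfolding gauge_def using control_nonneg[of s t] st p1 by (intro powr_less_mono2) auto
    also have "\<dots> = \<delta>" using \<delta> p1 by (simp add: powr_powr)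
    finally show ?thesis .
  qed
  then show ?thesis using e(1) by (intro exI[of _ "e / 2"]) auto
qed

text \<open>Serves both for the confinement to \<open>K\<close> and for the modulus of continuity of
  the solution. For \<open>g \<le> 1\<close> the cubic term is dominated by the linear one; the
  summands 1 in the denominators prevent division by 0.\<close>

lemma small_gauge_exists:
  fixes B \<kappa> d :: real
  assumes "0 \<le> B" "0 \<le> \<kappa>" "0 < d"
  shows "\<exists>\<delta>>0. \<forall>g. 0 \<le> g \<longrightarrow> g \<le> \<delta> \<longrightarrow> \<kappa> * g \<le> 1 \<and> B * g + \<kappa> * g ^ 3 \<le> d"
proof -
  define \<delta> where "\<delta> = min 1 (min (1 / (\<kappa> + 1)) (d / (B + \<kappa> + 1)))"
  have \<delta>: "0 < \<delta>" "\<delta> \<le> 1" "\<delta> \<le> 1 / (\<kappa> + 1)" "\<delta> \<le> d / (B + \<kappa> + 1)"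
    unfolding \<delta>_def using assms by auto
  have "\<kappa> * g \<le> 1 \<and> B * g + \<kappa> * g ^ 3 \<le> d" if g: "0 \<le> g" "g \<le> \<delta>" for g
  proof
    have "\<kappa> * g \<le> (\<kappa> + 1) * (1 / (\<kappa> + 1))" using g \<delta> assms by (intro mult_mono) auto
    then show "\<kappa> * g \<le> 1" using assms by simp
    have "g ^ 3 \<le> g" using g \<delta> power_decreasing[of 1 3 g] by simp
    then have "B * g + \<kappa> * g ^ 3 \<le> B * g + \<kappa> * g" using assms by (simp add: mult_left_mono)
    also have "\<dots> \<le> (B + \<kappa> + 1) * g" using g by (simp add: algebra_simps)
    also have "\<dots> \<le> (B + \<kappa> + 1) * (d / (B + \<kappa> + 1))" using g \<delta> assms by (intro mult_left_mono) auto
    finally show "B * g + \<kappa> * g ^ 3 \<le> d" using assms by simp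
  qed
  then show ?thesis using \<delta>(1) by blast
qed

lemma increment_bound:
  assumes K: "compact K" and F: "\<And>i \<tau>. i < m \<Longrightarrow> \<tau> \<in> forests n \<Longrightarrow> continuous_on K (F i \<tau>)"
  shows "\<exists>B\<ge>0. \<forall>y s t. y \<in> K \<longrightarrow> S \<le> s \<longrightarrow> s \<le> t \<longrightarrow> t \<le> T \<longrightarrow>
    l1 m (\<lambda>i. rough_increment n X (\<lambda>\<tau>. F i \<tau> y) s t) \<le> B * gauge s t"
proof -
  define Q where "Q = {q. fst q \<in> K \<and> S \<le> fst (snd q) \<and> fst (snd q) \<le> snd (snd q) \<and> snd (snd q) \<le> T}"
  let ?P = "principal Q"
  have "(\<lambda>q. rough_increment n X (\<lambda>\<tau>. F i \<tau> (fst q)) (fst (snd q)) (snd (snd q)))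
    \<in> O[?P](\<lambda>q. gauge (fst (snd q)) (snd (snd q)))" if "i < m" for i
    by (rule rough_increment_bigo(3)[where F = "\<lambda>q \<tau>. F i \<tau> (fst q)"])
      (auto simp: eventually_principal Q_def intro!: bounded_comp_bigo[OF K F] that)
  then have "(\<lambda>q. l1 m (\<lambda>i. rough_increment n X (\<lambda>\<tau>. F i \<tau> (fst q)) (fst (snd q)) (snd (snd q))))
    \<in> O[?P](\<lambda>q. gauge (fst (snd q)) (snd (snd q)))"
    by (intro big_sum_in_bigo) simp
  then obtain B where "B \<ge> 0" "\<And>q. q \<in> Q \<Longrightarrow>
      \<bar>l1 m (\<lambda>i. rough_increment n X (\<lambda>\<tau>. F i \<tau> (fst q)) (fst (snd q)) (snd (snd q)))\<bar>
      \<le> B * \<bar>gauge (fst (snd q)) (snd (snd q))\<bar>"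
    unfolding bigo_principal_iff by blast
  then have "l1 m (\<lambda>i. rough_increment n X (\<lambda>\<tau>. F i \<tau> y) s t) \<le> B * gauge s t"
    if "y \<in> K" "S \<le> s" "s \<le> t" "t \<le> T" for y s t
    using that by (force simp: Q_def)
  with \<open>B \<ge> 0\<close> show ?thesis by blast
qed

text \<open>The premise of closeness carries the constant 1, so the set \<open>Q\<close> of
  configurations, and with it \<open>c\<close>, involves no \<kappa>.\<close>

lemma defect_bound:
  assumes W: "openin (Euclidean_space m) W" and K: "compact K" "K \<subseteq> W"
    and F: "\<And>i \<tau>. i < m \<Longrightarrow> \<tau> \<in> forests n \<Longrightarrow> Ck_on m 2 W (F i \<tau>)"
    and adm: "\<And>y i \<alpha> \<beta>. y \<in> K \<Longrightarrow> i < m \<Longrightarrow> \<alpha> \<in> {1..n} \<Longrightarrow> \<beta> \<in> {1..n} \<Longrightarrow>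
      (\<Sum>j<m. partial_deriv j (F i (Vertex \<beta>)) y * F j (Vertex \<alpha>) y)
        = F i (Dot (Upair \<alpha> \<beta>)) y + F i (Stack \<alpha> \<beta>) y"
  shows "\<exists>c\<ge>0. \<forall>y z s u t. y \<in> K \<longrightarrow> z \<in> K \<longrightarrow> S \<le> s \<longrightarrow> s \<le> u \<longrightarrow> u \<le> t \<longrightarrow> t \<le> T \<longrightarrow>
      (\<forall>j<m. \<bar>z j - y j - rough_increment n X (\<lambda>\<tau>. F j \<tau> y) s u\<bar> \<le> gauge s t ^ 2) \<longrightarrow>
      l1 m (\<lambda>i. rough_increment n X (\<lambda>\<tau>. F i \<tau> y) s u + rough_increment n X (\<lambda>\<tau>. F i \<tau> z) u t
        - rough_increment n X (\<lambda>\<tau>. F i \<tau> y) s t) \<le> c * gauge s t ^ 3"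
proof -
  define Y where "Y = (\<lambda>q::(nat \<Rightarrow> real) \<times> (nat \<Rightarrow> real) \<times> real \<times> real \<times> real. fst q)"
  define Z where "Z = (\<lambda>q::(nat \<Rightarrow> real) \<times> (nat \<Rightarrow> real) \<times> real \<times> real \<times> real. fst (snd q))"
  define s where "s = (\<lambda>q::(nat \<Rightarrow> real) \<times> (nat \<Rightarrow> real) \<times> real \<times> real \<times> real. fst (snd (snd q)))"
  define u where "u = (\<lambda>q::(nat \<Rightarrow> real) \<times> (nat \<Rightarrow> real) \<times> real \<times> real \<times> real. fst (snd (snd (snd q))))"
  define t where "t = (\<lambda>q::(nat \<Rightarrow> real) \<times> (nat \<Rightarrow> real) \<times> real \<times> real \<times> real. snd (snd (snd (snd q))))"
  note defs = Y_def Z_def s_def u_def t_def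
  define Q where "Q = {q. Y q \<in> K \<and> Z q \<in> K \<and> S \<le> s q \<and> s q \<le> u q \<and> u q \<le> t q \<and> t q \<le> T \<and>
    (\<forall>j<m. \<bar>Z q j - Y q j - rough_increment n X (\<lambda>\<tau>. F j \<tau> (Y q)) (s q) (u q)\<bar> \<le> gauge (s q) (t q) ^ 2)}"
  let ?D = "\<lambda>q i. rough_increment n X (\<lambda>\<tau>. F i \<tau> (Y q)) (s q) (u q)
      + rough_increment n X (\<lambda>\<tau>. F i \<tau> (Z q)) (u q) (t q)
      - rough_increment n X (\<lambda>\<tau>. F i \<tau> (Y q)) (s q) (t q)"
  have "(\<lambda>q. ?D q i) \<in> O[principal Q](\<lambda>q. gauge (s q) (t q) ^ 3)" if "i < m" for i
  proof (rule euler_defect_bigo[OF W K F adm _ _ that])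
    show "\<forall>\<^sub>F q in principal Q. S \<le> s q \<and> s q \<le> u q \<and> u q \<le> t q \<and> t q \<le> T \<and> Y q \<in> K \<and> Z q \<in> K"
      by (simp add: eventually_principal Q_def)
    show "(\<lambda>q. Z q j - Y q j - rough_increment n X (\<lambda>\<tau>. F j \<tau> (Y q)) (s q) (u q))
       \<in> O[principal Q](\<lambda>q. gauge (s q) (t q) ^ 2)" if "j < m" for j
      unfolding bigo_principal_iff using that by (intro exI[of _ 1]) (auto simp: Q_def)
  qed
  then have "(\<lambda>q. l1 m (?D q)) \<in> O[principal Q](\<lambda>q. gauge (s q) (t q) ^ 3)"
    by (intro big_sum_in_bigo) simp
  then obtain c where c: "c \<ge> 0" "\<And>q. q \<in> Q \<Longrightarrow> \<bar>l1 m (?D q)\<bar> \<le> c * \<bar>gauge (s q) (t q) ^ 3\<bar>"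
    unfolding bigo_principal_iff by blast
  have "l1 m (\<lambda>i. rough_increment n X (\<lambda>\<tau>. F i \<tau> y') s' u' + rough_increment n X (\<lambda>\<tau>. F i \<tau> z') u' t'
        - rough_increment n X (\<lambda>\<tau>. F i \<tau> y') s' t') \<le> c * gauge s' t' ^ 3"
    if "y' \<in> K" "z' \<in> K" "S \<le> s'" "s' \<le> u'" "u' \<le> t'" "t' \<le> T"
      "\<forall>j<m. \<bar>z' j - y' j - rough_increment n X (\<lambda>\<tau>. F j \<tau> y') s' u'\<bar> \<le> gauge s' t' ^ 2" for y' z' s' u' t'
    using c(2)[of "(y', z', s', u', t')"] that by (simp add: Q_def defs sum_nonneg)
  with c(1) show ?thesis by blast
qed

text \<open>The order of choices matters: \<open>B\<close> and \<open>c\<close> depend on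
  \<open>K\<close>, \<kappa> on \<open>c\<close>, and the length of the interval on all of
  them.\<close>

lemma local_solution:
  assumes ST: "S \<le> T" and W: "openin (Euclidean_space m) W" and y0: "y0 \<in> W"
    and F: "\<And>i \<tau>. i < m \<Longrightarrow> \<tau> \<in> forests n \<Longrightarrow> Ck_on m 2 W (F i \<tau>)"
    and adm: "\<And>y i \<alpha> \<beta>. y \<in> W \<Longrightarrow> i < m \<Longrightarrow> \<alpha> \<in> {1..n} \<Longrightarrow> \<beta> \<in> {1..n} \<Longrightarrow>
      (\<Sum>j<m. partial_deriv j (F i (Vertex \<beta>)) y * F j (Vertex \<alpha>) y)
        = F i (Dot (Upair \<alpha> \<beta>)) y + F i (Stack \<alpha> \<beta>) y"
  obtains \<epsilon> C Z where "0 < \<epsilon>" "Z S = y0" "\<And>t. Z t \<in> W" "continuous_on {S..min (S + \<epsilon>) T} Z"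
    "\<And>s t i. S \<le> s \<Longrightarrow> s \<le> t \<Longrightarrow> t \<le> min (S + \<epsilon>) T \<Longrightarrow> i < m \<Longrightarrow>
      \<bar>Z t i - Z s i - rough_increment n X (\<lambda>\<tau>. F i \<tau> (Z s)) s t\<bar> \<le> C * gauge s t ^ 3"
proof -
  have sub: "W \<subseteq> espace m" using W openin_subset topspace_eq_espace by blast
  obtain d0 where d0: "d0 > 0" "cube m y0 d0 \<subseteq> W" using open_contains_cube[OF W y0] by blast
  \<comment> \<open>Halving puts the closed cube of radius \<open>d\<close> inside the open cube of
    radius \<open>d0\<close>.\<close>
  define d where "d = d0 / 2"
  have d: "d > 0" using d0 by (simp add: d_def)
  define K where "K = {v \<in> espace m. \<forall>i<m. \<bar>v i - y0 i\<bar> \<le> d}"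
  have KW: "K \<subseteq> W" using d0 by (force simp: K_def cube_def d_def)
  have K: "compact K" unfolding K_def by (rule compact_closed_cube)
  have cont: "continuous_on K (F i \<tau>)" if "i < m" "\<tau> \<in> forests n" for i \<tau>
    using Ck_on_continuous[OF F[OF that] sub] KW by (rule continuous_on_subset)
  obtain B where B: "B \<ge> 0" "\<And>y s t. y \<in> K \<Longrightarrow> S \<le> s \<Longrightarrow> s \<le> t \<Longrightarrow> t \<le> T \<Longrightarrow>
    l1 m (\<lambda>i. rough_increment n X (\<lambda>\<tau>. F i \<tau> y) s t) \<le> B * gauge s t"
    using increment_bound[OF K, of m F] cont by meson
  have "\<exists>c\<ge>0. \<forall>y z s u t. y \<in> K \<longrightarrow> z \<in> K \<longrightarrow> S \<le> s \<longrightarrow> s \<le> u \<longrightarrow> u \<le> t \<longrightarrow> t \<le> T \<longrightarrow>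
      (\<forall>j<m. \<bar>z j - y j - rough_increment n X (\<lambda>\<tau>. F j \<tau> y) s u\<bar> \<le> gauge s t ^ 2) \<longrightarrow>
      l1 m (\<lambda>i. rough_increment n X (\<lambda>\<tau>. F i \<tau> y) s u + rough_increment n X (\<lambda>\<tau>. F i \<tau> z) u t
        - rough_increment n X (\<lambda>\<tau>. F i \<tau> y) s t) \<le> c * gauge s t ^ 3"
    using KW by (intro defect_bound[OF W K KW F] adm) auto
  then obtain c where c: "0 \<le> c \<and> (\<forall>y z s u t. y \<in> K \<longrightarrow> z \<in> K \<longrightarrow> S \<le> s \<longrightarrow> s \<le> u \<longrightarrow> u \<le> t \<longrightarrow> t \<le> T \<longrightarrow>
      (\<forall>j<m. \<bar>z j - y j - rough_increment n X (\<lambda>\<tau>. F j \<tau> y) s u\<bar> \<le> gauge s t ^ 2) \<longrightarrow>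
      l1 m (\<lambda>i. rough_increment n X (\<lambda>\<tau>. F i \<tau> y) s u + rough_increment n X (\<lambda>\<tau>. F i \<tau> z) u t
        - rough_increment n X (\<lambda>\<tau>. F i \<tau> y) s t) \<le> c * gauge s t ^ 3)" ..
  \<comment> \<open>Positive exactly because \<open>3 / p > 1\<close>: here \<open>p < 3\<close> is
    decisive.\<close>
  define \<rho> where "\<rho> = 1 - 2 powr (1 - 3 / p)"
  have "2 powr (1 - 3 / p) < 2 powr 0" using p1 p3 by (intro powr_less_mono) (auto simp: field_simps)
  then have \<rho>: "\<rho> > 0" by (simp add: \<rho>_def)
  \<comment> \<open>Satisfies the relation between \<kappa> and \<open>c\<close> required for sewing
    with equality.\<close>
  define \<kappa> where "\<kappa> = 2 * c / \<rho>"
  have \<kappa>: "\<kappa> \<ge> 0" "2 * c \<le> \<kappa> * (1 - 2 powr (1 - 3 / p))"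
    using \<rho> conjunct1[OF c] by (auto simp: \<kappa>_def simp flip: \<rho>_def)
  obtain \<delta> where \<delta>: "\<delta> > 0" "\<And>g. 0 \<le> g \<Longrightarrow> g \<le> \<delta> \<Longrightarrow> \<kappa> * g \<le> 1 \<and> B * g + \<kappa> * g ^ 3 \<le> d"
    using small_gauge_exists[OF B(1) \<kappa>(1) d] by blast
  obtain e where e: "e > 0" "\<And>s t. S \<le> s \<Longrightarrow> s \<le> t \<Longrightarrow> t \<le> T \<Longrightarrow> \<bar>s - S\<bar> < e \<Longrightarrow> \<bar>t - S\<bar> < e \<Longrightarrow> gauge s t < \<delta>"
    using gauge_continuous[OF order_refl ST \<delta>(1)] by blast
  \<comment> \<open>The half keeps all times of \<open>[S, b]\<close> strictly within distance
    \<open>e\<close> of \<open>S\<close>.\<close>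
  define b where "b = min (S + e / 2) T"
  have b: "S \<le> b" "b \<le> T" using e(1) ST by (auto simp: b_def)
  have small: "gauge s t \<le> \<delta>" if "S \<le> s" "s \<le> t" "t \<le> b" for s t
    using e(2)[of s t] that e(1) unfolding b_def by (auto intro: less_imp_le)
  interpret euler_scheme S T p n \<omega> X m F y0 b d B c \<kappa> K
  proof unfold_locales
    show "y0 \<in> espace m" using y0 sub by blast
    show "\<kappa> * gauge s t \<le> 1" "B * gauge s t + \<kappa> * gauge s t ^ 3 \<le> d" if "S \<le> s" "s \<le> t" "t \<le> b" for s t
      using \<delta>(2)[OF gauge_nonneg small[OF that]] by auto
    show "l1 m (\<lambda>i. rough_increment n X (\<lambda>\<tau>. F i \<tau> y) s u + rough_increment n X (\<lambda>\<tau>. F i \<tau> z) u t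
        - rough_increment n X (\<lambda>\<tau>. F i \<tau> y) s t) \<le> c * gauge s t ^ 3"
      if "y \<in> K" "z \<in> K" "S \<le> s" "s \<le> u" "u \<le> t" "t \<le> T"
        "\<And>j. j < m \<Longrightarrow> \<bar>z j - y j - rough_increment n X (\<lambda>\<tau>. F j \<tau> y) s u\<bar> \<le> gauge s t ^ 2" for y z s u t
      by (rule conjunct2[OF c, rule_format, OF that(1-6)]) (rule that(7))
    show "0 \<le> c" by (rule conjunct1[OF c])
  qed (fact b cont B(2) \<kappa> K_def)+
  from euler_limit obtain Z where Z': "Z S = y0 \<and> (\<forall>t. Z t \<in> K) \<and> (\<forall>s t. S \<le> s \<longrightarrow> s \<le> t \<longrightarrow> t \<le> b \<longrightarrow>
    l1 m (\<lambda>l. Z t l - Z s l - incr (Z s) s t l) \<le> \<kappa> * \<omega> s t powr (3 / p))" ..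
  then have Z: "Z S = y0" "\<And>t. Z t \<in> K" by auto
  note Z3 = Z'[THEN conjunct2, THEN conjunct2, rule_format]
  have est: "\<bar>Z t i - Z s i - rough_increment n X (\<lambda>\<tau>. F i \<tau> (Z s)) s t\<bar> \<le> \<kappa> * gauge s t ^ 3"
    if "S \<le> s" "s \<le> t" "t \<le> b" "i < m" for s t i
  proof -
    have "\<bar>Z t i - Z s i - incr (Z s) s t i\<bar> \<le> l1 m (\<lambda>l. Z t l - Z s l - incr (Z s) s t l)"
      using that by (intro member_le_sum) auto
    then show ?thesis using Z3[OF that(1-3)] gauge_power[of 3 s t] by simp
  qed
  have modulus: "\<bar>Z t i - Z s i\<bar> \<le> B * gauge s t + \<kappa> * gauge s t ^ 3"
    if "S \<le> s" "s \<le> t" "t \<le> b" "i < m" for s t i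
  proof -
    have "\<bar>incr (Z s) s t i\<bar> \<le> l1 m (incr (Z s) s t)"
      using that by (intro member_le_sum) auto
    then have "\<bar>incr (Z s) s t i\<bar> \<le> B * gauge s t" using B(2)[OF Z(2), of s t s] that b by simp
    then show ?thesis using est[OF that] by linarith
  qed
  have "continuous_on {S..b} (\<lambda>t. Z t i)" for i
  proof (cases "i < m")
    case True
    show ?thesis
      unfolding continuous_on_iff
    proof (intro ballI allI impI)
      fix a \<eta> :: real assume a: "a \<in> {S..b}" and \<eta>: "\<eta> > 0"
      obtain \<delta>' where \<delta>': "\<delta>' > 0" "\<And>g. 0 \<le> g \<Longrightarrow> g \<le> \<delta>' \<Longrightarrow> B * g + \<kappa> * g ^ 3 \<le> \<eta> / 2"
        using small_gauge_exists[OF B(1) \<kappa>(1), of "\<eta> / 2"] \<eta> by auto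
      obtain e' where e': "e' > 0" "\<And>s t. S \<le> s \<Longrightarrow> s \<le> t \<Longrightarrow> t \<le> T \<Longrightarrow> \<bar>s - a\<bar> < e' \<Longrightarrow> \<bar>t - a\<bar> < e' \<Longrightarrow> gauge s t < \<delta>'"
        using gauge_continuous[of a \<delta>'] a b \<delta>'(1) by auto
      have "dist (Z t i) (Z a i) < \<eta>" if t: "t \<in> {S..b}" "dist t a < e'" for t
      proof -
        \<comment> \<open>The modulus is available for ordered times only, while \<open>t\<close>
          may lie on either side of \<open>a\<close>.\<close>
        define s' t' where "s' = min a t" and "t' = max a t"
        have st: "S \<le> s'" "s' \<le> t'" "t' \<le> b" "\<bar>s' - a\<bar> < e'" "\<bar>t' - a\<bar> < e'"
          using a t e'(1) by (auto simp: s'_def t'_def dist_real_def)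
        have "gauge s' t' < \<delta>'" using st b by (intro e'(2)) auto
        then have "\<bar>Z t' i - Z s' i\<bar> \<le> \<eta> / 2"
          using modulus[OF st(1-3) True] \<delta>'(2)[of "gauge s' t'"] by simp
        then have "\<bar>Z t i - Z a i\<bar> \<le> \<eta> / 2"
          by (cases "a \<le> t") (auto simp: s'_def t'_def abs_minus_commute)
        then show ?thesis using \<eta> by (simp add: dist_real_def)
      qed
      then show "\<exists>d>0. \<forall>t\<in>{S..b}. dist t a < d \<longrightarrow> dist (Z t i) (Z a i) < \<eta>" using e'(1) by blast
    qed
  next
    case False
    then have "Z t i = 0" for t using Z(2)[of t] by (auto simp: K_def espace_iff)
    then show ?thesis by simp
  qed
  then have "continuous_on {S..b} Z" by (rule continuous_on_coordinatewise_then_product)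
  then show ?thesis
    using that[of "e / 2" Z \<kappa>] e(1) Z(1,2) KW est unfolding b_def by auto
qed

end

section \<open>Integral curves on the manifold\<close>

locale rough_equation = rough_driver S T p n \<omega> X + admissible_field m M A n f
  for S T p :: real and n :: nat and \<omega> :: "real \<Rightarrow> real \<Rightarrow> real"
    and X :: "forest \<Rightarrow> real \<Rightarrow> real \<Rightarrow> real" and m :: nat
    and M :: "'a topology" and A :: "'a chart set" and f :: "'a \<Rightarrow> 'a velocity"
begin

text \<open>An exact identity: by \<open>X (Dot ..)\<close> being a product of vertex terms, the
  second-order part of the jet action factors into the products \<open>W j * W k\<close> of
  first-level increments.\<close>

lemma rough_increment_change:
  assumes c: "(U, x) \<in> A" "(V, y) \<in> A" and q: "q \<in> U \<inter> V" and i: "i < m"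
    and st: "S \<le> s" "s \<le> t" "t \<le> T"
  defines "g \<equiv> \<lambda>u. transition (U, x) y u i" and "F \<equiv> fiber_coords m n x (f q)"
  defines "W \<equiv> \<lambda>j. \<Sum>\<alpha>=1..n. F j (Vertex \<alpha>) * X (Vertex \<alpha>) s t"
  shows "rough_increment n X (fiber_coords m n y (f q) i) s t
    = (\<Sum>j<m. partial_deriv j g (x q) * rough_increment n X (F j) s t)
      + 1/2 * (\<Sum>j<m. \<Sum>k<m. partial_deriv j (partial_deriv k g) (x q) * (W j * W k))"
proof -
  let ?a = "\<lambda>j. partial_deriv j g (x q)" and ?h = "\<lambda>j k. partial_deriv j (partial_deriv k g) (x q)"
  have lin1: "(\<Sum>\<alpha>=1..n. (\<Sum>j<m. ?a j * H j \<alpha>) * B \<alpha>) = (\<Sum>j<m. ?a j * (\<Sum>\<alpha>=1..n. H j \<alpha> * B \<alpha>))"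
    for H :: "nat \<Rightarrow> nat \<Rightarrow> real" and B :: "nat \<Rightarrow> real"
  proof -
    have "(\<Sum>\<alpha>=1..n. (\<Sum>j<m. ?a j * H j \<alpha>) * B \<alpha>) = (\<Sum>\<alpha>=1..n. \<Sum>j<m. ?a j * (H j \<alpha> * B \<alpha>))"
      by (simp add: sum_distrib_right mult.assoc)
    also have "\<dots> = (\<Sum>j<m. \<Sum>\<alpha>=1..n. ?a j * (H j \<alpha> * B \<alpha>))" by (rule sum.swap)
    finally show ?thesis by (simp add: sum_distrib_left)
  qed
  have lin2: "(\<Sum>\<alpha>=1..n. \<Sum>\<beta>=1..n. (\<Sum>j<m. ?a j * H j \<alpha> \<beta>) * B \<alpha> \<beta>)
     = (\<Sum>j<m. ?a j * (\<Sum>\<alpha>=1..n. \<Sum>\<beta>=1..n. H j \<alpha> \<beta> * B \<alpha> \<beta>))"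
    for H :: "nat \<Rightarrow> nat \<Rightarrow> nat \<Rightarrow> real" and B :: "nat \<Rightarrow> nat \<Rightarrow> real"
  proof -
    have "(\<Sum>\<alpha>=1..n. \<Sum>\<beta>=1..n. (\<Sum>j<m. ?a j * H j \<alpha> \<beta>) * B \<alpha> \<beta>)
      = (\<Sum>\<alpha>=1..n. \<Sum>j<m. ?a j * (\<Sum>\<beta>=1..n. H j \<alpha> \<beta> * B \<alpha> \<beta>))"
      by (simp only: lin1)
    also have "\<dots> = (\<Sum>j<m. \<Sum>\<alpha>=1..n. ?a j * (\<Sum>\<beta>=1..n. H j \<alpha> \<beta> * B \<alpha> \<beta>))" by (rule sum.swap)
    finally show ?thesis by (simp add: sum_distrib_left)
  qed
  have quad: "(\<Sum>\<alpha>=1..n. \<Sum>\<beta>=1..n. (\<Sum>j<m. \<Sum>k<m. ?h j k * F j (Vertex \<alpha>) * F k (Vertex \<beta>)) * (X (Vertex \<alpha>) s t * X (Vertex \<beta>) s t))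
     = (\<Sum>j<m. \<Sum>k<m. ?h j k * (W j * W k))"
  proof -
    have "(\<Sum>\<alpha>=1..n. \<Sum>\<beta>=1..n. (\<Sum>j<m. \<Sum>k<m. ?h j k * F j (Vertex \<alpha>) * F k (Vertex \<beta>)) * (X (Vertex \<alpha>) s t * X (Vertex \<beta>) s t))
      = (\<Sum>\<alpha>=1..n. \<Sum>\<beta>=1..n. \<Sum>j<m. \<Sum>k<m. ?h j k * ((F j (Vertex \<alpha>) * X (Vertex \<alpha>) s t) * (F k (Vertex \<beta>) * X (Vertex \<beta>) s t)))"
      by (simp add: sum_distrib_left sum_distrib_right mult_ac)
    also have "\<dots> = (\<Sum>j<m. \<Sum>k<m. \<Sum>\<alpha>=1..n. \<Sum>\<beta>=1..n. ?h j k * ((F j (Vertex \<alpha>) * X (Vertex \<alpha>) s t) * (F k (Vertex \<beta>) * X (Vertex \<beta>) s t)))"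
      by (rule sum_swap4)
    also have "\<dots> = (\<Sum>j<m. \<Sum>k<m. ?h j k * (W j * W k))"
    proof (intro sum.cong refl)
      fix j k
      have "W j * W k = (\<Sum>\<alpha>=1..n. \<Sum>\<beta>=1..n. (F j (Vertex \<alpha>) * X (Vertex \<alpha>) s t) * (F k (Vertex \<beta>) * X (Vertex \<beta>) s t))"
        by (simp only: W_def sum_product)
      then show "(\<Sum>\<alpha>=1..n. \<Sum>\<beta>=1..n. ?h j k * ((F j (Vertex \<alpha>) * X (Vertex \<alpha>) s t) * (F k (Vertex \<beta>) * X (Vertex \<beta>) s t)))
          = ?h j k * (W j * W k)"
        by (simp only: sum_distrib_left)
    qed
    finally show ?thesis .
  qed
  have vertex: "fiber_coords m n y (f q) i (Vertex \<alpha>) = (\<Sum>j<m. ?a j * F j (Vertex \<alpha>))"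
    if "\<alpha> \<in> {1..n}" for \<alpha>
    unfolding g_def F_def by (rule fiber_coords_change(1)[OF c q i that that])
  have pair: "fiber_coords m n y (f q) i (Stack \<alpha> \<beta>) = (\<Sum>j<m. ?a j * F j (Stack \<alpha> \<beta>))"
    "fiber_coords m n y (f q) i (Dot (Upair \<alpha> \<beta>)) = (\<Sum>j<m. ?a j * F j (Dot (Upair \<alpha> \<beta>)))
        + (\<Sum>j<m. \<Sum>k<m. ?h j k * F j (Vertex \<alpha>) * F k (Vertex \<beta>))"
    if "\<alpha> \<in> {1..n}" "\<beta> \<in> {1..n}" for \<alpha> \<beta>
    unfolding g_def F_def by (rule fiber_coords_change[OF c q i that])+
  have "rough_increment n X (fiber_coords m n y (f q) i) s t =
    (\<Sum>\<alpha>=1..n. (\<Sum>j<m. ?a j * F j (Vertex \<alpha>)) * X (Vertex \<alpha>) s t)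
    + 1/2 * (\<Sum>\<alpha>=1..n. \<Sum>\<beta>=1..n. ((\<Sum>j<m. ?a j * F j (Dot (Upair \<alpha> \<beta>)))
        + (\<Sum>j<m. \<Sum>k<m. ?h j k * F j (Vertex \<alpha>) * F k (Vertex \<beta>))) * (X (Vertex \<alpha>) s t * X (Vertex \<beta>) s t))
    + (\<Sum>\<alpha>=1..n. \<Sum>\<beta>=1..n. (\<Sum>j<m. ?a j * F j (Stack \<alpha> \<beta>)) * X (Stack \<alpha> \<beta>) s t)"
    unfolding rough_increment_eq
    by (simp add: vertex pair X_Dot st del: atLeastAtMost_iff One_nat_def cong: sum.cong)
  also have "\<dots> = (\<Sum>j<m. ?a j * (\<Sum>\<alpha>=1..n. F j (Vertex \<alpha>) * X (Vertex \<alpha>) s t))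
    + 1/2 * ((\<Sum>j<m. ?a j * (\<Sum>\<alpha>=1..n. \<Sum>\<beta>=1..n. F j (Dot (Upair \<alpha> \<beta>)) * (X (Vertex \<alpha>) s t * X (Vertex \<beta>) s t)))
      + (\<Sum>j<m. \<Sum>k<m. ?h j k * (W j * W k)))
    + (\<Sum>j<m. ?a j * (\<Sum>\<alpha>=1..n. \<Sum>\<beta>=1..n. F j (Stack \<alpha> \<beta>) * X (Stack \<alpha> \<beta>) s t))"
    by (simp only: distrib_right sum.distrib lin2 quad) (simp only: lin1)
  also have "\<dots> = (\<Sum>j<m. ?a j * rough_increment n X (F j) s t) + 1/2 * (\<Sum>j<m. \<Sum>k<m. ?h j k * (W j * W k))"
    unfolding rough_increment_eq
    by (simp add: X_Dot st sum.distrib distrib_left sum_distrib_left mult_ac)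
  finally show ?thesis .
qed

text \<open>The quadratic Taylor term of the transition map is exactly what the jet action adds to the
  coordinates of \<open>\<alpha> \<cdot> \<beta>\<close>.\<close>

lemma expansion_change_chart:
  assumes c: "(U, x) \<in> A" "(V, y) \<in> A" and ab: "S \<le> a" "b \<le> T"
    and cont: "continuous_on {a..b} Z" and ZW: "\<And>t. t \<in> {a..b} \<Longrightarrow> Z t \<in> x ` (U \<inter> V)"
    and est: "\<And>s t i. a \<le> s \<Longrightarrow> s \<le> t \<Longrightarrow> t \<le> b \<Longrightarrow> i < m \<Longrightarrow>
      \<bar>Z t i - Z s i - rough_increment n X (\<lambda>\<tau>. local_rep m n (U, x) f i \<tau> (Z s)) s t\<bar> \<le> C * gauge s t ^ 3"
  defines "Y \<equiv> \<lambda>t. inv_into U x (Z t)"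
  shows "\<exists>C>0. \<forall>i<m. \<forall>s t. a \<le> s \<and> s \<le> t \<and> t \<le> b \<longrightarrow>
    \<bar>y (Y t) i - y (Y s) i - rough_increment n X (fiber_coords m n y (f (Y s)) i) s t\<bar> \<le> C * \<omega> s t powr (3 / p)"
proof -
  let ?N = "x ` (U \<inter> V)"
  have N: "openin (Euclidean_space m) ?N" by (rule overlap_image_openin[OF c])
  have sub: "?N \<subseteq> espace m" using N openin_subset topspace_eq_espace by blast
  \<comment> \<open>Compact as a continuous image, but in general not convex; the Taylor bound used
    for it allows this.\<close>
  define K where "K = Z ` {a..b}"
  have K: "compact K" "K \<subseteq> ?N"
    using cont ZW by (auto simp: K_def intro: compact_continuous_image)
  have Y: "Y t \<in> U \<inter> V" "x (Y t) = Z t" if t: "t \<in> {a..b}" for t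
  proof -
    obtain r where "r \<in> U \<inter> V" "Z t = x r" using ZW[OF t] by blast
    then show "Y t \<in> U \<inter> V" "x (Y t) = Z t" using chart_inj[OF c(1)] by (simp_all add: Y_def)
  qed
  define Q where "Q = {q::real \<times> real. a \<le> fst q \<and> fst q \<le> snd q \<and> snd q \<le> b}"
  define Fil where "Fil = principal Q"
  let ?g = "\<lambda>q. gauge (fst q) (snd q)"
  have ev: "\<forall>\<^sub>F q in Fil. S \<le> fst q \<and> fst q \<le> fst q \<and> fst q \<le> snd q \<and> snd q \<le> snd q \<and> snd q \<le> T"
    and ev': "\<forall>\<^sub>F q in Fil. S \<le> fst q \<and> fst q \<le> snd q \<and> snd q \<le> T"
    and evK: "\<forall>\<^sub>F q in Fil. Z (fst q) \<in> K \<and> Z (snd q) \<in> K" and evK1: "\<forall>\<^sub>F q in Fil. Z (fst q) \<in> K"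
    using ab by (auto simp: Fil_def eventually_principal Q_def K_def)
  have bounded: "(\<lambda>q. G (Z (fst q))) \<in> O[Fil](\<lambda>_. 1)" if "Ck_on m k ?N G" for k G
    using continuous_on_subset[OF Ck_on_continuous[OF that sub] K(2)]
    by (rule bounded_comp_bigo[OF K(1) _ evK1])
  have mult1: "(\<lambda>q. g q * h q) \<in> O[Fil](k)" if "g \<in> O[Fil](\<lambda>_. 1)" "h \<in> O[Fil](k)"
    for g h k :: "real \<times> real \<Rightarrow> real"
    using landau_o.big.mult[OF that] by simp
  define F where "F q j \<tau> = local_rep m n (U, x) f j \<tau> (Z (fst q))" for q :: "real \<times> real" and j \<tau>
  define D where "D j q = Z (snd q) j - Z (fst q) j" for j q
  define J where "J j q = rough_increment n X (F q j) (fst q) (snd q)" for j q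
  define W where "W j q = (\<Sum>\<alpha>=1..n. F q j (Vertex \<alpha>) * X (Vertex \<alpha>) (fst q) (snd q))" for j q
  have F1: "(\<lambda>q. F q j \<tau>) \<in> O[Fil](\<lambda>_. 1)" if "j < m" "\<tau> \<in> forests n" for j \<tau>
    unfolding F_def by (rule bounded, rule Ck_on_subset[OF local_rep_Ck_on[OF c(1) that]]) auto
  have DJ: "(\<lambda>q. D j q - J j q) \<in> O[Fil](\<lambda>q. ?g q ^ 3)" if "j < m" for j
    using est that by (intro bigoI[of _ C]) (auto simp: Fil_def eventually_principal Q_def D_def J_def F_def[abs_def])
  have JW: "(\<lambda>q. J j q - W j q) \<in> O[Fil](\<lambda>q. ?g q ^ 2)" and W1: "W j \<in> O[Fil](?g)"
    and J1: "J j \<in> O[Fil](?g)" if "j < m" for j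
    using rough_increment_bigo[where F = "\<lambda>q. F q j", OF ev F1[OF that]] unfolding J_def W_def by auto
  have DW: "(\<lambda>q. D j q - W j q) \<in> O[Fil](\<lambda>q. ?g q ^ 2)" if "j < m" for j
  proof -
    have "(\<lambda>q. (D j q - J j q) + (J j q - W j q)) \<in> O[Fil](\<lambda>q. ?g q ^ 2)"
      using bigo_gauge_weaken[OF ev' DJ[OF that], of 2] JW[OF that] by (intro sum_in_bigo(1)) simp_all
    moreover have "(D j q - J j q) + (J j q - W j q) = D j q - W j q" for q by simp
    ultimately show ?thesis by (simp only:)
  qed
  have D1: "D j \<in> O[Fil](?g)" if "j < m" for j
  proof -
    have "(\<lambda>q. (D j q - J j q) + J j q) \<in> O[Fil](?g)"
      using bigo_gauge_weaken[OF ev' DJ[OF that], of 1] J1[OF that] by (intro sum_in_bigo(1)) simp_all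
    then show ?thesis by simp
  qed
  have main: "(\<lambda>q. y (Y (snd q)) i - y (Y (fst q)) i
      - rough_increment n X (fiber_coords m n y (f (Y (fst q))) i) (fst q) (snd q)) \<in> O[Fil](\<lambda>q. ?g q ^ 3)"
    if i: "i < m" for i
  proof -
    define g where "g u = transition (U, x) y u i" for u
    have g: "Ck_on m k ?N g" for k
      unfolding g_def by (rule smooth_map_on_Ck_on[OF transition_smooth[OF c] i])
    let ?a = "\<lambda>j q. partial_deriv j g (Z (fst q))"
    let ?h = "\<lambda>j k q. partial_deriv j (partial_deriv k g) (Z (fst q))"
    have a1: "?a j \<in> O[Fil](\<lambda>_. 1)" if "j < m" for j
      using Ck_on_partial[OF g[of "Suc 0"] that] by (rule bounded)
    have h1: "?h j k \<in> O[Fil](\<lambda>_. 1)" if "j < m" "k < m" for j k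
      using Ck_on_partial[OF Ck_on_partial[OF g[of "Suc (Suc 0)"] that(2)] that(1)] by (rule bounded)
    \<comment> \<open>This sum equals \<open>D j q * D k q - W j q * W k q\<close>. Taylor's
      quadratic term has the full displacements \<open>D\<close>, the rough increment only their
      first-level parts \<open>W\<close>; the difference has order three.\<close>
    have DD: "(\<lambda>q. (D j q - W j q) * D k q + (D k q - W k q) * W j q) \<in> O[Fil](\<lambda>q. ?g q ^ 3)"
      if "j < m" "k < m" for j k
      using landau_o.big.mult[OF DW[OF that(1)] D1[OF that(2)]] landau_o.big.mult[OF DW[OF that(2)] W1[OF that(1)]]
      by (intro sum_in_bigo(1)) (simp_all add: power3_eq_cube power2_eq_square)
    \<comment> \<open>Order three is needed: a quadratic expansion of the transition map leaves an
      error of the size allowed for an integral curve.\<close>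
    define r where "r q = taylor_remainder m 3 g (Z (fst q)) (Z (snd q))" for q
    have "r \<in> O[Fil](\<lambda>q. ?g q ^ 3)"
      unfolding r_def by (rule taylor_bigo[OF N g _ K evK]) (use D1 in \<open>simp_all add: D_def[abs_def]\<close>)
    moreover have "(\<lambda>q. \<Sum>j<m. ?a j q * (D j q - J j q)) \<in> O[Fil](\<lambda>q. ?g q ^ 3)"
      by (intro big_sum_in_bigo mult1 a1 DJ) auto
    moreover have "(\<lambda>q. 1/2 * (\<Sum>j<m. \<Sum>k<m. ?h j k q * ((D j q - W j q) * D k q + (D k q - W k q) * W j q)))
       \<in> O[Fil](\<lambda>q. ?g q ^ 3)"
      by (intro landau_o.big.cmult_in_iff[THEN iffD2] big_sum_in_bigo mult1 h1 DD) auto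
    ultimately have "(\<lambda>q. r q + (\<Sum>j<m. ?a j q * (D j q - J j q))
       + 1/2 * (\<Sum>j<m. \<Sum>k<m. ?h j k q * ((D j q - W j q) * D k q + (D k q - W k q) * W j q)))
       \<in> O[Fil](\<lambda>q. ?g q ^ 3)" (is "?k \<in> _")
      by (intro sum_in_bigo(1))
    moreover have "\<forall>\<^sub>F q in Fil. ?k q = y (Y (snd q)) i - y (Y (fst q)) i
      - rough_increment n X (fiber_coords m n y (f (Y (fst q))) i) (fst q) (snd q)"
      unfolding Fil_def eventually_principal
    proof
      fix q assume q: "q \<in> Q"
      then have mem: "fst q \<in> {a..b}" "snd q \<in> {a..b}" and st: "S \<le> fst q" "fst q \<le> snd q" "snd q \<le> T"
        using ab by (auto simp: Q_def)
      note Y1 = Y[OF mem(1)] and Y2 = Y[OF mem(2)]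
      have gY: "g (Z (fst q)) = y (Y (fst q)) i" "g (Z (snd q)) = y (Y (snd q)) i"
        using Y1 Y2 transition_apply[OF c(1)] unfolding g_def by (metis IntD1)+
      have Fq: "F q j = fiber_coords m n x (f (Y (fst q))) j" for j
        using local_rep_apply[OF c(1), of "Y (fst q)"] Y1 by (auto simp: F_def fun_eq_iff)
      have incr: "rough_increment n X (fiber_coords m n y (f (Y (fst q))) i) (fst q) (snd q)
        = (\<Sum>j<m. ?a j q * J j q) + 1/2 * (\<Sum>j<m. \<Sum>k<m. ?h j k q * (W j q * W k q))"
        using rough_increment_change[OF c Y1(1) i st]
        by (simp add: J_def W_def Fq Y1(2) g_def[abs_def])
      have "(\<Sum>j<m. D j q * (\<Sum>k<m. D k q * ?h k j q)) = (\<Sum>j<m. \<Sum>k<m. ?h j k q * (D j q * D k q))"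
      proof -
        have "(\<Sum>j<m. D j q * (\<Sum>k<m. D k q * ?h k j q)) = (\<Sum>j<m. \<Sum>k<m. ?h k j q * (D k q * D j q))"
          by (simp add: sum_distrib_left mult_ac)
        also have "\<dots> = (\<Sum>j<m. \<Sum>k<m. ?h j k q * (D j q * D k q))" by (rule sum.swap)
        finally show ?thesis .
      qed
      then have r: "r q = g (Z (snd q)) - g (Z (fst q)) - (\<Sum>j<m. ?a j q * D j q)
          - 1/2 * (\<Sum>j<m. \<Sum>k<m. ?h j k q * (D j q * D k q))"
        unfolding r_def taylor_remainder_def D_def[symmetric]
        by (simp add: numeral_3_eq_3 mult.commute)
      have quad: "(\<Sum>j<m. \<Sum>k<m. ?h j k q * ((D j q - W j q) * D k q + (D k q - W k q) * W j q))
        = (\<Sum>j<m. \<Sum>k<m. ?h j k q * (D j q * D k q)) - (\<Sum>j<m. \<Sum>k<m. ?h j k q * (W j q * W k q))"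
        unfolding sum_subtractf[symmetric] by (intro sum.cong refl) (simp add: algebra_simps)
      show "?k q = y (Y (snd q)) i - y (Y (fst q)) i
      - rough_increment n X (fiber_coords m n y (f (Y (fst q))) i) (fst q) (snd q)"
        unfolding incr quad r gY by (simp add: right_diff_distrib sum_subtractf)
    qed
    ultimately show ?thesis by (simp add: landau_o.big.in_cong)
  qed
  have "(\<lambda>q. \<Sum>i<m. \<bar>y (Y (snd q)) i - y (Y (fst q)) i
      - rough_increment n X (fiber_coords m n y (f (Y (fst q))) i) (fst q) (snd q)\<bar>) \<in> O[Fil](\<lambda>q. ?g q ^ 3)"
    using main by (intro big_sum_in_bigo) simp
  then obtain C' where C': "C' \<ge> 0" "\<forall>q\<in>Q. \<bar>\<Sum>i<m. \<bar>y (Y (snd q)) i - y (Y (fst q)) i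
      - rough_increment n X (fiber_coords m n y (f (Y (fst q))) i) (fst q) (snd q)\<bar>\<bar> \<le> C' * \<bar>?g q ^ 3\<bar>"
    unfolding Fil_def bigo_principal_iff by blast
  have "\<bar>y (Y t) i - y (Y s) i - rough_increment n X (fiber_coords m n y (f (Y s)) i) s t\<bar>
      \<le> (C' + 1) * \<omega> s t powr (3 / p)" if i: "i < m" and st: "a \<le> s" "s \<le> t" "t \<le> b" for i s t
  proof -
    let ?e = "\<lambda>i. y (Y t) i - y (Y s) i - rough_increment n X (fiber_coords m n y (f (Y s)) i) s t"
    have "\<bar>?e i\<bar> \<le> l1 m ?e" using i by (intro member_le_sum) auto
    also have "\<dots> \<le> C' * gauge s t ^ 3"
      using bspec[OF C'(2), of "(s, t)"] st by (simp add: Q_def sum_nonneg)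
    \<comment> \<open>An integral curve requires a positive constant, and \<open>C'\<close> may be
      0.\<close>
    also have "\<dots> \<le> (C' + 1) * gauge s t ^ 3" by (intro mult_right_mono) auto
    finally show ?thesis using gauge_power[of 3 s t] by simp
  qed
  then show ?thesis using C'(1) by (intro exI[of _ "C' + 1"]) auto
qed

text \<open>The equation is solved in one chart around \<open>Y0\<close> and the solution stays in
  its domain. The definition of an integral curve quantifies over all charts, and the change of
  chart covers each of them, the original one included.\<close>

lemma local_existence:
  assumes ST: "S \<le> T" and Y0: "Y0 \<in> topspace M"
  shows "\<exists>\<epsilon>>0. \<exists>Y. integral_curve m n M A f p \<omega> X S (min (S + \<epsilon>) T) Y \<and> Y S = Y0"
proof -
  have "(\<Union>c\<in>A. fst c) = topspace M" using smooth_manifold unfolding smooth_manifold_def by (elim conjE)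
  with Y0 obtain c0 where "c0 \<in> A" "Y0 \<in> fst c0" by blast
  then obtain U x where c: "(U, x) \<in> A" and Y0U: "Y0 \<in> U" by (cases c0) auto
  let ?W = "x ` U"
  have W: "openin (Euclidean_space m) ?W" using chart_image_openin[OF c] chart_openin[OF c] by blast
  obtain \<epsilon> C Z where \<epsilon>: "0 < \<epsilon>" and Z: "Z S = x Y0" "\<And>t. Z t \<in> ?W" "continuous_on {S..min (S + \<epsilon>) T} Z"
    and est: "\<And>s t i. S \<le> s \<Longrightarrow> s \<le> t \<Longrightarrow> t \<le> min (S + \<epsilon>) T \<Longrightarrow> i < m \<Longrightarrow>
      \<bar>Z t i - Z s i - rough_increment n X (\<lambda>\<tau>. local_rep m n (U, x) f i \<tau> (Z s)) s t\<bar> \<le> C * gauge s t ^ 3"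
  proof (rule local_solution[OF ST W, of "x Y0" "local_rep m n (U, x) f"])
    show "x Y0 \<in> ?W" using Y0U by blast
    show "Ck_on m 2 ?W (local_rep m n (U, x) f i \<tau>)" if "i < m" "\<tau> \<in> forests n" for i \<tau>
      by (rule local_rep_Ck_on[OF c that])
    show "(\<Sum>j<m. partial_deriv j (local_rep m n (U, x) f i (Vertex \<beta>)) v * local_rep m n (U, x) f j (Vertex \<alpha>) v)
        = local_rep m n (U, x) f i (Dot (Upair \<alpha> \<beta>)) v + local_rep m n (U, x) f i (Stack \<alpha> \<beta>) v"
      if v: "v \<in> ?W" and i: "i < m" "\<alpha> \<in> {1..n}" "\<beta> \<in> {1..n}" for v i \<alpha> \<beta>
    proof -
      obtain r where r: "r \<in> U" "v = x r" using v by blast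
      show ?thesis using admissible_in_chart[OF c r(1) i] by (simp add: r local_rep_apply[OF c])
    qed
  qed blast
  define b where "b = min (S + \<epsilon>) T"
  define Y where "Y t = inv_into U x (Z t)" for t
  have YU: "Y t \<in> U" "x (Y t) = Z t" for t
    using Z(2)[of t] by (auto simp: Y_def inv_into_into f_inv_into_f)
  have "continuous_map (top_of_set {S..b}) M Y"
  proof -
    \<comment> \<open>The inverse homeomorphism of the chart provides continuity of
      \<open>Y\<close>; it agrees with \<open>inv_into\<close> along the curve.\<close>
    obtain h where h: "homeomorphic_maps (subtopology M U) (subtopology (Euclidean_space m) ?W) x h"
      using chart_homeomorphic[OF c] homeomorphic_map_maps by blast
    have "continuous_map (top_of_set {S..b}) (subtopology (Euclidean_space m) ?W) Z"
      using W Z(2,3) subtopology_Euclidean_space[of ?W m] openin_subset[OF W]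
      by (auto simp: continuous_map_in_subtopology b_def topspace_eq_espace)
    then have "continuous_map (top_of_set {S..b}) (subtopology M U) (h \<circ> Z)"
      using h unfolding homeomorphic_maps_def by (intro continuous_map_compose) auto
    moreover have "h \<circ> Z = Y"
    proof
      fix t
      have "Y t \<in> topspace (subtopology M U)"
        using YU(1)[of t] openin_subset[OF chart_openin[OF c]] by auto
      then have "h (x (Y t)) = Y t" using h unfolding homeomorphic_maps_def by blast
      then show "(h \<circ> Z) t = Y t" by (simp add: YU(2))
    qed
    ultimately show ?thesis by (simp add: continuous_map_in_subtopology)
  qed
  moreover have "\<exists>C>0. \<forall>i<m. \<forall>s t. c' \<le> s \<and> s \<le> t \<and> t \<le> d' \<longrightarrow>
           \<bar>y (Y t) i - y (Y s) i
             - (\<Sum>\<tau>\<in>forests n. 1 / symmetry_factor \<tau> * fiber_coords m n y (f (Y s)) i \<tau> * X \<tau> s t)\<bar>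
           \<le> C * \<omega> s t powr (3 / p)"
    if "S \<le> c'" "d' \<le> b" "(V, y) \<in> A" "Y ` {c'..d'} \<subseteq> V" for c' d' V y
    unfolding rough_increment_def[symmetric] Y_def
  proof (rule expansion_change_chart[OF c that(3) that(1)])
    show "d' \<le> T" using that by (simp add: b_def)
    show "continuous_on {c'..d'} Z" using Z(3) by (rule continuous_on_subset) (use that in \<open>auto simp: b_def\<close>)
    show "Z t \<in> x ` (U \<inter> V)" if "t \<in> {c'..d'}" for t
      using YU[of t] that \<open>Y ` {c'..d'} \<subseteq> V\<close> by (metis IntI imageI subsetD)
    show "\<bar>Z t i - Z s i - rough_increment n X (\<lambda>\<tau>. local_rep m n (U, x) f i \<tau> (Z s)) s t\<bar> \<le> C * gauge s t ^ 3"
      if "c' \<le> s" "s \<le> t" "t \<le> d'" "i < m" for s t i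
      using \<open>S \<le> c'\<close> \<open>d' \<le> b\<close> that by (intro est) (auto simp: b_def)
  qed
  ultimately have "integral_curve m n M A f p \<omega> X S b Y"
    unfolding integral_curve_def by blast
  moreover have "Y S = Y0" using Z(1) Y0U chart_inj[OF c] by (simp add: Y_def)
  ultimately show ?thesis using \<epsilon> unfolding b_def by blast
qed

end

theorem theorem4p27:
  fixes S T p :: real and n m :: nat
    and \<omega> :: "real \<Rightarrow> real \<Rightarrow> real"
    and X :: "forest \<Rightarrow> real \<Rightarrow> real \<Rightarrow> real"
    and M :: "'a topology" and A :: "'a chart set"
    and f :: "'a \<Rightarrow> 'a velocity" and Y0 :: 'a
  assumes "S \<le> T" and "1 \<le> p" and "p < 3"
    and "control S T \<omega>"
    and "branched_rough_path n S T p \<omega> X"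
    and "smooth_manifold m M A"
    and "rough_velocity_field m n M A f"
    and "admissible m n M A f"
    and "Y0 \<in> topspace M"
  shows "\<exists>\<epsilon>>0. \<exists>Y. integral_curve m n M A f p \<omega> X S (min (S + \<epsilon>) T) Y \<and> Y S = Y0"
proof -
  interpret rough_equation S T p n \<omega> X m M A f
    using assms by unfold_locales
  show ?thesis using assms by (intro local_existence)
qed

end
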